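(* Let $\mathcal K$ be a triangulated category, $\mathcal E$ a Frobenius class of triangles in $\mathcal K$, and $\pi\colon\mathcal K\to\underline{\mathcal K}_{\mathcal E}$ the corresponding quotient functor to the relative stable category. Let $\mathcal M=\operatorname{thick}_{\mathcal K}(\operatorname{proj}(\mathcal E))$ be the thick subcategory of $\mathcal K$ generated by the $\mathcal E$-projective-injectives. Then: (a) The full subcategory $\pi(\mathcal M)$ is thick in $\underline{\mathcal K}_{\mathcal E}$. (b) The functor $\pi$ induces an equivalence of the Verdier quotients $\bar\pi\colon\mathcal K/\!\!/\mathcal M\xrightarrow{\sim}\underline{\mathcal K}_{\mathcal E}/\!\!/\pi(\mathcal M)$. (c) The functor $\bar\pi$ is exact.
   Context: Standing assumption: $\mathcal K$ is essentially small, with suspension $\Sigma$. Subcategories are full and replete; a thick subcategory is a triangulated subcategory closed under direct summands. $\mathcal T/\!\!/\mathcal J$ denotes the Verdier quotient of a triangulated category $\mathcal T$ by a thick subcategory $\mathcal J$. Let $\mathcal E$ be a family of distinguished triangles $X\xrightarrow{f}Y\xrightarrow{g}Z\xrightarrow{h}\Sigma X$ in $\mathcal K$; for a triangle in $\mathcal E$ one calls $f$ an $\mathcal E$-monomorphism, $g$ an $\mathcal E$-epimorphism and $h$ an $\mathcal E$-phantom. $\mathcal E$ is a proper class of triangles if it is closed under isomorphisms, suspension (triple rotation), finite sums and retracts; contains all triangles $X\xrightarrow{\mathrm{id}}X\to0\to\Sigma X$ and $0\to Y\xrightarrow{\mathrm{id}}Y\to0$; $\mathcal E$-monomorphisms are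 closed under homotopy pushouts and $\mathcal E$-epimorphisms under homotopy pullbacks (along arbitrary morphisms); and $\mathcal E$ is saturated: if the homotopy pullback of a morphism $g$ along an $\mathcal E$-epimorphism is an $\mathcal E$-epimorphism, then $g$ is an $\mathcal E$-epimorphism. An object $P$ is $\mathcal E$-projective if $0\to\mathcal K(P,X)\to\mathcal K(P,Y)\to\mathcal K(P,Z)\to0$ is exact for every triangle in $\mathcal E$; $\mathcal E$-injectives are defined dually; $\operatorname{proj}(\mathcal E)$ and $\operatorname{inj}(\mathcal E)$ denote the classes of these. $\mathcal E$ has enough projectives (injectives) if every $X$ admits an $\mathcal E$-epimorphism $P\to X$ with $P\in\operatorname{proj}(\mathcal E)$ (an $\mathcal E$-monomorphism $X\to I$ with $I\in\operatorname{inj}(\mathcal E)$). $\mathcal E$ is Frobenius if it is a proper class with enough projectives, enough injectives and $\operatorname{proj}(\mathcal E)=\operatorname{inj}(\mathcal E)$. For $\mathcal E$ Frobenius, the relative stable category is the additive quotient $\pi\colon\mathcal K\to\underline{\mathcal K}_{\mathcal E}=\mathcal K/\operatorname{proj}(\mathcal E)$ (same objects, morphisms modulo those factoring through an object of $\operatorname{proj}(\mathcal E)$). It is triangulated (Beligiannis): for each $X$ choose an $\mathcal E$-monomorphism $i_X\colon X\to X_{\mathcal E}$ with $X_{\mathcal E}\in\operatorname{inj}(\mathcal E)$ and a distinguished triangle $X\xrightarrow{i_X}X_{\mathcal E}\to X'\to\Sigma X$, and set $\Sigma_{\mathcal E}X=\pi(X')$. For $f\colon X\to Y$ in $\mathcal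 K$ form the homotopy pushout $Z$ of $X_{\mathcal E}\leftarrow X\xrightarrow{f}Y$ and the induced map from $X\to X_{\mathcal E}\to X'\to\Sigma X$ to the distinguished triangle $Y\xrightarrow{g}Z\xrightarrow{h}X'\to\Sigma Y$ which is the identity on $X'$; the distinguished triangles in $\underline{\mathcal K}_{\mathcal E}$ are those isomorphic to some $X\xrightarrow{\pi f}Y\xrightarrow{\pi g}Z\xrightarrow{\pi h}\Sigma_{\mathcal E}X$. ($\pi$ itself is in general not exact.) *)

theory Defs
  imports "HOL-Algebra.Group"
begin

text \<open>
  A category with objects in \<open>'o\<close> and arrows in \<open>'m\<close>. The hom-sets of a preadditive category carry
  the group operation \<open>Add\<close> with neutral elements \<open>Zer X Y\<close>. Every field is only meaningful on the
  carriers \<open>Obj\<close> and \<open>Arr\<close>, and \<open>g \<cdot> f\<close> only when the codomain of \<open>f\<close> is the domain of \<open>g\<close>.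
\<close>

record ('o, 'm) precat =
  Obj :: "'o set"
  Arr :: "'m set"
  Dom :: "'m \<Rightarrow> 'o"
  Cod :: "'m \<Rightarrow> 'o"
  Ide :: "'o \<Rightarrow> 'm"
  Cmp :: "'m \<Rightarrow> 'm \<Rightarrow> 'm"  (infixr "\<cdot>\<index>" 75)
  Add :: "'m \<Rightarrow> 'm \<Rightarrow> 'm"
  Zer :: "'o \<Rightarrow> 'o \<Rightarrow> 'm"

definition Hom :: "('o, 'm, 'z) precat_scheme \<Rightarrow> 'o \<Rightarrow> 'o \<Rightarrow> 'm set" where
  "Hom K X Y = {f \<in> Arr K. Dom K f = X \<and> Cod K f = Y}"

definition hom_group :: "('o, 'm, 'z) precat_scheme \<Rightarrow> 'o \<Rightarrow> 'o \<Rightarrow> 'm monoid" where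
  "hom_group K X Y = \<lparr>carrier = Hom K X Y, mult = Add K, one = Zer K X Y\<rparr>"

definition Neg :: "('o, 'm, 'z) precat_scheme \<Rightarrow> 'm \<Rightarrow> 'm" where
  "Neg K f = inv\<^bsub>hom_group K (Dom K f) (Cod K f)\<^esub> f"

definition Sub :: "('o, 'm, 'z) precat_scheme \<Rightarrow> 'm \<Rightarrow> 'm \<Rightarrow> 'm" where
  "Sub K f g = Add K f (Neg K g)"

locale category =
  fixes K :: "('o, 'm, 'z) precat_scheme" (structure)
  assumes Dom_Obj: "f \<in> Arr K \<Longrightarrow> Dom K f \<in> Obj K"
    and Cod_Obj: "f \<in> Arr K \<Longrightarrow> Cod K f \<in> Obj K"
    and Ide_Hom: "X \<in> Obj K \<Longrightarrow> Ide K X \<in> Hom K X X"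
    and Cmp_Hom: "f \<in> Hom K X Y \<Longrightarrow> g \<in> Hom K Y Z \<Longrightarrow> g \<cdot> f \<in> Hom K X Z"
    and Cmp_assoc: "f \<in> Hom K W X \<Longrightarrow> g \<in> Hom K X Y \<Longrightarrow> h \<in> Hom K Y Z \<Longrightarrow>
                    (h \<cdot> g) \<cdot> f = h \<cdot> (g \<cdot> f)"
    and Cmp_Ide: "f \<in> Hom K X Y \<Longrightarrow> f \<cdot> Ide K X = f"
    and Ide_Cmp: "f \<in> Hom K X Y \<Longrightarrow> Ide K Y \<cdot> f = f"

definition is_iso :: "('o, 'm, 'z) precat_scheme \<Rightarrow> 'm \<Rightarrow> bool" where
  "is_iso K f \<longleftrightarrow> f \<in> Arr K \<and>
     (\<exists>g \<in> Hom K (Cod K f) (Dom K f).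
        g \<cdot>\<^bsub>K\<^esub> f = Ide K (Dom K f) \<and> f \<cdot>\<^bsub>K\<^esub> g = Ide K (Cod K f))"

record ('o, 'm, 'p, 'n) fctr =
  FO :: "'o \<Rightarrow> 'p"
  FA :: "'m \<Rightarrow> 'n"

definition is_functor ::
  "('o, 'm, 'y) precat_scheme \<Rightarrow> ('p, 'n, 'z) precat_scheme \<Rightarrow> ('o, 'm, 'p, 'n) fctr \<Rightarrow> bool" where
  "is_functor C D F \<longleftrightarrow> category C \<and> category D \<and>
     (\<forall>X \<in> Obj C. FO F X \<in> Obj D) \<and>
     (\<forall>f \<in> Arr C. FA F f \<in> Hom D (FO F (Dom C f)) (FO F (Cod C f))) \<and>
     (\<forall>X \<in> Obj C. FA F (Ide C X) = Ide D (FO F X)) \<and>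
     (\<forall>f \<in> Arr C. \<forall>g \<in> Arr C. Cod C f = Dom C g \<longrightarrow>
        FA F (g \<cdot>\<^bsub>C\<^esub> f) = FA F g \<cdot>\<^bsub>D\<^esub> FA F f)"

definition id_fctr :: "('o, 'm, 'o, 'm) fctr" where
  "id_fctr = \<lparr>FO = id, FA = id\<rparr>"

definition comp_fctr ::
  "('p, 'n, 'q, 'k) fctr \<Rightarrow> ('o, 'm, 'p, 'n) fctr \<Rightarrow> ('o, 'm, 'q, 'k) fctr"
  (infixl "\<circ>\<circ>" 55) where
  "G \<circ>\<circ> F = \<lparr>FO = FO G \<circ> FO F, FA = FA G \<circ> FA F\<rparr>"

text \<open>Equality of functors means equality on the carriers of the source category.\<close>

definition fctr_eq ::
  "('o, 'm, 'z) precat_scheme \<Rightarrow> ('o, 'm, 'p, 'n) fctr \<Rightarrow> ('o, 'm, 'p, 'n) fctr \<Rightarrow> bool" where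
  "fctr_eq C F G \<longleftrightarrow> (\<forall>X \<in> Obj C. FO F X = FO G X) \<and> (\<forall>f \<in> Arr C. FA F f = FA G f)"

definition natural_iso ::
  "('o, 'm, 'y) precat_scheme \<Rightarrow> ('p, 'n, 'z) precat_scheme \<Rightarrow>
   ('o, 'm, 'p, 'n) fctr \<Rightarrow> ('o, 'm, 'p, 'n) fctr \<Rightarrow> ('o \<Rightarrow> 'n) \<Rightarrow> bool" where
  "natural_iso C D F G \<eta> \<longleftrightarrow>
     (\<forall>X \<in> Obj C. \<eta> X \<in> Hom D (FO F X) (FO G X) \<and> is_iso D (\<eta> X)) \<and>
     (\<forall>f \<in> Arr C. \<eta> (Cod C f) \<cdot>\<^bsub>D\<^esub> FA F f = FA G f \<cdot>\<^bsub>D\<^esub> \<eta> (Dom C f))"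

definition is_equivalence ::
  "('o, 'm, 'y) precat_scheme \<Rightarrow> ('p, 'n, 'z) precat_scheme \<Rightarrow> ('o, 'm, 'p, 'n) fctr \<Rightarrow> bool" where
  "is_equivalence C D F \<longleftrightarrow> is_functor C D F \<and>
     (\<exists>G. is_functor D C G \<and>
        (\<exists>\<eta>. natural_iso C C (G \<circ>\<circ> F) id_fctr \<eta>) \<and>
        (\<exists>\<epsilon>. natural_iso D D (F \<circ>\<circ> G) id_fctr \<epsilon>))"

definition is_additive ::
  "('o, 'm, 'y) precat_scheme \<Rightarrow> ('p, 'n, 'z) precat_scheme \<Rightarrow> ('o, 'm, 'p, 'n) fctr \<Rightarrow> bool" where
  "is_additive C D F \<longleftrightarrow> is_functor C D F \<and>
     (\<forall>X \<in> Obj C. \<forall>Y \<in> Obj C. FA F \<in> hom (hom_group C X Y) (hom_group D (FO F X) (FO F Y)))"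

definition is_zero :: "('o, 'm, 'z) precat_scheme \<Rightarrow> 'o \<Rightarrow> bool" where
  "is_zero K Z \<longleftrightarrow> Z \<in> Obj K \<and>
     (\<forall>X \<in> Obj K. (\<exists>!f. f \<in> Hom K X Z) \<and> (\<exists>!f. f \<in> Hom K Z X))"

definition is_biproduct ::
  "('o, 'm, 'z) precat_scheme \<Rightarrow> 'o \<Rightarrow> 'o \<Rightarrow> 'o \<Rightarrow> 'm \<Rightarrow> 'm \<Rightarrow> 'm \<Rightarrow> 'm \<Rightarrow> bool" where
  "is_biproduct K X Y B i j p q \<longleftrightarrow>
     X \<in> Obj K \<and> Y \<in> Obj K \<and> B \<in> Obj K \<and>
     i \<in> Hom K X B \<and> j \<in> Hom K Y B \<and> p \<in> Hom K B X \<and> q \<in> Hom K B Y \<and>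
     p \<cdot>\<^bsub>K\<^esub> i = Ide K X \<and> q \<cdot>\<^bsub>K\<^esub> j = Ide K Y \<and>
     p \<cdot>\<^bsub>K\<^esub> j = Zer K Y X \<and> q \<cdot>\<^bsub>K\<^esub> i = Zer K X Y \<and>
     Add K (i \<cdot>\<^bsub>K\<^esub> p) (j \<cdot>\<^bsub>K\<^esub> q) = Ide K B"

locale additive_category = category K
  for K :: "('o, 'm, 'z) precat_scheme" (structure) +
  assumes Hom_group: "X \<in> Obj K \<Longrightarrow> Y \<in> Obj K \<Longrightarrow> comm_group (hom_group K X Y)"
    and Cmp_Add: "f \<in> Hom K X Y \<Longrightarrow> f' \<in> Hom K X Y \<Longrightarrow> g \<in> Hom K Y Z \<Longrightarrow>
                  g \<cdot> Add K f f' = Add K (g \<cdot> f) (g \<cdot> f')"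
    and Add_Cmp: "f \<in> Hom K X Y \<Longrightarrow> g \<in> Hom K Y Z \<Longrightarrow> g' \<in> Hom K Y Z \<Longrightarrow>
                  Add K g g' \<cdot> f = Add K (g \<cdot> f) (g' \<cdot> f)"
    and zero_ex: "\<exists>Z. is_zero K Z"
    and biproduct_ex: "X \<in> Obj K \<Longrightarrow> Y \<in> Obj K \<Longrightarrow> \<exists>B i j p q. is_biproduct K X Y B i j p q"

record ('o, 'm) suscat = "('o, 'm) precat" +
  Sus :: "'o \<Rightarrow> 'o"
  SusA :: "'m \<Rightarrow> 'm"

record ('o, 'm) tricat = "('o, 'm) suscat" +
  Tri :: "('m \<times> 'm \<times> 'm) set"

type_synonym 'm triangle = "'m \<times> 'm \<times> 'm"

definition susp_fctr :: "('o, 'm, 'z) suscat_scheme \<Rightarrow> ('o, 'm, 'o, 'm) fctr" where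
  "susp_fctr K = \<lparr>FO = Sus K, FA = SusA K\<rparr>"

fun is_triangle :: "('o, 'm, 'z) suscat_scheme \<Rightarrow> 'm triangle \<Rightarrow> bool" where
  "is_triangle K (f, g, h) \<longleftrightarrow> f \<in> Arr K \<and> g \<in> Arr K \<and> h \<in> Arr K \<and>
     Cod K f = Dom K g \<and> Cod K g = Dom K h \<and> Cod K h = Sus K (Dom K f)"

fun tri_mor :: "('o, 'm, 'z) suscat_scheme \<Rightarrow> 'm triangle \<Rightarrow> 'm triangle \<Rightarrow> 'm triangle \<Rightarrow> bool" where
  "tri_mor K (f, g, h) (f', g', h') (a, b, c) \<longleftrightarrow>
     a \<in> Hom K (Dom K f) (Dom K f') \<and> b \<in> Hom K (Dom K g) (Dom K g') \<and>
     c \<in> Hom K (Dom K h) (Dom K h') \<and>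
     b \<cdot>\<^bsub>K\<^esub> f = f' \<cdot>\<^bsub>K\<^esub> a \<and> c \<cdot>\<^bsub>K\<^esub> g = g' \<cdot>\<^bsub>K\<^esub> b \<and> SusA K a \<cdot>\<^bsub>K\<^esub> h = h' \<cdot>\<^bsub>K\<^esub> c"

definition tri_isomorphic :: "('o, 'm, 'z) suscat_scheme \<Rightarrow> 'm triangle \<Rightarrow> 'm triangle \<Rightarrow> bool" where
  "tri_isomorphic K T T' \<longleftrightarrow>
     (\<exists>a b c. tri_mor K T T' (a, b, c) \<and> is_iso K a \<and> is_iso K b \<and> is_iso K c)"

fun tri_retract :: "('o, 'm, 'z) suscat_scheme \<Rightarrow> 'm triangle \<Rightarrow> 'm triangle \<Rightarrow> bool" where
  "tri_retract K (f, g, h) T' \<longleftrightarrow>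
     (\<exists>a b c a' b' c'. tri_mor K (f, g, h) T' (a, b, c) \<and> tri_mor K T' (f, g, h) (a', b', c') \<and>
        a' \<cdot>\<^bsub>K\<^esub> a = Ide K (Dom K f) \<and> b' \<cdot>\<^bsub>K\<^esub> b = Ide K (Dom K g) \<and> c' \<cdot>\<^bsub>K\<^esub> c = Ide K (Dom K h))"

fun tri_sum ::
  "('o, 'm, 'z) suscat_scheme \<Rightarrow> 'm triangle \<Rightarrow> 'm triangle \<Rightarrow> 'm triangle \<Rightarrow> bool" where
  "tri_sum K (f, g, h) (f', g', h') (f'', g'', h'') \<longleftrightarrow>
     (\<exists>i1 i2 i3 j1 j2 j3 p1 p2 p3 q1 q2 q3.
        tri_mor K (f, g, h) (f'', g'', h'') (i1, i2, i3) \<and>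
        tri_mor K (f', g', h') (f'', g'', h'') (j1, j2, j3) \<and>
        tri_mor K (f'', g'', h'') (f, g, h) (p1, p2, p3) \<and>
        tri_mor K (f'', g'', h'') (f', g', h') (q1, q2, q3) \<and>
        is_biproduct K (Dom K f) (Dom K f') (Dom K f'') i1 j1 p1 q1 \<and>
        is_biproduct K (Dom K g) (Dom K g') (Dom K g'') i2 j2 p2 q2 \<and>
        is_biproduct K (Dom K h) (Dom K h') (Dom K h'') i3 j3 p3 q3)"

text \<open>
  The suspension is only required to be an additive auto-equivalence, as it need not be an
  automorphism for the relative stable category below.
\<close>

locale triangulated_category = additive_category K
  for K :: "('o, 'm, 'z) tricat_scheme" (structure) +
  assumes susp_equivalence: "is_equivalence K K (susp_fctr K)"
    and susp_additive: "is_additive K K (susp_fctr K)"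
    and Tri_triangle: "T \<in> Tri K \<Longrightarrow> is_triangle K T"
    and Tri_iso: "T \<in> Tri K \<Longrightarrow> is_triangle K T' \<Longrightarrow> tri_isomorphic K T T' \<Longrightarrow> T' \<in> Tri K"
    and Tri_Ide: "X \<in> Obj K \<Longrightarrow> is_zero K Z \<Longrightarrow> (Ide K X, Zer K X Z, Zer K Z (Sus K X)) \<in> Tri K"
    and cone_ex: "f \<in> Arr K \<Longrightarrow> \<exists>g h. (f, g, h) \<in> Tri K"
    and rotation: "is_triangle K (f, g, h) \<Longrightarrow>
                   (f, g, h) \<in> Tri K \<longleftrightarrow> (g, h, Neg K (SusA K f)) \<in> Tri K"
    and fill_in: "(f, g, h) \<in> Tri K \<Longrightarrow> (f', g', h') \<in> Tri K \<Longrightarrow>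
                  a \<in> Hom K (Dom K f) (Dom K f') \<Longrightarrow> b \<in> Hom K (Cod K f) (Cod K f') \<Longrightarrow>
                  b \<cdot> f = f' \<cdot> a \<Longrightarrow> \<exists>c. tri_mor K (f, g, h) (f', g', h') (a, b, c)"
    and octahedral: "(f, f1, f2) \<in> Tri K \<Longrightarrow> (g, g1, g2) \<in> Tri K \<Longrightarrow> Cod K f = Dom K g \<Longrightarrow>
                  (g \<cdot> f, k1, k2) \<in> Tri K \<Longrightarrow>
                  \<exists>u v. (u, v, SusA K f1 \<cdot> g2) \<in> Tri K \<and>
                    tri_mor K (f, f1, f2) (g \<cdot> f, k1, k2) (Ide K (Dom K f), g, u) \<and>
                    tri_mor K (g \<cdot> f, k1, k2) (g, g1, g2) (f, Ide K (Cod K g), v)"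

text \<open>Full replete subcategories are represented by their sets of objects.\<close>

definition thick :: "('o, 'm, 'z) tricat_scheme \<Rightarrow> 'o set \<Rightarrow> bool" where
  "thick K S \<longleftrightarrow> S \<subseteq> Obj K \<and>
     (\<exists>Z \<in> S. is_zero K Z) \<and>
     (\<forall>f. is_iso K f \<longrightarrow> Dom K f \<in> S \<longrightarrow> Cod K f \<in> S) \<and>
     (\<forall>X \<in> Obj K. Sus K X \<in> S \<longleftrightarrow> X \<in> S) \<and>
     (\<forall>f g h. (f, g, h) \<in> Tri K \<longrightarrow>
        (Dom K f \<in> S \<and> Dom K g \<in> S \<longrightarrow> Dom K h \<in> S) \<and>
        (Dom K g \<in> S \<and> Dom K h \<in> S \<longrightarrow> Dom K f \<in> S) \<and>
        (Dom K f \<in> S \<and> Dom K h \<in> S \<longrightarrow> Dom K g \<in> S)) \<and>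
     (\<forall>X Y B i j p q. is_biproduct K X Y B i j p q \<longrightarrow> B \<in> S \<longrightarrow> X \<in> S \<and> Y \<in> S)"

definition thick_closure :: "('o, 'm, 'z) tricat_scheme \<Rightarrow> 'o set \<Rightarrow> 'o set" where
  "thick_closure K A = {X \<in> Obj K. \<forall>S. thick K S \<longrightarrow> A \<subseteq> S \<longrightarrow> X \<in> S}"

definition is_exact ::
  "('o, 'm, 'y) tricat_scheme \<Rightarrow> ('p, 'n, 'z) tricat_scheme \<Rightarrow> ('o, 'm, 'p, 'n) fctr \<Rightarrow> bool" where
  "is_exact C D F \<longleftrightarrow> is_additive C D F \<and>
     (\<exists>\<phi>. natural_iso C D (F \<circ>\<circ> susp_fctr C) (susp_fctr D \<circ>\<circ> F) \<phi> \<and>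
        (\<forall>f g h. (f, g, h) \<in> Tri C \<longrightarrow>
           (FA F f, FA F g, \<phi> (Dom C f) \<cdot>\<^bsub>D\<^esub> FA F h) \<in> Tri D))"

definition with_triangles :: "('o, 'm) suscat \<Rightarrow> 'm triangle set \<Rightarrow> ('o, 'm) tricat" where
  "with_triangles K A =
     suscat.extend K (tricat.fields {T. is_triangle K T \<and> (\<exists>T0 \<in> A. tri_isomorphic K T0 T)})"

text \<open>
  The commutative square
  \<open>
    X --i--> Y
    |        |
    f        u
    v        v
    X' -j--> Y'
  \<close>
  is homotopy cartesian: \<open>j\<close> is a homotopy pushout of \<open>i\<close> along \<open>f\<close>, and \<open>f\<close> is a homotopy
  pullback of \<open>u\<close> along \<open>j\<close>. The distinguished triangle is
  \<open>X \<rightarrow> Y \<oplus> X' \<rightarrow> Y' \<rightarrow> \<Sigma>X\<close> with first map \<open>(i, f)\<close> and second map \<open>(u, -j)\<close>.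
\<close>

definition homotopy_cartesian ::
  "('o, 'm, 'z) tricat_scheme \<Rightarrow> 'm \<Rightarrow> 'm \<Rightarrow> 'm \<Rightarrow> 'm \<Rightarrow> bool" where
  "homotopy_cartesian K i f u j \<longleftrightarrow>
     i \<in> Arr K \<and> f \<in> Arr K \<and> u \<in> Arr K \<and> j \<in> Arr K \<and>
     Dom K i = Dom K f \<and> Cod K i = Dom K u \<and> Cod K f = Dom K j \<and> Cod K u = Cod K j \<and>
     u \<cdot>\<^bsub>K\<^esub> i = j \<cdot>\<^bsub>K\<^esub> f \<and>
     (\<exists>B k l p q d. is_biproduct K (Cod K i) (Cod K f) B k l p q \<and>
        (Add K (k \<cdot>\<^bsub>K\<^esub> i) (l \<cdot>\<^bsub>K\<^esub> f), Sub K (u \<cdot>\<^bsub>K\<^esub> p) (j \<cdot>\<^bsub>K\<^esub> q), d) \<in> Tri K)"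

text \<open>
  The Verdier quotient is the localisation at the class of arrows with cone in \<open>J\<close>, by the calculus
  of fractions: an arrow from \<open>X\<close> to \<open>Y\<close> is an equivalence class of roofs \<open>(s, f)\<close>, with
  \<open>s : Z \<rightarrow> X\<close> in this class and \<open>f : Z \<rightarrow> Y\<close>, standing for \<open>f s\<^sup>-\<^sup>1\<close>. Each use of \<open>the_elem\<close>
  below is applied to the set of values obtained from all choices of representatives, which is a
  singleton whenever \<open>J\<close> is thick in a triangulated category.
\<close>

definition cone_in :: "('o, 'm, 'z) tricat_scheme \<Rightarrow> 'o set \<Rightarrow> 'm set" where
  "cone_in K J = {s. \<exists>g h. (s, g, h) \<in> Tri K \<and> Cod K g \<in> J}"

definition roofs :: "('o, 'm, 'z) tricat_scheme \<Rightarrow> 'o set \<Rightarrow> ('m \<times> 'm) set" where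
  "roofs K J = {(s, f). s \<in> cone_in K J \<and> s \<in> Arr K \<and> f \<in> Arr K \<and> Dom K s = Dom K f}"

definition roof_rel ::
  "('o, 'm, 'z) tricat_scheme \<Rightarrow> 'o set \<Rightarrow> (('m \<times> 'm) \<times> ('m \<times> 'm)) set" where
  "roof_rel K J = {((s, f), (s', f')). (s, f) \<in> roofs K J \<and> (s', f') \<in> roofs K J \<and>
     (\<exists>t t'. t \<in> Arr K \<and> t' \<in> Arr K \<and> Dom K t = Dom K t' \<and>
        Cod K t = Dom K s \<and> Cod K t' = Dom K s' \<and>
        s \<cdot>\<^bsub>K\<^esub> t = s' \<cdot>\<^bsub>K\<^esub> t' \<and> f \<cdot>\<^bsub>K\<^esub> t = f' \<cdot>\<^bsub>K\<^esub> t' \<and> s \<cdot>\<^bsub>K\<^esub> t \<in> cone_in K J)}"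

definition roof :: "('o, 'm, 'z) tricat_scheme \<Rightarrow> 'o set \<Rightarrow> 'm \<Rightarrow> 'm \<Rightarrow> ('m \<times> 'm) set" where
  "roof K J s f = roof_rel K J `` {(s, f)}"

definition verdier_suscat ::
  "('o, 'm, 'z) tricat_scheme \<Rightarrow> 'o set \<Rightarrow> ('o, ('m \<times> 'm) set) suscat" where
  "verdier_suscat K J =
     \<lparr>Obj = Obj K,
      Arr = roofs K J // roof_rel K J,
      Dom = (\<lambda>c. the_elem {Cod K s | s f. (s, f) \<in> c}),
      Cod = (\<lambda>c. the_elem {Cod K f | s f. (s, f) \<in> c}),
      Ide = (\<lambda>X. roof K J (Ide K X) (Ide K X)),
      Cmp = (\<lambda>d c. the_elem {roof K J (s \<cdot>\<^bsub>K\<^esub> t') (g \<cdot>\<^bsub>K\<^esub> f') | s f t g t' f'.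
               (s, f) \<in> c \<and> (t, g) \<in> d \<and> t' \<in> cone_in K J \<and> t' \<in> Arr K \<and> f' \<in> Arr K \<and>
               Dom K t' = Dom K f' \<and> Cod K t' = Dom K f \<and> Cod K f' = Dom K t \<and>
               f \<cdot>\<^bsub>K\<^esub> t' = t \<cdot>\<^bsub>K\<^esub> f'}),
      Add = (\<lambda>c d. the_elem {roof K J s (Add K f g) | s f g. (s, f) \<in> c \<and> (s, g) \<in> d}),
      Zer = (\<lambda>X Y. roof K J (Ide K X) (Zer K X Y)),
      Sus = Sus K,
      SusA = (\<lambda>c. the_elem {roof K J (SusA K s) (SusA K f) | s f. (s, f) \<in> c})\<rparr>"

definition verdier_fctr ::
  "('o, 'm, 'z) tricat_scheme \<Rightarrow> 'o set \<Rightarrow> ('o, 'm, 'o, ('m \<times> 'm) set) fctr" where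
  "verdier_fctr K J = \<lparr>FO = id, FA = (\<lambda>f. roof K J (Ide K (Dom K f)) f)\<rparr>"

definition verdier ::
  "('o, 'm, 'z) tricat_scheme \<Rightarrow> 'o set \<Rightarrow> ('o, ('m \<times> 'm) set) tricat" where
  "verdier K J = with_triangles (verdier_suscat K J)
     {(FA (verdier_fctr K J) f, FA (verdier_fctr K J) g, FA (verdier_fctr K J) h) | f g h.
        (f, g, h) \<in> Tri K}"

definition E_mono :: "'m triangle set \<Rightarrow> 'm \<Rightarrow> bool" where
  "E_mono E f \<longleftrightarrow> (\<exists>g h. (f, g, h) \<in> E)"

definition E_epi :: "'m triangle set \<Rightarrow> 'm \<Rightarrow> bool" where
  "E_epi E g \<longleftrightarrow> (\<exists>f h. (f, g, h) \<in> E)"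

text \<open>
  Closure under suspension is closure under all powers of \<open>\<Sigma>\<close>, negative ones included. The
  suspension of a triangle is its triple rotation.
\<close>

locale proper_class =
  fixes K :: "('o, 'm, 'z) tricat_scheme" (structure) and E :: "'m triangle set"
  assumes E_Tri: "E \<subseteq> Tri K"
    and E_iso: "T \<in> E \<Longrightarrow> T' \<in> Tri K \<Longrightarrow> tri_isomorphic K T T' \<Longrightarrow> T' \<in> E"
    and E_susp: "(f, g, h) \<in> Tri K \<Longrightarrow>
          (f, g, h) \<in> E \<longleftrightarrow> (Neg K (SusA K f), Neg K (SusA K g), Neg K (SusA K h)) \<in> E"
    and E_sum: "T \<in> E \<Longrightarrow> T' \<in> E \<Longrightarrow> T'' \<in> Tri K \<Longrightarrow> tri_sum K T T' T'' \<Longrightarrow> T'' \<in> E"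
    and E_retract: "T' \<in> E \<Longrightarrow> T \<in> Tri K \<Longrightarrow> tri_retract K T T' \<Longrightarrow> T \<in> E"
    and E_Ide1: "X \<in> Obj K \<Longrightarrow> is_zero K Z \<Longrightarrow> (Ide K X, Zer K X Z, Zer K Z (Sus K X)) \<in> E"
    and E_Ide2: "Y \<in> Obj K \<Longrightarrow> is_zero K Z \<Longrightarrow> (Zer K Z Y, Ide K Y, Zer K Y (Sus K Z)) \<in> E"
    and E_pushout: "homotopy_cartesian K i f u j \<Longrightarrow> E_mono E i \<Longrightarrow> E_mono E j"
    and E_pullback: "homotopy_cartesian K i f u j \<Longrightarrow> E_epi E u \<Longrightarrow> E_epi E f"
    and E_saturated: "homotopy_cartesian K i f u j \<Longrightarrow> E_epi E j \<Longrightarrow> E_epi E f \<Longrightarrow> E_epi E u"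

definition E_proj :: "('o, 'm, 'z) tricat_scheme \<Rightarrow> 'm triangle set \<Rightarrow> 'o set" where
  "E_proj K E = {P \<in> Obj K. \<forall>f g h. (f, g, h) \<in> E \<longrightarrow>
     inj_on (\<lambda>a. f \<cdot>\<^bsub>K\<^esub> a) (Hom K P (Dom K f)) \<and>
     (\<lambda>a. f \<cdot>\<^bsub>K\<^esub> a) ` Hom K P (Dom K f) =
       {b \<in> Hom K P (Dom K g). g \<cdot>\<^bsub>K\<^esub> b = Zer K P (Dom K h)} \<and>
     (\<lambda>b. g \<cdot>\<^bsub>K\<^esub> b) ` Hom K P (Dom K g) = Hom K P (Dom K h)}"

definition E_inj :: "('o, 'm, 'z) tricat_scheme \<Rightarrow> 'm triangle set \<Rightarrow> 'o set" where
  "E_inj K E = {I \<in> Obj K. \<forall>f g h. (f, g, h) \<in> E \<longrightarrow>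
     inj_on (\<lambda>c. c \<cdot>\<^bsub>K\<^esub> g) (Hom K (Dom K h) I) \<and>
     (\<lambda>c. c \<cdot>\<^bsub>K\<^esub> g) ` Hom K (Dom K h) I =
       {b \<in> Hom K (Dom K g) I. b \<cdot>\<^bsub>K\<^esub> f = Zer K (Dom K f) I} \<and>
     (\<lambda>b. b \<cdot>\<^bsub>K\<^esub> f) ` Hom K (Dom K g) I = Hom K (Dom K f) I}"

locale frobenius_class = proper_class +
  assumes enough_proj: "X \<in> Obj K \<Longrightarrow> \<exists>g. E_epi E g \<and> Dom K g \<in> E_proj K E \<and> Cod K g = X"
    and enough_inj: "X \<in> Obj K \<Longrightarrow> \<exists>f. E_mono E f \<and> Dom K f = X \<and> Cod K f \<in> E_inj K E"
    and proj_eq_inj: "E_proj K E = E_inj K E"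

text \<open>\<open>R X = (i, p, q)\<close> is the chosen triangle \<open>X \<rightarrow> X\<^sub>E \<rightarrow> X' \<rightarrow> \<Sigma>X\<close>.\<close>

definition injective_choice ::
  "('o, 'm, 'z) tricat_scheme \<Rightarrow> 'm triangle set \<Rightarrow> ('o \<Rightarrow> 'm triangle) \<Rightarrow> bool" where
  "injective_choice K E R \<longleftrightarrow>
     (\<forall>X \<in> Obj K. R X \<in> Tri K \<and>
        (case R X of (i, p, q) \<Rightarrow> E_mono E i \<and> Dom K i = X \<and> Cod K i \<in> E_inj K E))"

definition factor_through :: "('o, 'm, 'z) precat_scheme \<Rightarrow> 'o set \<Rightarrow> 'o \<Rightarrow> 'o \<Rightarrow> 'm set" where
  "factor_through K A X Y = {b \<cdot>\<^bsub>K\<^esub> a | a b P. P \<in> A \<and> a \<in> Hom K X P \<and> b \<in> Hom K P Y}"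

definition stab_class :: "('o, 'm, 'z) precat_scheme \<Rightarrow> 'o set \<Rightarrow> 'm \<Rightarrow> 'm set" where
  "stab_class K A f = Add K f ` factor_through K A (Dom K f) (Cod K f)"

text \<open>
  As for Verdier quotients, \<open>the_elem\<close> is applied to the set of values over all representatives.
  The suspension of \<open>\<pi> f\<close> is \<open>\<pi> f'\<close> for any morphism \<open>(f, e, f')\<close> between the chosen triangles.
\<close>

definition stable_suscat ::
  "('o, 'm, 'z) tricat_scheme \<Rightarrow> 'm triangle set \<Rightarrow> ('o \<Rightarrow> 'm triangle) \<Rightarrow> ('o, 'm set) suscat" where
  "stable_suscat K E R = (let cl = stab_class K (E_proj K E) in
     \<lparr>Obj = Obj K,
      Arr = cl ` Arr K,
      Dom = (\<lambda>c. the_elem (Dom K ` c)),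
      Cod = (\<lambda>c. the_elem (Cod K ` c)),
      Ide = (\<lambda>X. cl (Ide K X)),
      Cmp = (\<lambda>d c. the_elem {cl (g \<cdot>\<^bsub>K\<^esub> f) | g f. g \<in> d \<and> f \<in> c}),
      Add = (\<lambda>c d. the_elem {cl (Add K f g) | f g. f \<in> c \<and> g \<in> d}),
      Zer = (\<lambda>X Y. cl (Zer K X Y)),
      Sus = (\<lambda>X. case R X of (i, p, q) \<Rightarrow> Cod K p),
      SusA = (\<lambda>c. the_elem {cl f' | f e f'.
                f \<in> c \<and> tri_mor K (R (Dom K f)) (R (Cod K f)) (f, e, f')})\<rparr>)"

definition stable_fctr ::
  "('o, 'm, 'z) tricat_scheme \<Rightarrow> 'm triangle set \<Rightarrow> ('o, 'm, 'o, 'm set) fctr" where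
  "stable_fctr K E = \<lparr>FO = id, FA = stab_class K (E_proj K E)\<rparr>"

text \<open>
  With \<open>R X = (i, p, q)\<close>, the map \<open>(f, z, id)\<close> goes from \<open>X \<rightarrow> X\<^sub>E \<rightarrow> X' \<rightarrow> \<Sigma>X\<close> to
  \<open>Y \<rightarrow> Z \<rightarrow> X' \<rightarrow> \<Sigma>Y\<close>, where \<open>Z\<close> is the homotopy pushout of \<open>i\<close> and \<open>f\<close>.
\<close>

definition standard_triangles ::
  "('o, 'm, 'z) tricat_scheme \<Rightarrow> 'm triangle set \<Rightarrow> ('o \<Rightarrow> 'm triangle) \<Rightarrow> 'm set triangle set" where
  "standard_triangles K E R =
     {(FA (stable_fctr K E) f, FA (stable_fctr K E) g, FA (stable_fctr K E) h) | f g h.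
        f \<in> Arr K \<and>
        (\<exists>i p q z w. R (Dom K f) = (i, p, q) \<and>
           homotopy_cartesian K i f z g \<and>
           (g, h, w) \<in> Tri K \<and>
           tri_mor K (i, p, q) (g, h, w) (f, z, Ide K (Cod K p)))}"

definition relative_stable ::
  "('o, 'm, 'z) tricat_scheme \<Rightarrow> 'm triangle set \<Rightarrow> ('o \<Rightarrow> 'm triangle) \<Rightarrow> ('o, 'm set) tricat" where
  "relative_stable K E R = with_triangles (stable_suscat K E R) (standard_triangles K E R)"

end

theory Submission
  imports Defs
begin

text \<open>
  Write \<open>S\<close> for the arrows of \<open>K\<close> with cone in \<open>M\<close>, and \<open>X \<rightarrow> X\<^sub>\<E> \<rightarrow> X' \<rightarrow> \<Sigma>X\<close> for the chosen triangles
  with maps \<open>i\<close>, \<open>p\<close>, \<open>q\<close>. The functor \<open>\<pi>\<close> induces not just an equivalence but an isomorphism of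
  categories: applying \<open>\<pi>\<close> to both legs of a roof is a bijection from the arrows of \<open>K // M\<close> to those
  of the Verdier quotient of the relative stable category (\<open>roof_rel_KE_iff\<close>, \<open>roof_map_inj\<close>).
  Two facts are behind this.

  \<^item> Stably equal arrows differ by an arrow \<open>b a\<close> through an object of \<open>M\<close>, and the fibre of \<open>a\<close>, which
    lies in \<open>S\<close>, equalises them (\<open>cl_agree\<close>). An identity between stable roofs therefore lifts to
    \<open>K\<close> after a refinement.

  \<^item> \<open>\<pi> s\<close> has a cone in \<open>M\<close> if and only if \<open>s\<close> has one (\<open>cone_in_KE\<close>). Indeed the standard triangle on
    \<open>s : X \<rightarrow> Y\<close> has as its third object the cone of \<open>(i, s) : X \<rightarrow> X\<^sub>\<E> \<oplus> Y\<close>, which differs from the cone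
    of \<open>s\<close> by \<open>\<Sigma>X\<^sub>\<E> \<in> M\<close>. An arbitrary triangle on \<open>\<pi> s\<close> is only isomorphic to a standard one on some
    other arrow, and this isomorphism is absorbed by the saturation of \<open>S\<close>: every arrow that becomes
    invertible in \<open>K // M\<close> lies in \<open>S\<close> (\<open>saturated\<close>).

  The category laws, the composition and the addition of the target are transported along this
  bijection from \<open>K // M\<close>, where they come from the calculus of right fractions.

  For the thickness of \<open>\<pi>(M)\<close>, note that an object belongs to \<open>M\<close> as soon as its identity vanishes in
  \<open>K // M\<close>, and that vanishing in \<open>K // M\<close> depends only on the stable class of an arrow. So stable
  retracts, and in particular stable summands and stably isomorphic objects, of objects of \<open>M\<close> belong
  to \<open>M\<close> (\<open>stable_retract_in_M\<close>). The two-out-of-three property holds because a standard triangle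
  \<open>X \<rightarrow> Y \<rightarrow> Z \<rightarrow> X'\<close> comes with a triangle \<open>Y \<rightarrow> Z \<rightarrow> X' \<rightarrow> \<Sigma>Y\<close> of \<open>K\<close>, and \<open>X'\<close> lies in \<open>M\<close> if and only if
  \<open>X\<close> does.

  For exactness, \<open>q : X' \<rightarrow> \<Sigma>X\<close> has cone \<open>\<Sigma>X\<^sub>\<E>\<close> and hence becomes invertible in \<open>K // M\<close>. It is natural in
  \<open>X\<close>, so the inverse of \<open>-q\<close> identifies \<open>\<Sigma>X\<close> with the stable suspension \<open>X'\<close>
  (\<open>lift_roof\<close>, \<open>nq_inv_natural\<close>). Two applications of the octahedral axiom to one cone of \<open>(i, f)\<close> show
  that, after this identification, the triangle on \<open>f\<close> in \<open>K\<close> and a standard triangle on \<open>f\<close> become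
  isomorphic (\<open>standard_triangle_comparison\<close>).
\<close>

section \<open>Categories and additive categories\<close>

context category
begin

lemma Hom_iff [simp]: "f \<in> Hom K X Y \<longleftrightarrow> f \<in> Arr K \<and> Dom K f = X \<and> Cod K f = Y"
  by (simp add: Hom_def)

lemmas Dom_Obj [simp] and Cod_Obj [simp]

lemma Cmp_simps [simp]:
  assumes "f \<in> Arr K" "g \<in> Arr K" "Cod K f = Dom K g"
  shows "g \<cdot> f \<in> Arr K" "Dom K (g \<cdot> f) = Dom K f" "Cod K (g \<cdot> f) = Cod K g"
  using Cmp_Hom[of f "Dom K f" "Cod K f" g "Cod K g"] assms by auto

lemma Ide_simps [simp]:
  assumes "X \<in> Obj K"
  shows "Ide K X \<in> Arr K" "Dom K (Ide K X) = X" "Cod K (Ide K X) = X"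
  using Ide_Hom[OF assms] by auto

lemma Cmp_assoc' [simp]:
  "f \<in> Arr K \<Longrightarrow> g \<in> Arr K \<Longrightarrow> h \<in> Arr K \<Longrightarrow> Cod K f = Dom K g \<Longrightarrow> Cod K g = Dom K h \<Longrightarrow>
    (h \<cdot> g) \<cdot> f = h \<cdot> (g \<cdot> f)"
  using Cmp_assoc[of f "Dom K f" "Dom K g" g "Dom K h" h "Cod K h"] by auto

lemma Cmp_Ide' [simp]: "f \<in> Arr K \<Longrightarrow> Dom K f = X \<Longrightarrow> f \<cdot> Ide K X = f"
  using Cmp_Ide[of f X "Cod K f"] by auto

lemma Ide_Cmp' [simp]: "f \<in> Arr K \<Longrightarrow> Cod K f = X \<Longrightarrow> Ide K X \<cdot> f = f"
  using Ide_Cmp[of f "Dom K f" X] by auto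

text \<open>The simplifier nests composites to the right, so that an equation between two composites does
  not match inside longer ones; the next two lemmas prolong such an equation on the right.\<close>

lemma Cmp_reassoc:
  assumes "f \<cdot> a = g \<cdot> b" "a \<in> Arr K" "b \<in> Arr K" "f \<in> Arr K" "g \<in> Arr K" "w \<in> Arr K"
    "Cod K a = Dom K f" "Cod K b = Dom K g" "Cod K w = Dom K a" "Dom K a = Dom K b"
  shows "f \<cdot> (a \<cdot> w) = g \<cdot> (b \<cdot> w)"
proof -
  have "f \<cdot> (a \<cdot> w) = (f \<cdot> a) \<cdot> w" using assms(2-) by simp
  also have "\<dots> = (g \<cdot> b) \<cdot> w" by (simp only: assms(1))
  also have "\<dots> = g \<cdot> (b \<cdot> w)" using assms(2-) by simp
  finally show ?thesis .
qed

lemma Cmp_reassoc1: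
  assumes "f \<cdot> a = c" "a \<in> Arr K" "f \<in> Arr K" "w \<in> Arr K" "Cod K a = Dom K f" "Cod K w = Dom K a"
  shows "f \<cdot> (a \<cdot> w) = c \<cdot> w"
  using assms by (metis Cmp_assoc')

lemma is_isoI:
  assumes "f \<in> Arr K" "g \<in> Arr K" "Dom K g = Cod K f" "Cod K g = Dom K f"
    "g \<cdot> f = Ide K (Dom K f)" "f \<cdot> g = Ide K (Cod K f)"
  shows "is_iso K f"
  using assms unfolding is_iso_def by auto

lemma is_isoE:
  assumes "is_iso K f"
  obtains g where "f \<in> Arr K" "g \<in> Arr K" "Dom K g = Cod K f" "Cod K g = Dom K f"
    "g \<cdot> f = Ide K (Dom K f)" "f \<cdot> g = Ide K (Cod K f)"
  using assms unfolding is_iso_def by auto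

lemma is_iso_Ide [simp]: "X \<in> Obj K \<Longrightarrow> is_iso K (Ide K X)"
  by (rule is_isoI[where g = "Ide K X"]) auto

lemma is_iso_Cmp:
  assumes "is_iso K f" "is_iso K g" "Cod K f = Dom K g"
  shows "is_iso K (g \<cdot> f)"
proof -
  obtain f' where f: "f \<in> Arr K" "f' \<in> Arr K" "Dom K f' = Cod K f" "Cod K f' = Dom K f"
    "f' \<cdot> f = Ide K (Dom K f)" "f \<cdot> f' = Ide K (Cod K f)" using assms(1) by (rule is_isoE)
  obtain g' where g: "g \<in> Arr K" "g' \<in> Arr K" "Dom K g' = Cod K g" "Cod K g' = Dom K g"
    "g' \<cdot> g = Ide K (Dom K g)" "g \<cdot> g' = Ide K (Cod K g)" using assms(2) by (rule is_isoE)
  have 1: "f \<cdot> (f' \<cdot> g') = g'" using f g assms(3) Cmp_reassoc1[OF f(6), of g'] by simp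
  have 2: "g' \<cdot> (g \<cdot> f) = f" using f g assms(3) Cmp_reassoc1[OF g(5), of f] by simp
  show ?thesis
    by (rule is_isoI[where g = "f' \<cdot> g'"]) (use f g assms(3) 1 2 in simp_all)
qed

lemma iso_cancel_right:
  assumes "is_iso K s" "a \<in> Arr K" "b \<in> Arr K" "Dom K a = Cod K s" "Dom K b = Cod K s"
    "a \<cdot> s = b \<cdot> s"
  shows "a = b"
proof -
  obtain r where r: "s \<in> Arr K" "r \<in> Arr K" "Dom K r = Cod K s" "Cod K r = Dom K s"
    "r \<cdot> s = Ide K (Dom K s)" "s \<cdot> r = Ide K (Cod K s)" using assms(1) by (rule is_isoE)
  have "a = (a \<cdot> s) \<cdot> r" using r assms(2-5) by simp
  also have "\<dots> = (b \<cdot> s) \<cdot> r" by (simp only: assms(6))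
  also have "\<dots> = b" using r assms(2-5) by simp
  finally show ?thesis .
qed

lemma iso_cancel_left:
  assumes "is_iso K s" "a \<in> Arr K" "b \<in> Arr K" "Cod K a = Dom K s" "Cod K b = Dom K s"
    "s \<cdot> a = s \<cdot> b"
  shows "a = b"
proof -
  obtain r where r: "s \<in> Arr K" "r \<in> Arr K" "Dom K r = Cod K s" "Cod K r = Dom K s"
    "r \<cdot> s = Ide K (Dom K s)" "s \<cdot> r = Ide K (Cod K s)" using assms(1) by (rule is_isoE)
  have "a = r \<cdot> (s \<cdot> a)" using r(1-4) assms(2-5) Cmp_reassoc1[OF r(5), of a] by simp
  also have "\<dots> = r \<cdot> (s \<cdot> b)" by (simp only: assms(6))
  also have "\<dots> = b" using r(1-4) assms(2-5) Cmp_reassoc1[OF r(5), of b] by simp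
  finally show ?thesis .
qed

end

context additive_category
begin

lemma Zer_simps [simp]:
  assumes "X \<in> Obj K" "Y \<in> Obj K"
  shows "Zer K X Y \<in> Arr K" "Dom K (Zer K X Y) = X" "Cod K (Zer K X Y) = Y"
proof -
  interpret comm_group "hom_group K X Y" by (rule Hom_group) fact+
  show "Zer K X Y \<in> Arr K" "Dom K (Zer K X Y) = X" "Cod K (Zer K X Y) = Y"
    using one_closed by (auto simp: hom_group_def)
qed

context
  fixes f g h :: 'm and X Y :: 'o
  assumes f: "f \<in> Arr K"
begin

interpretation G: comm_group "hom_group K (Dom K f) (Cod K f)"
  by (rule Hom_group) (auto simp: f)

lemma Add_simps [simp]:
  assumes "g \<in> Arr K" "Dom K f = Dom K g" "Cod K f = Cod K g"
  shows "Add K f g \<in> Arr K" "Dom K (Add K f g) = Dom K f" "Cod K (Add K f g) = Cod K f"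
  using assms G.m_closed[of f g] by (auto simp: hom_group_def f)

lemma Add_assoc:
  assumes "g \<in> Arr K" "Dom K f = Dom K g" "Cod K f = Cod K g"
    "h \<in> Arr K" "Dom K f = Dom K h" "Cod K f = Cod K h"
  shows "Add K (Add K f g) h = Add K f (Add K g h)"
  using assms G.m_assoc[of f g h] by (auto simp: hom_group_def f)

lemma Add_commute:
  assumes "g \<in> Arr K" "Dom K f = Dom K g" "Cod K f = Cod K g"
  shows "Add K f g = Add K g f"
  using assms G.m_comm[of f g] by (auto simp: hom_group_def f)

lemma Add_left_commute:
  assumes "g \<in> Arr K" "Dom K f = Dom K g" "Cod K f = Cod K g"
    "h \<in> Arr K" "Dom K f = Dom K h" "Cod K f = Cod K h"
  shows "Add K f (Add K g h) = Add K g (Add K f h)"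
  using assms G.m_lcomm[of f g h] by (auto simp: hom_group_def f)

lemma Add_Zer [simp]:
  assumes "Dom K f = X" "Cod K f = Y"
  shows "Add K f (Zer K X Y) = f" "Add K (Zer K X Y) f = f"
  using assms G.r_one[of f] G.l_one[of f] by (auto simp: hom_group_def f)

lemma Neg_simps [simp]:
  shows "Neg K f \<in> Arr K" "Dom K (Neg K f) = Dom K f" "Cod K (Neg K f) = Cod K f"
  using G.inv_closed[of f] unfolding Neg_def by (auto simp: hom_group_def f)

lemma Add_Neg [simp]:
  assumes "Dom K f = X" "Cod K f = Y"
  shows "Add K f (Neg K f) = Zer K (Dom K f) (Cod K f)" "Add K (Neg K f) f = Zer K (Dom K f) (Cod K f)"
  using G.r_inv[of f] G.l_inv[of f] unfolding Neg_def by (auto simp: hom_group_def f)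

lemma Add_eq_Zer_imp_Neg:
  assumes "g \<in> Arr K" "Dom K f = Dom K g" "Cod K f = Cod K g"
    "Add K f g = Zer K (Dom K f) (Cod K f)"
  shows "g = Neg K f"
  using assms G.inv_equality[of g f] G.m_comm[of f g] unfolding Neg_def
  by (auto simp: hom_group_def f)

lemma Add_left_cancel:
  assumes "g \<in> Arr K" "Dom K f = Dom K g" "Cod K f = Cod K g"
    "h \<in> Arr K" "Dom K f = Dom K h" "Cod K f = Cod K h" "Add K f g = Add K f h"
  shows "g = h"
  using assms G.Units_l_cancel[of f g h] G.Units_eq by (auto simp: hom_group_def f)

end

lemma Neg_Neg [simp]: "f \<in> Arr K \<Longrightarrow> Neg K (Neg K f) = f"
  by (rule sym, rule Add_eq_Zer_imp_Neg) auto

lemmas Add_ac = Add_assoc Add_commute Add_left_commute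

lemma Cmp_Add' [simp]:
  assumes "f \<in> Arr K" "f' \<in> Arr K" "Dom K f = Dom K f'" "Cod K f = Cod K f'" "g \<in> Arr K"
    "Cod K f' = Dom K g"
  shows "g \<cdot> Add K f f' = Add K (g \<cdot> f) (g \<cdot> f')"
  using assms Cmp_Add[of f "Dom K f" "Dom K g" f' g "Cod K g"] by auto

lemma Add_Cmp' [simp]:
  assumes "g \<in> Arr K" "g' \<in> Arr K" "Dom K g = Dom K g'" "Cod K g = Cod K g'" "f \<in> Arr K"
    "Cod K f = Dom K g'"
  shows "Add K g g' \<cdot> f = Add K (g \<cdot> f) (g' \<cdot> f)"
  using assms Add_Cmp[of f "Dom K f" "Dom K g" g "Cod K g" g'] by auto

lemma Cmp_Zer [simp]:
  assumes "g \<in> Arr K" "X \<in> Obj K" "Dom K g = Y"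
  shows "g \<cdot> Zer K X Y = Zer K X (Cod K g)"
proof -
  have [simp]: "Y \<in> Obj K" using assms by auto
  have "Add K (g \<cdot> Zer K X Y) (g \<cdot> Zer K X Y) = g \<cdot> Add K (Zer K X Y) (Zer K X Y)"
    using assms by (subst Cmp_Add') auto
  also have "\<dots> = Add K (g \<cdot> Zer K X Y) (Zer K X (Cod K g))" using assms by simp
  finally have eq: "Add K (g \<cdot> Zer K X Y) (g \<cdot> Zer K X Y) = Add K (g \<cdot> Zer K X Y) (Zer K X (Cod K g))" .
  show ?thesis by (rule Add_left_cancel[OF _ _ _ _ _ _ _ eq]) (use assms in simp_all)
qed

lemma Zer_Cmp [simp]:
  assumes "f \<in> Arr K" "Z \<in> Obj K" "Cod K f = Y"
  shows "Zer K Y Z \<cdot> f = Zer K (Dom K f) Z"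
proof -
  have [simp]: "Y \<in> Obj K" using assms by auto
  have "Add K (Zer K Y Z \<cdot> f) (Zer K Y Z \<cdot> f) = Add K (Zer K Y Z) (Zer K Y Z) \<cdot> f"
    using assms by (subst Add_Cmp') auto
  also have "\<dots> = Add K (Zer K Y Z \<cdot> f) (Zer K (Dom K f) Z)" using assms by simp
  finally have eq: "Add K (Zer K Y Z \<cdot> f) (Zer K Y Z \<cdot> f) = Add K (Zer K Y Z \<cdot> f) (Zer K (Dom K f) Z)" .
  show ?thesis by (rule Add_left_cancel[OF _ _ _ _ _ _ _ eq]) (use assms in simp_all)
qed

lemma Cmp_Neg [simp]:
  assumes "f \<in> Arr K" "g \<in> Arr K" "Cod K f = Dom K g"
  shows "g \<cdot> Neg K f = Neg K (g \<cdot> f)"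
proof (rule Add_eq_Zer_imp_Neg)
  have "Add K (g \<cdot> f) (g \<cdot> Neg K f) = g \<cdot> Add K f (Neg K f)"
    using assms by (subst Cmp_Add') auto
  then show "Add K (g \<cdot> f) (g \<cdot> Neg K f) = Zer K (Dom K (g \<cdot> f)) (Cod K (g \<cdot> f))"
    using assms by simp
qed (use assms in auto)

lemma Neg_Cmp [simp]:
  assumes "f \<in> Arr K" "g \<in> Arr K" "Cod K f = Dom K g"
  shows "Neg K g \<cdot> f = Neg K (g \<cdot> f)"
proof (rule Add_eq_Zer_imp_Neg)
  have "Add K (g \<cdot> f) (Neg K g \<cdot> f) = Add K g (Neg K g) \<cdot> f"
    using assms by (subst Add_Cmp') auto
  then show "Add K (g \<cdot> f) (Neg K g \<cdot> f) = Zer K (Dom K (g \<cdot> f)) (Cod K (g \<cdot> f))"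
    using assms by simp
qed (use assms in auto)

lemma Neg_Zer [simp]: "X \<in> Obj K \<Longrightarrow> Y \<in> Obj K \<Longrightarrow> Neg K (Zer K X Y) = Zer K X Y"
  by (rule sym, rule Add_eq_Zer_imp_Neg) auto

lemma Sub_simps [simp]:
  assumes "f \<in> Arr K" "g \<in> Arr K" "Dom K f = Dom K g" "Cod K f = Cod K g"
  shows "Sub K f g \<in> Arr K" "Dom K (Sub K f g) = Dom K f" "Cod K (Sub K f g) = Cod K f"
  using assms by (auto simp: Sub_def)

lemma Sub_eq_Zer_iff:
  assumes "f \<in> Arr K" "g \<in> Arr K" "Dom K f = Dom K g" "Cod K f = Cod K g"
  shows "Sub K f g = Zer K (Dom K f) (Cod K f) \<longleftrightarrow> f = g"
proof
  assume "Sub K f g = Zer K (Dom K f) (Cod K f)"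
  then have "Neg K g = Neg K f" using assms by (intro Add_eq_Zer_imp_Neg) (auto simp: Sub_def)
  then have "Neg K (Neg K g) = Neg K (Neg K f)" by simp
  then show "f = g" using assms by simp
qed (use assms in \<open>auto simp: Sub_def\<close>)

lemma Cmp_Sub:
  assumes "f \<in> Arr K" "g \<in> Arr K" "Dom K f = Dom K g" "Cod K f = Cod K g" "h \<in> Arr K"
    "Cod K g = Dom K h"
  shows "h \<cdot> Sub K f g = Sub K (h \<cdot> f) (h \<cdot> g)"
  using assms by (auto simp: Sub_def)

lemma Sub_Cmp:
  assumes "f \<in> Arr K" "g \<in> Arr K" "Dom K f = Dom K g" "Cod K f = Cod K g" "h \<in> Arr K"
    "Cod K h = Dom K g"
  shows "Sub K f g \<cdot> h = Sub K (f \<cdot> h) (g \<cdot> h)"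
  using assms by (auto simp: Sub_def)

lemma eq_Zer_if_Ide_Zer:
  assumes "Ide K X = Zer K X X" "X \<in> Obj K" "f \<in> Arr K"
  shows "Dom K f = X \<Longrightarrow> f = Zer K X (Cod K f)" "Cod K f = X \<Longrightarrow> f = Zer K (Dom K f) X"
  using assms by (metis Cmp_Ide' Cmp_Zer, metis Ide_Cmp' Zer_Cmp)

lemma is_zero_iff: "is_zero K X \<longleftrightarrow> X \<in> Obj K \<and> Ide K X = Zer K X X"
proof
  assume z: "is_zero K X"
  then have "\<exists>!f. f \<in> Hom K X X" "X \<in> Obj K" unfolding is_zero_def by auto
  then show "X \<in> Obj K \<and> Ide K X = Zer K X X"
    by (metis (full_types) Hom_iff Ide_Hom Zer_simps)
next
  assume X: "X \<in> Obj K \<and> Ide K X = Zer K X X"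
  show "is_zero K X" unfolding is_zero_def
  proof (intro conjI ballI)
    fix Y assume Y: "Y \<in> Obj K"
    show "\<exists>!f. f \<in> Hom K Y X"
      by (rule ex1I[of _ "Zer K Y X"]) (use X Y eq_Zer_if_Ide_Zer(2) in auto)
    show "\<exists>!f. f \<in> Hom K X Y"
      by (rule ex1I[of _ "Zer K X Y"]) (use X Y eq_Zer_if_Ide_Zer(1) in auto)
  qed (use X in auto)
qed

lemma is_zero_Obj [simp]: "is_zero K Z \<Longrightarrow> Z \<in> Obj K"
  by (simp add: is_zero_iff)

lemma zero_iso: 
  assumes "is_zero K Z" "is_zero K Z'"
  shows "is_iso K (Zer K Z Z')"
  by (rule is_isoI[where g = "Zer K Z' Z"]) (use assms in \<open>auto simp: is_zero_iff\<close>)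

lemma is_iso_Neg_Ide: "X \<in> Obj K \<Longrightarrow> is_iso K (Neg K (Ide K X))"
  by (rule is_isoI[where g = "Neg K (Ide K X)"]) auto

end

section \<open>Triangulated categories\<close>

context triangulated_category
begin

lemma Sus_Obj [simp]: "X \<in> Obj K \<Longrightarrow> Sus K X \<in> Obj K"
  and SusA_simps [simp]: "f \<in> Arr K \<Longrightarrow> SusA K f \<in> Arr K"
    "f \<in> Arr K \<Longrightarrow> Dom K (SusA K f) = Sus K (Dom K f)"
    "f \<in> Arr K \<Longrightarrow> Cod K (SusA K f) = Sus K (Cod K f)"
  and SusA_Ide [simp]: "X \<in> Obj K \<Longrightarrow> SusA K (Ide K X) = Ide K (Sus K X)"
  and SusA_Cmp [simp]: "f \<in> Arr K \<Longrightarrow> g \<in> Arr K \<Longrightarrow> Cod K f = Dom K g \<Longrightarrow>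
    SusA K (g \<cdot> f) = SusA K g \<cdot> SusA K f"
  using susp_equivalence unfolding is_equivalence_def is_functor_def susp_fctr_def by auto

lemma SusA_Add [simp]:
  assumes "f \<in> Arr K" "g \<in> Arr K" "Dom K f = Dom K g" "Cod K f = Cod K g"
  shows "SusA K (Add K f g) = Add K (SusA K f) (SusA K g)"
proof -
  have "\<forall>X\<in>Obj K. \<forall>Y\<in>Obj K. \<forall>x\<in>Hom K X Y. \<forall>y\<in>Hom K X Y.
      SusA K (Add K x y) = Add K (SusA K x) (SusA K y)"
    using susp_additive unfolding is_additive_def hom_def susp_fctr_def hom_group_def by auto
  moreover have "f \<in> Hom K (Dom K g) (Cod K g)" "g \<in> Hom K (Dom K g) (Cod K g)"
    using assms by auto
  ultimately show ?thesis using Dom_Obj[OF assms(2)] Cod_Obj[OF assms(2)] by blast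
qed

lemma SusA_Zer [simp]:
  assumes "X \<in> Obj K" "Y \<in> Obj K"
  shows "SusA K (Zer K X Y) = Zer K (Sus K X) (Sus K Y)"
proof -
  have eq: "Add K (SusA K (Zer K X Y)) (SusA K (Zer K X Y)) =
    Add K (SusA K (Zer K X Y)) (Zer K (Sus K X) (Sus K Y))"
    using assms by (subst SusA_Add[symmetric]) auto
  show ?thesis by (rule Add_left_cancel[OF _ _ _ _ _ _ _ eq]) (use assms in simp_all)
qed

lemma SusA_Neg [simp]: "f \<in> Arr K \<Longrightarrow> SusA K (Neg K f) = Neg K (SusA K f)"
  by (rule Add_eq_Zer_imp_Neg) (auto simp flip: SusA_Add)

lemma Sus_zero: "is_zero K Z \<Longrightarrow> is_zero K (Sus K Z)"
  unfolding is_zero_iff by (metis SusA_Ide SusA_Zer Sus_Obj)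

lemma SusA_faithful:
  assumes "f \<in> Arr K" "g \<in> Arr K" "Dom K f = Dom K g" "Cod K f = Cod K g" "SusA K f = SusA K g"
  shows "f = g"
proof -
  obtain G \<eta> where \<eta>: "natural_iso K K (G \<circ>\<circ> susp_fctr K) id_fctr \<eta>"
    using susp_equivalence unfolding is_equivalence_def by blast
  have nat: "\<eta> (Cod K a) \<cdot> FA G (SusA K a) = a \<cdot> \<eta> (Dom K a)" if "a \<in> Arr K" for a
    using \<eta> that unfolding natural_iso_def comp_fctr_def id_fctr_def susp_fctr_def by auto
  have 1: "\<eta> (Dom K g) \<in> Arr K" "Cod K (\<eta> (Dom K g)) = Dom K g" "is_iso K (\<eta> (Dom K g))"
    using \<eta> Dom_Obj[OF assms(2)]
    unfolding natural_iso_def comp_fctr_def id_fctr_def susp_fctr_def by auto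
  have eq: "f \<cdot> \<eta> (Dom K g) = g \<cdot> \<eta> (Dom K g)"
    using nat[OF assms(1)] nat[OF assms(2)] assms(3-5) by metis
  show ?thesis by (rule iso_cancel_right[OF 1(3) assms(1,2) _ _ eq]) (simp_all only: 1 assms(3))
qed

lemma Sus_essentially_surjective:
  assumes "Y \<in> Obj K"
  obtains X a where "X \<in> Obj K" "is_iso K a" "a \<in> Arr K" "Dom K a = Sus K X" "Cod K a = Y"
proof -
  obtain G \<epsilon> where G: "is_functor K K G" and \<epsilon>: "natural_iso K K (susp_fctr K \<circ>\<circ> G) id_fctr \<epsilon>"
    using susp_equivalence unfolding is_equivalence_def by blast
  show ?thesis
    by (rule that[of "FO G Y" "\<epsilon> Y"])
      (use assms G \<epsilon> in \<open>auto simp: is_functor_def natural_iso_def comp_fctr_def id_fctr_def susp_fctr_def\<close>)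
qed

lemma SusA_full:
  assumes X: "X \<in> Obj K" and Y: "Y \<in> Obj K"
    and h: "h \<in> Arr K" "Dom K h = Sus K X" "Cod K h = Sus K Y"
  obtains f where "f \<in> Arr K" "Dom K f = X" "Cod K f = Y" "SusA K f = h"
proof -
  obtain G \<eta> \<epsilon> where G: "is_functor K K G"
    and \<eta>: "natural_iso K K (G \<circ>\<circ> susp_fctr K) id_fctr \<eta>"
    and \<epsilon>: "natural_iso K K (susp_fctr K \<circ>\<circ> G) id_fctr \<epsilon>"
    using susp_equivalence unfolding is_equivalence_def by blast
  have GA: "FA G a \<in> Arr K" "Dom K (FA G a) = FO G (Dom K a)" "Cod K (FA G a) = FO G (Cod K a)"
    if "a \<in> Arr K" for a using G that unfolding is_functor_def by auto
  have nat: "\<eta> (Cod K a) \<cdot> FA G (SusA K a) = a \<cdot> \<eta> (Dom K a)" if "a \<in> Arr K" for a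
    using \<eta> that unfolding natural_iso_def comp_fctr_def id_fctr_def susp_fctr_def by auto
  have nat': "\<epsilon> (Cod K a) \<cdot> SusA K (FA G a) = a \<cdot> \<epsilon> (Dom K a)" if "a \<in> Arr K" for a
    using \<epsilon> that unfolding natural_iso_def comp_fctr_def id_fctr_def susp_fctr_def by auto
  have e: "\<eta> A \<in> Arr K" "Dom K (\<eta> A) = FO G (Sus K A)" "Cod K (\<eta> A) = A" "is_iso K (\<eta> A)"
    "\<epsilon> A \<in> Arr K" "Dom K (\<epsilon> A) = Sus K (FO G A)" "Cod K (\<epsilon> A) = A" "is_iso K (\<epsilon> A)"
    if "A \<in> Obj K" for A
    using \<eta> \<epsilon> that unfolding natural_iso_def comp_fctr_def id_fctr_def susp_fctr_def by auto
  obtain r where r: "r \<in> Arr K" "Dom K r = X" "Cod K r = FO G (Sus K X)"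
    "r \<cdot> \<eta> X = Ide K (FO G (Sus K X))"
    using e(4)[OF X] e(1-3)[OF X] by (elim is_isoE) auto
  define f where "f = \<eta> Y \<cdot> (FA G h \<cdot> r)"
  have f: "f \<in> Arr K" "Dom K f = X" "Cod K f = Y"
    using e[OF X] e[OF Y] GA[OF h(1)] r h unfolding f_def by simp_all
  have "f \<cdot> \<eta> X = \<eta> Y \<cdot> FA G h"
    unfolding f_def using e[OF X] e[OF Y] GA[OF h(1)] r h by simp
  then have eq: "\<eta> Y \<cdot> FA G (SusA K f) = \<eta> Y \<cdot> FA G h" using nat[OF f(1)] f by simp
  have *: "FA G (SusA K f) = FA G h"
    by (rule iso_cancel_left[OF e(4)[OF Y] _ _ _ _ eq])
      (use e[OF Y] GA[OF h(1)] GA[OF SusA_simps(1)[OF f(1)]] f h in simp_all)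
  have eq: "SusA K f \<cdot> \<epsilon> (Sus K X) = h \<cdot> \<epsilon> (Sus K X)"
    using nat'[OF h(1)] nat'[OF SusA_simps(1)[OF f(1)]] * f h by simp
  have "SusA K f = h"
    by (rule iso_cancel_right[OF _ _ _ _ _ eq]) (use e[of "Sus K X"] X f h in simp_all)
  with f show ?thesis by (rule that)
qed

lemma TriD:
  assumes "(f, g, h) \<in> Tri K"
  shows "f \<in> Arr K" "g \<in> Arr K" "h \<in> Arr K" "Dom K g = Cod K f" "Dom K h = Cod K g"
    "Cod K h = Sus K (Dom K f)"
  using Tri_triangle[OF assms] by auto

lemma Tri_rotate: "(f, g, h) \<in> Tri K \<Longrightarrow> (g, h, Neg K (SusA K f)) \<in> Tri K"
  using rotation[of f g h] Tri_triangle by blast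

lemma Tri_change_cone:
  assumes T: "(f, g, h) \<in> Tri K" and c: "is_iso K c" "c \<in> Arr K" "Dom K c = Cod K g"
    and h': "h' \<in> Arr K" "Dom K h' = Cod K c" "Cod K h' = Cod K h" "h' \<cdot> c = h"
  shows "(f, c \<cdot> g, h') \<in> Tri K"
proof (rule Tri_iso[OF T])
  note t = TriD[OF T]
  show "is_triangle K (f, c \<cdot> g, h')" using t c h'(1-3) by simp
  have "tri_mor K (f, g, h) (f, c \<cdot> g, h') (Ide K (Dom K f), Ide K (Cod K f), c)"
    using t c h' by simp
  then show "tri_isomorphic K (f, g, h) (f, c \<cdot> g, h')"
    unfolding tri_isomorphic_def using c t by (meson Cod_Obj Dom_Obj is_iso_Ide)
qed

lemma Tri_Ide2:
  assumes "Y \<in> Obj K" "is_zero K Z"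
  shows "(Zer K Z Y, Ide K Y, Zer K Y (Sus K Z)) \<in> Tri K"
proof -
  have "(Ide K Y, Zer K Y (Sus K Z), Zer K (Sus K Z) (Sus K Y)) \<in> Tri K"
    using assms Sus_zero by (intro Tri_Ide)
  then show ?thesis using assms by (subst rotation) auto
qed

lemma iso_cone:
  assumes "is_iso K a" "a \<in> Arr K" "is_zero K Z"
  shows "(a, Zer K (Cod K a) Z, Zer K Z (Sus K (Dom K a))) \<in> Tri K"
proof (rule Tri_iso[OF Tri_Ide[OF _ assms(3)]])
  show "tri_isomorphic K (Ide K (Dom K a), Zer K (Dom K a) Z, Zer K Z (Sus K (Dom K a)))
     (a, Zer K (Cod K a) Z, Zer K Z (Sus K (Dom K a)))"
    unfolding tri_isomorphic_def
    by (rule exI[of _ "Ide K (Dom K a)"], rule exI[of _ a], rule exI[of _ "Ide K Z"])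
      (use assms in auto)
qed (use assms in auto)

lemma Tri_comp:
  assumes T: "(f, g, h) \<in> Tri K"
  shows "g \<cdot> f = Zer K (Dom K f) (Cod K g)"
proof -
  note t = TriD[OF T]
  obtain Z where Z: "is_zero K Z" using zero_ex by blast
  have "(Ide K (Dom K f), Zer K (Dom K f) Z, Zer K Z (Sus K (Dom K f))) \<in> Tri K"
    using t Z by (intro Tri_Ide) auto
  from fill_in[OF this T, of "Ide K (Dom K f)" f] obtain c where
    "tri_mor K (Ide K (Dom K f), Zer K (Dom K f) Z, Zer K Z (Sus K (Dom K f))) (f, g, h)
      (Ide K (Dom K f), f, c)" using t by auto
  then have c: "c \<in> Arr K" "Dom K c = Z" "Cod K c = Cod K g" "c \<cdot> Zer K (Dom K f) Z = g \<cdot> f"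
    using t Z by auto
  show ?thesis unfolding c(4)[symmetric] using c t Z by simp
qed

lemma Tri_comp2: "(f, g, h) \<in> Tri K \<Longrightarrow> h \<cdot> g = Zer K (Cod K f) (Sus K (Dom K f))"
  using Tri_comp[OF Tri_rotate] TriD by metis

lemma Tri_comp3:
  assumes T: "(f, g, h) \<in> Tri K"
  shows "SusA K f \<cdot> h = Zer K (Cod K g) (Sus K (Cod K f))"
proof -
  note t = TriD[OF T]
  have "Neg K (SusA K f \<cdot> h) = Zer K (Cod K g) (Sus K (Cod K f))"
    using Tri_comp2[OF Tri_rotate[OF T]] t by simp
  then have "Neg K (Neg K (SusA K f \<cdot> h)) = Zer K (Cod K g) (Sus K (Cod K f))" using t by simp
  then show ?thesis using t by simp
qed

text \<open>A morphism from the rotated trivial triangle on the domain of \<open>a\<close> to the rotated given triangle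
  supplies a factorisation of \<open>\<Sigma>a\<close> through \<open>\<Sigma>f\<close>, and \<open>\<Sigma>\<close> is fully faithful.\<close>

lemma weak_kernel:
  assumes T: "(f, g, h) \<in> Tri K"
    and a: "a \<in> Arr K" "Cod K a = Cod K f" "g \<cdot> a = Zer K (Dom K a) (Cod K g)"
  obtains b where "b \<in> Arr K" "Dom K b = Dom K a" "Cod K b = Dom K f" "f \<cdot> b = a"
proof -
  note t = TriD[OF T]
  obtain Z where Z: "is_zero K Z" using zero_ex by blast
  have 1: "(Zer K (Dom K a) Z, Zer K Z (Sus K (Dom K a)), Neg K (SusA K (Ide K (Dom K a)))) \<in> Tri K"
    using a Z by (intro Tri_rotate[OF Tri_Ide]) auto
  from fill_in[OF 1 Tri_rotate[OF T], of a "Zer K Z (Cod K g)"] obtain c where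
    "tri_mor K (Zer K (Dom K a) Z, Zer K Z (Sus K (Dom K a)), Neg K (SusA K (Ide K (Dom K a))))
      (g, h, Neg K (SusA K f)) (a, Zer K Z (Cod K g), c)" using t a Z by auto
  then have c: "c \<in> Arr K" "Dom K c = Sus K (Dom K a)" "Cod K c = Sus K (Dom K f)"
    "SusA K a \<cdot> Neg K (Ide K (Sus K (Dom K a))) = Neg K (SusA K f) \<cdot> c"
    using t a Z by auto
  obtain b where b: "b \<in> Arr K" "Dom K b = Dom K a" "Cod K b = Dom K f" "SusA K b = c"
    using SusA_full[of "Dom K a" "Dom K f" c] c t a by auto
  have "Neg K (SusA K a) = Neg K (SusA K (f \<cdot> b))"
    using c(4) by (simp add: c(1-3) b a(1,2) t)
  then have "Neg K (Neg K (SusA K a)) = Neg K (Neg K (SusA K (f \<cdot> b)))" by (simp only:)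
  then have eq: "SusA K (f \<cdot> b) = SusA K a"
    using Neg_Neg[of "SusA K a"] Neg_Neg[of "SusA K (f \<cdot> b)"] t(1) a(1) b(1,3)
    by (simp only: SusA_simps Cmp_simps)
  have "f \<cdot> b = a" by (rule SusA_faithful[OF _ _ _ _ eq]) (use t a(1,2) b(1-3) in simp_all)
  with b show ?thesis by (intro that) auto
qed

lemma weak_kernel2:
  assumes T: "(f, g, h) \<in> Tri K"
    and a: "a \<in> Arr K" "Cod K a = Cod K g" "h \<cdot> a = Zer K (Dom K a) (Cod K h)"
  obtains b where "b \<in> Arr K" "Dom K b = Dom K a" "Cod K b = Cod K f" "g \<cdot> b = a"
  using weak_kernel[OF Tri_rotate[OF T], of a] a TriD[OF T] by metis

lemma weak_cokernel:
  assumes T: "(f, g, h) \<in> Tri K"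
    and a: "a \<in> Arr K" "Dom K a = Cod K f" "a \<cdot> f = Zer K (Dom K f) (Cod K a)"
  obtains b where "b \<in> Arr K" "Dom K b = Cod K g" "Cod K b = Cod K a" "b \<cdot> g = a"
proof -
  note t = TriD[OF T]
  obtain Z where Z: "is_zero K Z" using zero_ex by blast
  have "(Zer K Z (Cod K a), Ide K (Cod K a), Zer K (Cod K a) (Sus K Z)) \<in> Tri K"
    using a Z by (intro Tri_Ide2) auto
  from fill_in[OF T this, of "Zer K (Dom K f) Z" a] obtain c where
    "tri_mor K (f, g, h) (Zer K Z (Cod K a), Ide K (Cod K a), Zer K (Cod K a) (Sus K Z))
      (Zer K (Dom K f) Z, a, c)" using t a Z by auto
  then show ?thesis using t a Z by (intro that[of c]) auto
qed

text \<open>The axioms provide cones only: the cone of \<open>g\<close> is desuspended, which is possible up to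
  isomorphism.\<close>

lemma fibre_ex:
  assumes g: "g \<in> Arr K"
  obtains f h where "(f, g, h) \<in> Tri K"
proof -
  obtain h k where T: "(g, h, k) \<in> Tri K" using cone_ex[OF g] by blast
  note t = TriD[OF T]
  obtain D a where D: "D \<in> Obj K" and a: "is_iso K a" "a \<in> Arr K" "Dom K a = Sus K D" "Cod K a = Cod K h"
    using Sus_essentially_surjective[of "Cod K h"] t by auto
  from a(1) obtain b where b: "b \<in> Arr K" "Dom K b = Cod K h" "Cod K b = Sus K D"
    "b \<cdot> a = Ide K (Sus K D)" "a \<cdot> b = Ide K (Cod K h)" by (elim is_isoE) (use a in auto)
  have bi: "is_iso K b" by (rule is_isoI[where g = a]) (use a b in auto)
  obtain f where f: "f \<in> Arr K" "Dom K f = D" "Cod K f = Dom K g" "SusA K f = k \<cdot> a"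
    using SusA_full[of D "Dom K g" "k \<cdot> a"] D a t by auto
  have "(g, b \<cdot> h, k \<cdot> a) \<in> Tri K"
    by (rule Tri_change_cone[OF T bi]) (use a b t in auto)
  then have "(Neg K f, g, b \<cdot> h) \<in> Tri K"
    using a b t f by (subst rotation) auto
  then show ?thesis by (rule that)
qed

lemma is_biproductD:
  assumes "is_biproduct K X Y B i j p q"
  shows "X \<in> Obj K" "Y \<in> Obj K" "B \<in> Obj K"
    "i \<in> Arr K" "Dom K i = X" "Cod K i = B" "j \<in> Arr K" "Dom K j = Y" "Cod K j = B"
    "p \<in> Arr K" "Dom K p = B" "Cod K p = X" "q \<in> Arr K" "Dom K q = B" "Cod K q = Y"
    "p \<cdot> i = Ide K X" "q \<cdot> j = Ide K Y" "p \<cdot> j = Zer K Y X" "q \<cdot> i = Zer K X Y"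
    "Add K (i \<cdot> p) (j \<cdot> q) = Ide K B"
  using assms unfolding is_biproduct_def by auto

lemma is_biproduct_sym:
  "is_biproduct K X Y B i j p q \<Longrightarrow> is_biproduct K Y X B j i q p"
  using Add_commute[of "i \<cdot> p" "j \<cdot> q"] unfolding is_biproduct_def by auto

text \<open>The connecting map of a triangle on \<open>s\<close> vanishes, being \<open>\<Sigma>r \<Sigma>s h\<close> with \<open>\<Sigma>s h = 0\<close>. Hence the
  cone map \<open>k\<close> has a section \<open>\<tau>\<close>; subtracting \<open>s r \<tau>\<close> makes it orthogonal to \<open>r\<close>.\<close>

lemma split_mono_biproduct:
  assumes s: "s \<in> Arr K" and r: "r \<in> Arr K" "Dom K r = Cod K s" "Cod K r = Dom K s"
    "r \<cdot> s = Ide K (Dom K s)"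
  obtains C \<sigma> k where "is_biproduct K (Dom K s) C (Cod K s) s \<sigma> r k"
    "(s, k, Zer K C (Sus K (Dom K s))) \<in> Tri K"
proof -
  obtain k h where T: "(s, k, h) \<in> Tri K" using cone_ex[OF s] by blast
  note t = TriD[OF T]
  have "h = SusA K r \<cdot> (SusA K s \<cdot> h)"
    using t r Cmp_reassoc1[of "SusA K r" "SusA K s" "Ide K (Sus K (Dom K s))" h]
    by (auto simp flip: SusA_Cmp)
  also have "\<dots> = Zer K (Cod K k) (Sus K (Dom K s))"
    using Tri_comp3[OF T] t r by simp
  finally have h: "h = Zer K (Cod K k) (Sus K (Dom K s))" .
  obtain \<tau> where \<tau>: "\<tau> \<in> Arr K" "Dom K \<tau> = Cod K k" "Cod K \<tau> = Cod K s" "k \<cdot> \<tau> = Ide K (Cod K k)"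
    using weak_kernel2[OF T, of "Ide K (Cod K k)"] t h by auto
  define \<sigma> where "\<sigma> = Sub K \<tau> (s \<cdot> (r \<cdot> \<tau>))"
  have ks: "k \<cdot> s = Zer K (Dom K s) (Cod K k)" by (rule Tri_comp[OF T])
  have \<sigma>: "\<sigma> \<in> Arr K" "Dom K \<sigma> = Cod K k" "Cod K \<sigma> = Cod K s"
    using t r \<tau> by (auto simp: \<sigma>_def)
  have rs: "r \<cdot> (s \<cdot> w) = w" "k \<cdot> (s \<cdot> w) = Zer K (Dom K w) (Cod K k)"
    if "w \<in> Arr K" "Cod K w = Dom K s" for w
    using that t r Cmp_reassoc1[OF r(4), of w] Cmp_reassoc1[OF ks, of w] by auto
  have r\<sigma>: "r \<cdot> \<sigma> = Zer K (Cod K k) (Dom K s)"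
    using t r \<tau> rs by (simp add: \<sigma>_def Sub_def)
  have k\<sigma>: "k \<cdot> \<sigma> = Ide K (Cod K k)"
    using t r \<tau> rs by (simp add: \<sigma>_def Sub_def)
  \<comment> \<open>The defect \<open>e\<close> is annihilated by \<open>k\<close>, hence of the form \<open>s d\<close>, and by \<open>r\<close>, hence zero.\<close>
  define e where "e = Sub K (Ide K (Cod K s)) (Add K (s \<cdot> r) (\<sigma> \<cdot> k))"
  have e: "e \<in> Arr K" "Dom K e = Cod K s" "Cod K e = Cod K s"
    using t r \<sigma> by (auto simp: e_def)
  have "k \<cdot> (\<sigma> \<cdot> k) = k" "r \<cdot> (\<sigma> \<cdot> k) = Zer K (Cod K s) (Dom K s)"
    using t r \<sigma> Cmp_reassoc1[OF k\<sigma>, of k] Cmp_reassoc1[OF r\<sigma>, of k] by auto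
  then have ke: "k \<cdot> e = Zer K (Cod K s) (Cod K k)" and re: "r \<cdot> e = Zer K (Cod K s) (Dom K s)"
    using t r \<sigma> rs by (auto simp: e_def Sub_def)
  obtain d where d: "d \<in> Arr K" "Dom K d = Cod K s" "Cod K d = Dom K s" "s \<cdot> d = e"
    using weak_kernel[OF T, of e] ke e t by auto
  have "d = r \<cdot> e" using rs d by auto
  then have "e = Zer K (Cod K s) (Cod K s)" using re d t by auto
  then have "Ide K (Cod K s) = Add K (s \<cdot> r) (\<sigma> \<cdot> k)"
    using Sub_eq_Zer_iff[of "Ide K (Cod K s)" "Add K (s \<cdot> r) (\<sigma> \<cdot> k)"] t r \<sigma> by (auto simp: e_def)
  then have "is_biproduct K (Dom K s) (Cod K k) (Cod K s) s \<sigma> r k"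
    unfolding is_biproduct_def using t r \<sigma> ks r\<sigma> k\<sigma> by auto
  then show ?thesis using T h by (intro that) auto
qed

lemma biproduct_Tri:
  assumes B: "is_biproduct K X Y B i j p q"
  shows "(i, q, Zer K Y (Sus K X)) \<in> Tri K"
proof -
  note b = is_biproductD[OF B]
  obtain C \<sigma> k where B': "is_biproduct K X C B i \<sigma> p k" and T: "(i, k, Zer K C (Sus K X)) \<in> Tri K"
    using split_mono_biproduct[of i p] b by auto
  note b' = is_biproductD[OF B']
  \<comment> \<open>Both \<open>C\<close> and \<open>Y\<close> are complements of \<open>X\<close> in \<open>B\<close>, hence isomorphic over \<open>B\<close>.\<close>
  have q: "q = (q \<cdot> \<sigma>) \<cdot> k"
  proof -
    have "q = q \<cdot> Add K (i \<cdot> p) (\<sigma> \<cdot> k)" using b b' by simp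
    also have "\<dots> = Add K (q \<cdot> (i \<cdot> p)) (q \<cdot> (\<sigma> \<cdot> k))" using b(1-15) b'(1-15) by (subst Cmp_Add') auto
    also have "\<dots> = (q \<cdot> \<sigma>) \<cdot> k" using b b'(1-15) Cmp_reassoc1[OF b(19), of p] by simp
    finally show ?thesis .
  qed
  have k: "k = (k \<cdot> j) \<cdot> q"
  proof -
    have "k = k \<cdot> Add K (i \<cdot> p) (j \<cdot> q)" using b b' by simp
    also have "\<dots> = Add K (k \<cdot> (i \<cdot> p)) (k \<cdot> (j \<cdot> q))" using b(1-15) b'(1-15) by (subst Cmp_Add') auto
    also have "\<dots> = (k \<cdot> j) \<cdot> q" using b(1-15) b' Cmp_reassoc1[OF b'(19), of p] by simp
    finally show ?thesis .
  qed
  have 1: "(k \<cdot> j) \<cdot> (q \<cdot> \<sigma>) = Ide K C"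
  proof -
    have "(k \<cdot> j) \<cdot> (q \<cdot> \<sigma>) = ((k \<cdot> j) \<cdot> q) \<cdot> \<sigma>" using b(1-15) b'(1-15) by simp
    then show ?thesis using b'(17) k by simp
  qed
  have 2: "(q \<cdot> \<sigma>) \<cdot> (k \<cdot> j) = Ide K Y"
  proof -
    have "(q \<cdot> \<sigma>) \<cdot> (k \<cdot> j) = ((q \<cdot> \<sigma>) \<cdot> k) \<cdot> j" using b(1-15) b'(1-15) by simp
    then show ?thesis using b(17) q by simp
  qed
  have "is_iso K (q \<cdot> \<sigma>)"
    by (rule is_isoI[where g = "k \<cdot> j"]) (use 1 2 b(1-15) b'(1-15) in auto)
  then have "(i, (q \<cdot> \<sigma>) \<cdot> k, Zer K Y (Sus K X)) \<in> Tri K"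
    using b(1-15) b'(1-15) by (intro Tri_change_cone[OF T]) auto
  then show ?thesis using q by simp
qed

end

lemma the_elem_eqI: "x \<in> A \<Longrightarrow> (\<And>y. y \<in> A \<Longrightarrow> y = x) \<Longrightarrow> the_elem A = x"
  by (metis is_singletonI' is_singleton_the_elem empty_iff singletonD)

lemma verdier_simps:
  "Obj (verdier K J) = Obj K" "Arr (verdier K J) = roofs K J // roof_rel K J" "Ide (verdier K J) = (\<lambda>X. roof K J (Ide K X) (Ide K X))"
  "Zer (verdier K J) = (\<lambda>X Y. roof K J (Ide K X) (Zer K X Y))" "Sus (verdier K J) = Sus K"
  "Dom (verdier K J) = (\<lambda>c. the_elem {Cod K s | s f. (s, f) \<in> c})"
  "Cod (verdier K J) = (\<lambda>c. the_elem {Cod K f | s f. (s, f) \<in> c})"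
  "Cmp (verdier K J) = (\<lambda>d c. the_elem {roof K J (s \<cdot>\<^bsub>K\<^esub> t') (g \<cdot>\<^bsub>K\<^esub> f') | s f t g t' f'.
               (s, f) \<in> c \<and> (t, g) \<in> d \<and> t' \<in> cone_in K J \<and> t' \<in> Arr K \<and> f' \<in> Arr K \<and>
               Dom K t' = Dom K f' \<and> Cod K t' = Dom K f \<and> Cod K f' = Dom K t \<and>
               f \<cdot>\<^bsub>K\<^esub> t' = t \<cdot>\<^bsub>K\<^esub> f'})"
  "Add (verdier K J) = (\<lambda>c d. the_elem {roof K J s (Add K f g) | s f g. (s, f) \<in> c \<and> (s, g) \<in> d})"
  "SusA (verdier K J) = (\<lambda>c. the_elem {roof K J (SusA K s) (SusA K f) | s f. (s, f) \<in> c})"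
  unfolding verdier_def with_triangles_def verdier_suscat_def suscat.extend_def tricat.fields_def
  by simp_all

section \<open>Arrows with cone in a thick subcategory\<close>

locale thick_subcategory = triangulated_category K
  for K :: "('o, 'm, 'z) tricat_scheme" (structure) +
  fixes J :: "'o set"
  assumes thick_J: "thick K J"
begin

abbreviation S :: "'m set" where "S \<equiv> cone_in K J"

lemma J_Obj [simp]: "X \<in> J \<Longrightarrow> X \<in> Obj K"
  using thick_J unfolding thick_def by auto

lemma zero_in_J: obtains Z where "Z \<in> J" "is_zero K Z"
  using thick_J unfolding thick_def by auto

lemma J_Sus [simp]: "X \<in> Obj K \<Longrightarrow> Sus K X \<in> J \<longleftrightarrow> X \<in> J"
  using thick_J unfolding thick_def by auto

lemma J_Tri:
  assumes "(f, g, h) \<in> Tri K"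
  shows "Dom K f \<in> J \<Longrightarrow> Cod K f \<in> J \<Longrightarrow> Cod K g \<in> J"
    "Cod K f \<in> J \<Longrightarrow> Cod K g \<in> J \<Longrightarrow> Dom K f \<in> J"
    "Dom K f \<in> J \<Longrightarrow> Cod K g \<in> J \<Longrightarrow> Cod K f \<in> J"
  using thick_J assms TriD[OF assms] unfolding thick_def by metis+

lemma J_biproduct: "is_biproduct K X Y B i j p q \<Longrightarrow> B \<in> J \<Longrightarrow> X \<in> J"
  using thick_J unfolding thick_def by blast

lemma S_Arr [simp]: "s \<in> S \<Longrightarrow> s \<in> Arr K"
  unfolding cone_in_def using TriD by blast

lemma S_I: "(s, g, h) \<in> Tri K \<Longrightarrow> Cod K g \<in> J \<Longrightarrow> s \<in> S"
  unfolding cone_in_def by blast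

lemma S_E: 
  assumes "s \<in> S" obtains g h where "(s, g, h) \<in> Tri K" "Cod K g \<in> J"
  using assms unfolding cone_in_def by blast

text \<open>The octahedral axiom for \<open>s = id \<cdot> s\<close> puts any two cones of \<open>s\<close> into a triangle with a zero
  object, so that the choice of the cone in \<^const>\<open>cone_in\<close> is immaterial.\<close>

lemma S_cone:
  assumes "s \<in> S" and T: "(s, g, h) \<in> Tri K"
  shows "Cod K g \<in> J"
proof -
  obtain g0 h0 where T0: "(s, g0, h0) \<in> Tri K" and g0: "Cod K g0 \<in> J" using S_E[OF assms(1)] .
  obtain Z where Z: "Z \<in> J" "is_zero K Z" by (rule zero_in_J)
  note t = TriD[OF T] TriD[OF T0]
  have I: "(Ide K (Cod K s), Zer K (Cod K s) Z, Zer K Z (Sus K (Cod K s))) \<in> Tri K"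
    using t Z by (intro Tri_Ide) auto
  have "(Ide K (Cod K s) \<cdot> s, g, h) \<in> Tri K" using T t by simp
  from octahedral[OF T0 I _ this] obtain u v where
    T': "(u, v, SusA K g0 \<cdot> Zer K Z (Sus K (Cod K s))) \<in> Tri K"
    and m: "tri_mor K (s, g0, h0) (Ide K (Cod K s) \<cdot> s, g, h) (Ide K (Dom K s), Ide K (Cod K s), u)"
      "tri_mor K (Ide K (Cod K s) \<cdot> s, g, h) (Ide K (Cod K s), Zer K (Cod K s) Z, Zer K Z (Sus K (Cod K s)))
        (s, Ide K (Cod K (Ide K (Cod K s))), v)"
    using t by auto
  have "u \<in> Hom K (Dom K h0) (Dom K h)" "v \<in> Hom K (Dom K h) (Dom K (Zer K Z (Sus K (Cod K s))))"
    using m by (simp_all only: tri_mor.simps)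
  then have "Dom K u = Cod K g0" "Cod K u = Cod K g" "Cod K v = Z"
    using t(5,11) Z(2) TriD(1)[OF T0] by simp_all
  then show ?thesis using J_Tri(3)[OF T'] g0 Z by simp
qed

lemma S_fibre:
  assumes T: "(r, s, m) \<in> Tri K"
  shows "s \<in> S \<longleftrightarrow> Dom K r \<in> J"
proof -
  note t = TriD[OF T]
  show ?thesis using S_cone[OF _ Tri_rotate[OF T]] S_I[OF Tri_rotate[OF T]] t by auto
qed

lemma S_Cmp:
  assumes s: "s \<in> S" and r: "r \<in> S" and c: "Cod K s = Dom K r"
  shows "r \<cdot> s \<in> S"
proof -
  obtain s1 s2 where T1: "(s, s1, s2) \<in> Tri K" "Cod K s1 \<in> J" using S_E[OF s] .
  obtain r1 r2 where T2: "(r, r1, r2) \<in> Tri K" "Cod K r1 \<in> J" using S_E[OF r] .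
  note t = TriD[OF T1(1)] TriD[OF T2(1)]
  have "r \<cdot> s \<in> Arr K" using t c by simp
  then obtain k1 k2 where T3: "(r \<cdot> s, k1, k2) \<in> Tri K" using cone_ex by blast
  note t = t TriD[OF T3]
  from octahedral[OF T1(1) T2(1) c T3] obtain u v where
    T': "(u, v, SusA K s1 \<cdot> r2) \<in> Tri K"
    and m: "tri_mor K (s, s1, s2) (r \<cdot> s, k1, k2) (Ide K (Dom K s), r, u)"
      "tri_mor K (r \<cdot> s, k1, k2) (r, r1, r2) (s, Ide K (Cod K r), v)" by blast
  have "u \<in> Hom K (Dom K s2) (Dom K k2)" "v \<in> Hom K (Dom K k2) (Dom K r2)"
    using m by (simp_all only: tri_mor.simps)
  then have "Dom K u = Cod K s1" "Cod K u = Cod K k1" "Cod K v = Cod K r1" using t by simp_all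
  then have "Cod K k1 \<in> J" using J_Tri(3)[OF T'] T1(2) T2(2) by auto
  then show ?thesis using S_I[OF T3] by blast
qed

lemma iso_S: "is_iso K a \<Longrightarrow> a \<in> S"
proof -
  assume a: "is_iso K a"
  then have a': "a \<in> Arr K" by (rule is_isoE)
  obtain Z where Z: "Z \<in> J" "is_zero K Z" by (rule zero_in_J)
  show ?thesis by (rule S_I[OF iso_cone[OF a a' Z(2)]]) (use a' Z in auto)
qed

lemma Ide_S [simp]: "X \<in> Obj K \<Longrightarrow> Ide K X \<in> S"
  by (intro iso_S is_iso_Ide)

lemma Neg_S: assumes "s \<in> S" shows "Neg K s \<in> S"
proof -
  have "Neg K (Ide K (Cod K s)) \<cdot> s \<in> S"
    by (rule S_Cmp[OF assms iso_S[OF is_iso_Neg_Ide]]) (use assms in auto)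
  then show ?thesis using assms by simp
qed

lemma SusA_S [simp]: assumes "s \<in> S" shows "SusA K s \<in> S"
proof -
  obtain g h where T: "(s, g, h) \<in> Tri K" "Cod K g \<in> J" using S_E[OF assms] .
  have "(Neg K (SusA K s), Neg K (SusA K g), Neg K (SusA K h)) \<in> Tri K"
    using T by (intro Tri_rotate)
  then have "Neg K (SusA K s) \<in> S" by (rule S_I) (use T TriD[OF T(1)] in auto)
  then have "Neg K (Neg K (SusA K s)) \<in> S" by (rule Neg_S)
  then show ?thesis using assms by simp
qed

text \<open>The fibre of an arrow has the codomain of the arrow as a cone.\<close>

lemma kill:
  assumes f: "f \<in> Arr K" "Cod K f \<in> J"
  obtains w where "w \<in> S" "Cod K w = Dom K f" "f \<cdot> w = Zer K (Dom K w) (Cod K f)"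
proof -
  obtain w h where T: "(w, f, h) \<in> Tri K" using fibre_ex[OF f(1)] .
  show ?thesis by (rule that[of w]) (use f TriD[OF T] S_I[OF T] Tri_comp[OF T] in auto)
qed

text \<open>If \<open>k\<close> is the cone map of \<open>s\<close> and \<open>w \<in> S\<close> kills \<open>k f\<close>, then \<open>f w\<close> factors through \<open>s\<close>.\<close>

lemma Ore:
  assumes f: "f \<in> Arr K" and s: "s \<in> S" "Cod K s = Cod K f"
  obtains s' f' where "s' \<in> S" "f' \<in> Arr K" "Cod K s' = Dom K f" "Dom K f' = Dom K s'"
    "Cod K f' = Dom K s" "f \<cdot> s' = s \<cdot> f'"
proof -
  obtain k h where T: "(s, k, h) \<in> Tri K" "Cod K k \<in> J" using S_E[OF s(1)] .
  note t = TriD[OF T(1)]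
  obtain w where w: "w \<in> S" "Cod K w = Dom K f" "(k \<cdot> f) \<cdot> w = Zer K (Dom K w) (Cod K k)"
    using kill[of "k \<cdot> f"] f s t T(2) by auto
  obtain b where "b \<in> Arr K" "Dom K b = Dom K w" "Cod K b = Dom K s" "s \<cdot> b = f \<cdot> w"
    using weak_kernel[OF T(1), of "f \<cdot> w"] w f s t by auto
  then show ?thesis using w by (intro that[of w b]) auto
qed

text \<open>The difference of \<open>f\<close> and \<open>g\<close> factors through the fibre of \<open>s\<close>, an object of \<open>J\<close>.\<close>

lemma cancel:
  assumes s: "s \<in> S" and f: "f \<in> Arr K" "g \<in> Arr K" "Cod K f = Dom K s" "Cod K g = Dom K s"
    "Dom K f = Dom K g" and eq: "s \<cdot> f = s \<cdot> g"
  obtains w where "w \<in> S" "Cod K w = Dom K g" "f \<cdot> w = g \<cdot> w"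
proof -
  obtain r h where T: "(r, s, h) \<in> Tri K" using fibre_ex[OF S_Arr[OF s]] .
  note t = TriD[OF T]
  have rJ: "Dom K r \<in> J" using S_fibre[OF T] s by simp
  have "s \<cdot> Sub K f g = Sub K (s \<cdot> f) (s \<cdot> g)" using f s by (intro Cmp_Sub) auto
  also have "\<dots> = Zer K (Dom K g) (Cod K s)"
    using Sub_eq_Zer_iff[of "s \<cdot> f" "s \<cdot> g"] f s eq by auto
  finally have 0: "s \<cdot> Sub K f g = Zer K (Dom K g) (Cod K s)" .
  obtain d where d: "d \<in> Arr K" "Dom K d = Dom K g" "Cod K d = Dom K r" "r \<cdot> d = Sub K f g"
    using weak_kernel[OF T, of "Sub K f g"] t f 0 by auto
  obtain w where w: "w \<in> S" "Cod K w = Dom K g" "d \<cdot> w = Zer K (Dom K w) (Dom K r)"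
    using kill[of d] d rJ by auto
  have "Sub K (f \<cdot> w) (g \<cdot> w) = Sub K f g \<cdot> w" using f w by (intro Sub_Cmp[symmetric]) auto
  also have "\<dots> = r \<cdot> (d \<cdot> w)" unfolding d(4)[symmetric] using d(1-3) w(1,2) t by simp
  also have "\<dots> = Zer K (Dom K w) (Dom K s)" using w t by simp
  finally have "f \<cdot> w = g \<cdot> w" using Sub_eq_Zer_iff[of "f \<cdot> w" "g \<cdot> w"] f w by auto
  with w show ?thesis by (intro that) auto
qed

text \<open>The Ore condition for \<open>s b\<close> and \<open>s a\<close>, followed by cancellation of \<open>s\<close>. This is the form in
  which both conditions enter all arguments about representatives of roofs.\<close>

lemma refine:
  assumes s: "s \<in> S" and a: "a \<in> Arr K" "Cod K a = Dom K s" "s \<cdot> a \<in> S"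
    and b: "b \<in> Arr K" "Cod K b = Dom K s"
  obtains x y where "x \<in> S" "Cod K x = Dom K b" "y \<in> Arr K" "Dom K y = Dom K x" "Cod K y = Dom K a"
    "b \<cdot> x = a \<cdot> y"
proof -
  obtain x y where xy: "x \<in> S" "y \<in> Arr K" "Cod K x = Dom K b" "Dom K y = Dom K x"
    "Cod K y = Dom K a" "(s \<cdot> b) \<cdot> x = (s \<cdot> a) \<cdot> y"
    by (rule Ore[of "s \<cdot> b" "s \<cdot> a"]) (use s a b in auto)
  obtain w where w: "w \<in> S" "Cod K w = Dom K x" "(b \<cdot> x) \<cdot> w = (a \<cdot> y) \<cdot> w"
    by (rule cancel[of s "b \<cdot> x" "a \<cdot> y"]) (use xy s a b in auto)
  show ?thesis
    by (rule that[of "x \<cdot> w" "y \<cdot> w"]) (use xy w a b S_Cmp in auto)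
qed

section \<open>The Verdier quotient\<close>

abbreviation V :: "('o, ('m \<times> 'm) set) tricat" where "V \<equiv> verdier K J"
abbreviation Q :: "'m \<Rightarrow> ('m \<times> 'm) set" where "Q \<equiv> FA (verdier_fctr K J)"
abbreviation Cmp_V (infixr "\<odot>" 75) where "d \<odot> c \<equiv> d \<cdot>\<^bsub>V\<^esub> c"

lemma roofs_iff: "(s, f) \<in> roofs K J \<longleftrightarrow> s \<in> S \<and> f \<in> Arr K \<and> Dom K s = Dom K f"
  unfolding roofs_def by auto

lemma roof_relI:
  assumes "(s, f) \<in> roofs K J" "(s', f') \<in> roofs K J" "a \<in> Arr K" "a' \<in> Arr K" "Dom K a = Dom K a'"
    "Cod K a = Dom K s" "Cod K a' = Dom K s'" "s \<cdot> a = s' \<cdot> a'" "f \<cdot> a = f' \<cdot> a'" "s \<cdot> a \<in> S"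
  shows "((s, f), (s', f')) \<in> roof_rel K J"
  using assms unfolding roof_rel_def by blast

text \<open>The typing facts are part of the definition because the uses of a witness rely on them.\<close>

definition refinement :: "'m \<Rightarrow> 'm \<Rightarrow> 'm \<Rightarrow> 'm \<Rightarrow> 'm \<Rightarrow> 'm \<Rightarrow> bool" where
  "refinement s f s' f' a a' \<longleftrightarrow>
     s \<in> S \<and> f \<in> Arr K \<and> Dom K f = Dom K s \<and> s' \<in> S \<and> f' \<in> Arr K \<and> Dom K f' = Dom K s' \<and>
     a \<in> Arr K \<and> a' \<in> Arr K \<and> Dom K a' = Dom K a \<and> Cod K a = Dom K s \<and> Cod K a' = Dom K s' \<and>
     s \<cdot> a = s' \<cdot> a' \<and> f \<cdot> a = f' \<cdot> a' \<and> s \<cdot> a \<in> S \<and> s' \<cdot> a' \<in> S"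

lemma refinementD:
  assumes "refinement s f s' f' a a'"
  shows "s \<in> S" "f \<in> Arr K" "Dom K f = Dom K s" "s' \<in> S" "f' \<in> Arr K" "Dom K f' = Dom K s'"
    "a \<in> Arr K" "a' \<in> Arr K" "Dom K a' = Dom K a" "Cod K a = Dom K s" "Cod K a' = Dom K s'"
    "s \<cdot> a = s' \<cdot> a'" "f \<cdot> a = f' \<cdot> a'" "s \<cdot> a \<in> S" "s' \<cdot> a' \<in> S"
  using assms unfolding refinement_def by blast+

lemma roof_relE:
  assumes "((s, f), (s', f')) \<in> roof_rel K J"
  obtains a a' where "refinement s f s' f' a a'"
proof -
  from assms obtain a a' where a: "(s, f) \<in> roofs K J" "(s', f') \<in> roofs K J" "a \<in> Arr K" "a' \<in> Arr K"
    "Dom K a = Dom K a'" "Cod K a = Dom K s" "Cod K a' = Dom K s'" "s \<cdot> a = s' \<cdot> a'" "f \<cdot> a = f' \<cdot> a'"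
    "s \<cdot> a \<in> S" unfolding roof_rel_def by blast
  have "s' \<cdot> a' \<in> S" using a(8,10) by simp
  then have "refinement s f s' f' a a'" using a unfolding refinement_def roofs_iff by metis
  then show ?thesis by (rule that)
qed

lemma roof_rel_ends:
  assumes "((s, f), (s', f')) \<in> roof_rel K J"
  shows "Cod K s = Cod K s'" "Cod K f = Cod K f'"
proof -
  obtain a a' where a': "refinement s f s' f' a a'" using assms by (rule roof_relE)
  note a = refinementD[OF a']
  have "Cod K (s \<cdot> a) = Cod K s" "Cod K (s' \<cdot> a') = Cod K s'"
    "Cod K (f \<cdot> a) = Cod K f" "Cod K (f' \<cdot> a') = Cod K f'" using a(1-11) by auto
  then show "Cod K s = Cod K s'" "Cod K f = Cod K f'" using a(12,13) by auto
qed

lemma roof_rel_equiv: "equiv (roofs K J) (roof_rel K J)"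
proof (rule equivI)
  show "roof_rel K J \<subseteq> roofs K J \<times> roofs K J" unfolding roof_rel_def by auto
  show "refl_on (roofs K J) (roof_rel K J)"
  proof (rule refl_onI, clarify)
    fix s f assume sf: "(s, f) \<in> roofs K J"
    then show "((s, f), (s, f)) \<in> roof_rel K J"
      by (intro roof_relI[where a = "Ide K (Dom K s)" and a' = "Ide K (Dom K s)"])
        (auto simp: roofs_iff)
  qed
  show "sym (roof_rel K J)"
  proof (rule symI, clarify)
    fix s f s' f' assume "((s, f), (s', f')) \<in> roof_rel K J"
    then show "((s', f'), (s, f)) \<in> roof_rel K J"
      unfolding roof_rel_def by clarsimp metis
  qed
  show "trans (roof_rel K J)"
  proof (rule transI, clarify)
    fix s f s' f' s'' f''
    assume 1: "((s, f), (s', f')) \<in> roof_rel K J" and 2: "((s', f'), (s'', f'')) \<in> roof_rel K J"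
    obtain a a' where a': "refinement s f s' f' a a'" using 1 by (rule roof_relE)
    note a = refinementD[OF a']
    obtain b b' where b': "refinement s' f' s'' f'' b b'" using 2 by (rule roof_relE)
    note b = refinementD[OF b']
    obtain x y where x: "x \<in> S" "Cod K x = Dom K a'" "y \<in> Arr K" "Dom K y = Dom K x" "Cod K y = Dom K b"
      "a' \<cdot> x = b \<cdot> y" by (rule refine[of s' b a']) (use a b in auto)
    have 1: "s \<cdot> (a \<cdot> x) = s' \<cdot> (a' \<cdot> x)" "f \<cdot> (a \<cdot> x) = f' \<cdot> (a' \<cdot> x)"
      by (rule Cmp_reassoc[OF a(12)] Cmp_reassoc[OF a(13)]; use a(1-11) x(1-5) in simp)+
    have 2: "s' \<cdot> (b \<cdot> y) = s'' \<cdot> (b' \<cdot> y)" "f' \<cdot> (b \<cdot> y) = f'' \<cdot> (b' \<cdot> y)"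
      by (rule Cmp_reassoc[OF b(12)] Cmp_reassoc[OF b(13)]; use b(1-11) x(1-5) in simp)+
    have 3: "s \<cdot> (a \<cdot> x) \<in> S" using S_Cmp[OF x(1) a(14)] a(1-11) x(1-5) by simp
    show "((s, f), (s'', f'')) \<in> roof_rel K J"
      by (rule roof_relI[where a = "a \<cdot> x" and a' = "b' \<cdot> y"])
        (use a(1-11) b(1-11) x(1-5) 1 2 3 x(6) in \<open>simp_all add: roofs_iff\<close>)
  qed
qed

lemma roof_eq_iff:
  "(s, f) \<in> roofs K J \<Longrightarrow> (s', f') \<in> roofs K J \<Longrightarrow>
    roof K J s f = roof K J s' f' \<longleftrightarrow> ((s, f), (s', f')) \<in> roof_rel K J"
  unfolding roof_def by (rule eq_equiv_class_iff[OF roof_rel_equiv])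

lemma mem_roof_iff: "(s', f') \<in> roof K J s f \<longleftrightarrow> ((s, f), (s', f')) \<in> roof_rel K J"
  unfolding roof_def by (rule Image_singleton_iff)

lemma mem_roof_eq: "(s', f') \<in> roof K J s f \<Longrightarrow> roof K J s' f' = roof K J s f"
  using equiv_class_eq[OF roof_rel_equiv] unfolding mem_roof_iff by (metis roof_def)

lemma roof_rel_roofs: "((s, f), (s', f')) \<in> roof_rel K J \<Longrightarrow> (s, f) \<in> roofs K J \<and> (s', f') \<in> roofs K J"
  unfolding roof_rel_def by auto

lemma roof_self: "(s, f) \<in> roofs K J \<Longrightarrow> (s, f) \<in> roof K J s f"
  unfolding roof_def by (rule equiv_class_self[OF roof_rel_equiv])

lemma roof_refine:
  assumes "(s, f) \<in> roofs K J" "a \<in> Arr K" "Cod K a = Dom K s" "s \<cdot> a \<in> S"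
  shows "roof K J (s \<cdot> a) (f \<cdot> a) = roof K J s f"
proof -
  have "((s \<cdot> a, f \<cdot> a), (s, f)) \<in> roof_rel K J"
    by (rule roof_relI[where a = "Ide K (Dom K a)" and a' = a])
      (use assms in \<open>auto simp: roofs_iff\<close>)
  then show ?thesis using roof_eq_iff roof_rel_roofs by blast
qed

lemma roof_Arr [simp]:
  assumes "(s, f) \<in> roofs K J"
  shows "roof K J s f \<in> Arr V" "Dom V (roof K J s f) = Cod K s" "Cod V (roof K J s f) = Cod K f"
proof -
  show "roof K J s f \<in> Arr V" using assms by (auto simp: verdier_simps roof_def intro: quotientI)
  show "Dom V (roof K J s f) = Cod K s" "Cod V (roof K J s f) = Cod K f"
    unfolding verdier_simps using roof_self[OF assms]
    by (auto intro!: the_elem_eqI simp: mem_roof_iff dest: roof_rel_ends)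
qed

lemma V_ArrE:
  assumes "c \<in> Arr V"
  obtains s f where "(s, f) \<in> roofs K J" "c = roof K J s f"
  using assms unfolding verdier_simps roof_def by (auto elim!: quotientE)

text \<open>Composition of fractions is well defined. Given two sets of choices, all arrows are precomposed
  until the choices agree: \<open>x\<close> and \<open>z\<close> compare the left legs, \<open>w\<close> factors \<open>f'\<close> through \<open>b\<close>, and
  cancelling the denominator \<open>r2\<close> with \<open>u\<close> factors \<open>f2'\<close> through \<open>b2\<close> compatibly.\<close>

lemma Cmp_roof_cong:
  assumes c: "((s, f), (s2, f2)) \<in> roof_rel K J" and d: "((r, g), (r2, g2)) \<in> roof_rel K J"
    and sq: "r' \<in> S" "f' \<in> Arr K" "Dom K f' = Dom K r'" "Cod K r' = Dom K f" "Cod K f' = Dom K r"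
      "f \<cdot> r' = r \<cdot> f'"
    and sq2: "r2' \<in> S" "f2' \<in> Arr K" "Dom K f2' = Dom K r2'" "Cod K r2' = Dom K f2" "Cod K f2' = Dom K r2"
      "f2 \<cdot> r2' = r2 \<cdot> f2'"
  shows "((s \<cdot> r', g \<cdot> f'), (s2 \<cdot> r2', g2 \<cdot> f2')) \<in> roof_rel K J"
proof -
  obtain a a2 where a': "refinement s f s2 f2 a a2" using c by (rule roof_relE)
  note a = refinementD[OF a']
  obtain b b2 where b': "refinement r g r2 g2 b b2" using d by (rule roof_relE)
  note b = refinementD[OF b']
  note ab = a(1-11) b(1-11) sq(1-5) sq2(1-5)
  obtain x y where x: "x \<in> S" "Cod K x = Dom K r'" "y \<in> Arr K" "Dom K y = Dom K x" "Cod K y = Dom K a"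
    "r' \<cdot> x = a \<cdot> y" by (rule refine[of s a r']) (use a sq in auto)
  have "s2 \<cdot> r2' \<in> S" using ab by (intro S_Cmp) auto
  then obtain z x2 where z: "z \<in> S" "Cod K z = Dom K x" "x2 \<in> Arr K" "Dom K x2 = Dom K z"
    "Cod K x2 = Dom K r2'" "(a2 \<cdot> y) \<cdot> z = r2' \<cdot> x2"
    using refine[of s2 r2' "a2 \<cdot> y"] ab x(1-5) by auto
  note xz = x(1-5) z(1-5)
  have e2: "r' \<cdot> (x \<cdot> z) = a \<cdot> (y \<cdot> z)" 
    by (rule Cmp_reassoc[OF x(6)]) (use ab xz in simp_all)
  have e4: "a2 \<cdot> (y \<cdot> z) = r2' \<cdot> x2" using z(6) ab xz by auto
  have e1: "f \<cdot> (r' \<cdot> (x \<cdot> z)) = r \<cdot> (f' \<cdot> (x \<cdot> z))" 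
    by (rule Cmp_reassoc[OF sq(6)]) (use ab xz in simp_all)
  have e3: "f \<cdot> (a \<cdot> (y \<cdot> z)) = f2 \<cdot> (a2 \<cdot> (y \<cdot> z))" 
    by (rule Cmp_reassoc[OF a(13)]) (use ab xz in simp_all)
  have e5: "f2 \<cdot> (r2' \<cdot> x2) = r2 \<cdot> (f2' \<cdot> x2)" 
    by (rule Cmp_reassoc[OF sq2(6)]) (use ab xz in simp_all)
  have e6: "r \<cdot> (f' \<cdot> (x \<cdot> z)) = r2 \<cdot> (f2' \<cdot> x2)" using e1 e2 e3 e4 e5 by metis
  obtain w v where w: "w \<in> S" "Cod K w = Dom K z" "v \<in> Arr K" "Dom K v = Dom K w" "Cod K v = Dom K b"
    "(f' \<cdot> (x \<cdot> z)) \<cdot> w = b \<cdot> v" using refine[of r b "f' \<cdot> (x \<cdot> z)"] b(14) ab xz by auto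
  note xzw = xz w(1-5)
  have "r \<cdot> ((f' \<cdot> (x \<cdot> z)) \<cdot> w) = r2 \<cdot> ((f2' \<cdot> x2) \<cdot> w)"
    by (rule Cmp_reassoc[OF e6]) (use ab xzw in simp_all)
  then have "r2 \<cdot> (f2' \<cdot> (x2 \<cdot> w)) = r \<cdot> (b \<cdot> v)" unfolding w(6) using ab xzw by simp
  also have "\<dots> = r2 \<cdot> (b2 \<cdot> v)" by (rule Cmp_reassoc[OF b(12)]) (use ab xzw in simp_all)
  finally obtain u where u: "u \<in> S" "Cod K u = Dom K w" "(f2' \<cdot> (x2 \<cdot> w)) \<cdot> u = (b2 \<cdot> v) \<cdot> u"
    using cancel[of r2 "f2' \<cdot> (x2 \<cdot> w)" "b2 \<cdot> v"] ab xzw by auto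
  note all = ab xzw u(1,2)
  have G: "g \<cdot> (f' \<cdot> (x \<cdot> (z \<cdot> (w \<cdot> u)))) = g2 \<cdot> (f2' \<cdot> (x2 \<cdot> (w \<cdot> u)))"
  proof -
    have "(f' \<cdot> (x \<cdot> z)) \<cdot> (w \<cdot> u) = b \<cdot> (v \<cdot> u)"
      by (rule Cmp_reassoc[OF w(6)]) (use all in simp_all)
    then have "f' \<cdot> (x \<cdot> (z \<cdot> (w \<cdot> u))) = b \<cdot> (v \<cdot> u)" using all by simp
    moreover have "g \<cdot> (b \<cdot> (v \<cdot> u)) = g2 \<cdot> (b2 \<cdot> (v \<cdot> u))"
      by (rule Cmp_reassoc[OF b(13)]) (use all in simp_all)
    moreover have "b2 \<cdot> (v \<cdot> u) = f2' \<cdot> (x2 \<cdot> (w \<cdot> u))" using u(3) all by simp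
    ultimately show ?thesis by metis
  qed
  have L: "s \<cdot> (r' \<cdot> (x \<cdot> (z \<cdot> (w \<cdot> u)))) = s2 \<cdot> (r2' \<cdot> (x2 \<cdot> (w \<cdot> u)))"
  proof -
    have "r' \<cdot> ((x \<cdot> z) \<cdot> (w \<cdot> u)) = a \<cdot> ((y \<cdot> z) \<cdot> (w \<cdot> u))"
      by (rule Cmp_reassoc[OF e2]) (use all in simp_all)
    then have "r' \<cdot> (x \<cdot> (z \<cdot> (w \<cdot> u))) = a \<cdot> (y \<cdot> (z \<cdot> (w \<cdot> u)))" using all by simp
    moreover have "s \<cdot> (a \<cdot> (y \<cdot> (z \<cdot> (w \<cdot> u)))) = s2 \<cdot> (a2 \<cdot> (y \<cdot> (z \<cdot> (w \<cdot> u))))"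
      by (rule Cmp_reassoc[OF a(12)]) (use all in simp_all)
    moreover have "a2 \<cdot> ((y \<cdot> z) \<cdot> (w \<cdot> u)) = r2' \<cdot> (x2 \<cdot> (w \<cdot> u))"
      by (rule Cmp_reassoc[OF e4]) (use all in simp_all)
    then have "a2 \<cdot> (y \<cdot> (z \<cdot> (w \<cdot> u))) = r2' \<cdot> (x2 \<cdot> (w \<cdot> u))" using all by simp
    ultimately show ?thesis by metis
  qed
  have inS: "s \<cdot> (r' \<cdot> (x \<cdot> (z \<cdot> (w \<cdot> u)))) \<in> S" using all by (intro S_Cmp) auto
  show ?thesis
    by (rule roof_relI[where a = "x \<cdot> (z \<cdot> (w \<cdot> u))" and a' = "x2 \<cdot> (w \<cdot> u)"])
      (use all inS L G in \<open>simp_all add: roofs_iff S_Cmp\<close>)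
qed

lemma Cmp_roof:
  assumes "(s, f) \<in> roofs K J" "(r, g) \<in> roofs K J" "r' \<in> S" "f' \<in> Arr K" "Dom K f' = Dom K r'"
    "Cod K r' = Dom K f" "Cod K f' = Dom K r" "f \<cdot> r' = r \<cdot> f'"
  shows "roof K J r g \<odot> roof K J s f = roof K J (s \<cdot> r') (g \<cdot> f')"
  unfolding verdier_simps(8)
proof (rule the_elem_eqI, goal_cases)
  case 1
  then show ?case using assms roof_self S_Arr by fastforce
next
  case (2 y)
  then obtain s2 f2 r2 g2 r2' f2' where y: "y = roof K J (s2 \<cdot> r2') (g2 \<cdot> f2')"
    and 2: "(s2, f2) \<in> roof K J s f" "(r2, g2) \<in> roof K J r g"
      "r2' \<in> S" "f2' \<in> Arr K" "Dom K f2' = Dom K r2'" "Cod K r2' = Dom K f2" "Cod K f2' = Dom K r2"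
      "f2 \<cdot> r2' = r2 \<cdot> f2'" by auto
  have "((s \<cdot> r', g \<cdot> f'), (s2 \<cdot> r2', g2 \<cdot> f2')) \<in> roof_rel K J"
    by (rule Cmp_roof_cong[of s f s2 f2 r g r2 g2]) (use 2 assms in \<open>simp_all add: mem_roof_iff\<close>)
  then show ?case using roof_eq_iff roof_rel_roofs y by metis
qed

lemma roofs_Ide [simp]: "f \<in> Arr K \<Longrightarrow> X = Dom K f \<Longrightarrow> (Ide K X, f) \<in> roofs K J"
  by (simp add: roofs_iff)

lemma category_V: "category V"
proof
  fix c assume "c \<in> Arr V"
  then show "Dom V c \<in> Obj V" "Cod V c \<in> Obj V"
    by (auto elim!: V_ArrE simp: verdier_simps(1)) (auto simp: roofs_iff)
next
  fix X assume "X \<in> Obj V"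
  then show "Ide V X \<in> Hom V X X" by (simp add: verdier_simps(1,3) Hom_def)
next
  fix c d X Y Z assume "c \<in> Hom V X Y" "d \<in> Hom V Y Z"
  then obtain s f r g where c: "c = roof K J s f" "(s, f) \<in> roofs K J" "Cod K s = X" "Cod K f = Y"
    and d: "d = roof K J r g" "(r, g) \<in> roofs K J" "Cod K r = Y" "Cod K g = Z"
    unfolding Hom_def by (clarsimp elim!: V_ArrE)
  obtain r' f' where sq: "r' \<in> S" "f' \<in> Arr K" "Cod K r' = Dom K f" "Dom K f' = Dom K r'"
    "Cod K f' = Dom K r" "f \<cdot> r' = r \<cdot> f'"
    using Ore[of f r] c d by (auto simp: roofs_iff)
  have "(s \<cdot> r', g \<cdot> f') \<in> roofs K J" using c(2) d(2) sq(1-5) by (auto simp: roofs_iff intro: S_Cmp)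
  then show "d \<odot> c \<in> Hom V X Z"
    using Cmp_roof[OF c(2) d(2) sq(1,2,4,3,5,6)] c d sq(1-5) by (simp add: Hom_def roofs_iff)
next
  fix c d e X Y Z W assume "c \<in> Hom V W X" "d \<in> Hom V X Y" "e \<in> Hom V Y Z"
  then obtain s f r g u h where c: "c = roof K J s f" "(s, f) \<in> roofs K J" "Cod K f = X"
    and d: "d = roof K J r g" "(r, g) \<in> roofs K J" "Cod K r = X" "Cod K g = Y"
    and e: "e = roof K J u h" "(u, h) \<in> roofs K J" "Cod K u = Y"
    unfolding Hom_def by (clarsimp elim!: V_ArrE)
  note cde = c(2)[unfolded roofs_iff] d(2)[unfolded roofs_iff] e(2)[unfolded roofs_iff]
    c(3) d(3,4) e(3)
  obtain u' k where u: "u' \<in> S" "k \<in> Arr K" "Cod K u' = Dom K g" "Dom K k = Dom K u'"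
    "Cod K k = Dom K u" "g \<cdot> u' = u \<cdot> k" using Ore[of g u] cde by auto
  have ru: "r \<cdot> u' \<in> S" using cde u by (intro S_Cmp) auto
  obtain x y where x: "x \<in> S" "y \<in> Arr K" "Cod K x = Dom K f" "Dom K y = Dom K x"
    "Cod K y = Dom K u'" "f \<cdot> x = (r \<cdot> u') \<cdot> y"
    using Ore[of f "r \<cdot> u'"] cde u ru by auto
  have ed: "e \<odot> d = roof K J (r \<cdot> u') (h \<cdot> k)"
    unfolding d e using d e u cde by (intro Cmp_roof) auto
  have 1: "(e \<odot> d) \<odot> c = roof K J (s \<cdot> x) ((h \<cdot> k) \<cdot> y)"
    unfolding ed c(1) using c(2) cde u(1-5) x ru by (intro Cmp_roof) (auto simp: roofs_iff)
  have dc: "d \<odot> c = roof K J (s \<cdot> x) (g \<cdot> (u' \<cdot> y))"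
    unfolding d(1) c(1) using c(2) d(2) cde u(1-5) x ru by (intro Cmp_roof) auto
  have sq: "g \<cdot> (u' \<cdot> y) = u \<cdot> (k \<cdot> y)" 
    by (rule Cmp_reassoc[OF u(6)]) (use cde u(1-5) x(1-5) in simp_all)
  have rf: "(s \<cdot> x, g \<cdot> (u' \<cdot> y)) \<in> roofs K J" using cde u(1-5) x(1-5) by (auto simp: roofs_iff intro!: S_Cmp)
  have "e \<odot> (d \<odot> c) = roof K J ((s \<cdot> x) \<cdot> Ide K (Dom K x)) (h \<cdot> (k \<cdot> y))"
    unfolding dc e(1) by (rule Cmp_roof[OF rf e(2)]) (use cde u(1-5) x(1-5) sq in simp_all)
  then show "(e \<odot> d) \<odot> c = e \<odot> (d \<odot> c)"
    unfolding 1 using cde u(1-5) x(1-5) by simp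
next
  fix c X Y assume "c \<in> Hom V X Y"
  then obtain s f where c: "c = roof K J s f" "(s, f) \<in> roofs K J" "Cod K s = X" "Cod K f = Y"
    unfolding Hom_def by (clarsimp elim!: V_ArrE)
  note sf = c(2)[unfolded roofs_iff] c(3,4)
  have "c \<odot> Ide V X = roof K J (Ide K X \<cdot> s) (f \<cdot> Ide K (Dom K s))"
    unfolding verdier_simps(3) c(1) by (rule Cmp_roof) (use sf in \<open>auto simp: roofs_iff\<close>)
  then show "c \<odot> Ide V X = c" using sf c(1) by simp
  have "Ide V Y \<odot> c = roof K J (s \<cdot> Ide K (Dom K s)) (Ide K Y \<cdot> f)"
    unfolding verdier_simps(3) c(1) by (rule Cmp_roof) (use sf in \<open>auto simp: roofs_iff\<close>)
  then show "Ide V Y \<odot> c = c" using sf c(1) by simp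
qed

sublocale V: category V by (rule category_V)

lemma Q_roof: "Q f = roof K J (Ide K (Dom K f)) f"
  by (simp add: verdier_fctr_def)

lemma Q_simps [simp]:
  assumes "f \<in> Arr K"
  shows "Q f \<in> Arr V" "Dom V (Q f) = Dom K f" "Cod V (Q f) = Cod K f"
  using assms by (simp_all add: Q_roof)

lemma Obj_V [simp]: "Obj V = Obj K" and Sus_V [simp]: "Sus V = Sus K"
  by (simp_all add: verdier_simps)

lemma Q_Ide [simp]: "X \<in> Obj K \<Longrightarrow> Q (Ide K X) = Ide V X"
  by (simp add: Q_roof verdier_simps(3))

lemma Q_Cmp:
  assumes "f \<in> Arr K" "g \<in> Arr K" "Cod K f = Dom K g"
  shows "Q (g \<cdot> f) = Q g \<odot> Q f"
proof -
  have "Q g \<odot> Q f = roof K J (Ide K (Dom K f) \<cdot> Ide K (Dom K f)) (g \<cdot> f)"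
    unfolding Q_roof by (rule Cmp_roof) (use assms in auto)
  then show ?thesis using assms by (simp add: Q_roof)
qed

lemma Q_eq_iff:
  assumes "f \<in> Arr K" "g \<in> Arr K" "Dom K f = Dom K g"
  shows "Q f = Q g \<longleftrightarrow> (\<exists>w \<in> S. Cod K w = Dom K g \<and> f \<cdot> w = g \<cdot> w)" (is "_ = ?R")
proof -
  have "Q f = Q g \<longleftrightarrow> ((Ide K (Dom K f), f), (Ide K (Dom K g), g)) \<in> roof_rel K J"
    unfolding Q_roof using assms by (intro roof_eq_iff) auto
  also have "\<dots> \<longleftrightarrow> ?R"
  proof
    assume "((Ide K (Dom K f), f), (Ide K (Dom K g), g)) \<in> roof_rel K J"
    then obtain a a' where a': "refinement (Ide K (Dom K f)) f (Ide K (Dom K g)) g a a'" by (rule roof_relE)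
    note a = refinementD[OF a']
    have "a \<in> S" "a = a'" "Cod K a = Dom K g" using a(7,8,10-12,14) assms by simp_all
    then show ?R using a(13) by (intro bexI[of _ a]) simp_all
  next
    assume ?R
    then obtain w where w: "w \<in> S" "Cod K w = Dom K g" "f \<cdot> w = g \<cdot> w" by blast
    show "((Ide K (Dom K f), f), (Ide K (Dom K g), g)) \<in> roof_rel K J"
      by (rule roof_relI[where a = w and a' = w]) (use w assms in auto)
  qed
  finally show ?thesis .
qed

lemma Q_eqI:
  assumes "f \<in> Arr K" "g \<in> Arr K" "w \<in> S" "Cod K w = Dom K f" "Cod K w = Dom K g" "f \<cdot> w = g \<cdot> w"
  shows "Q f = Q g"
  using assms Q_eq_iff[of f g] by auto

lemma roof_Q_inv:
  assumes s: "s \<in> S"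
  shows "Q s \<odot> roof K J s (Ide K (Dom K s)) = Ide V (Cod K s)"
    "roof K J s (Ide K (Dom K s)) \<odot> Q s = Ide V (Dom K s)"
proof -
  have rf: "(s, Ide K (Dom K s)) \<in> roofs K J" using s by (simp add: roofs_iff)
  have "Q s \<odot> roof K J s (Ide K (Dom K s)) = roof K J (s \<cdot> Ide K (Dom K s)) (s \<cdot> Ide K (Dom K s))"
    unfolding Q_roof by (rule Cmp_roof) (use s in \<open>auto simp: roofs_iff\<close>)
  also have "\<dots> = roof K J (Ide K (Cod K s) \<cdot> s) (Ide K (Cod K s) \<cdot> s)" using s by simp
  also have "\<dots> = roof K J (Ide K (Cod K s)) (Ide K (Cod K s))" by (rule roof_refine) (use s in auto)
  finally show "Q s \<odot> roof K J s (Ide K (Dom K s)) = Ide V (Cod K s)" by (simp add: verdier_simps(3))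
  have "roof K J s (Ide K (Dom K s)) \<odot> Q s =
      roof K J (Ide K (Dom K s) \<cdot> Ide K (Dom K s)) (Ide K (Dom K s) \<cdot> Ide K (Dom K s))"
    unfolding Q_roof by (rule Cmp_roof) (use s rf in auto)
  then show "roof K J s (Ide K (Dom K s)) \<odot> Q s = Ide V (Dom K s)"
    using s by (simp add: verdier_simps(3))
qed

lemma roof_fraction:
  assumes "(s, f) \<in> roofs K J"
  shows "roof K J s f \<odot> Q s = Q f"
proof -
  have "roof K J s f \<odot> Q s = roof K J (Ide K (Dom K s) \<cdot> Ide K (Dom K s)) (f \<cdot> Ide K (Dom K s))"
    unfolding Q_roof by (rule Cmp_roof) (use assms in \<open>auto simp: roofs_iff\<close>)
  then show ?thesis using assms by (simp add: roofs_iff Q_roof)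
qed

lemma Q_iso: "s \<in> S \<Longrightarrow> is_iso V (Q s)"
  by (rule V.is_isoI[where g = "roof K J s (Ide K (Dom K s))"])
    (use roof_Q_inv in \<open>auto simp: roofs_iff\<close>)

lemma Add_roof:
  assumes "(s, f) \<in> roofs K J" "(s, g) \<in> roofs K J" "Cod K f = Cod K g"
  shows "Add V (roof K J s f) (roof K J s g) = roof K J s (Add K f g)"
  unfolding verdier_simps(9)
proof (rule the_elem_eqI, goal_cases)
  case 1
  then show ?case using assms roof_self by fastforce
next
  case (2 y)
  then obtain s' f' g' where y: "y = roof K J s' (Add K f' g')" and
    rel: "((s, f), (s', f')) \<in> roof_rel K J" "((s, g), (s', g')) \<in> roof_rel K J"
    by (auto simp: mem_roof_iff)
  obtain a a' where a': "refinement s f s' f' a a'" using rel(1) by (rule roof_relE)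
  note a = refinementD[OF a']
  obtain b b' where b': "refinement s g s' g' b b'" using rel(2) by (rule roof_relE)
  note b = refinementD[OF b']
  have fg': "Cod K f' = Cod K g'" using roof_rel_ends(2)[OF rel(1)] roof_rel_ends(2)[OF rel(2)] assms(3) by simp
  note ab = a(1-11) b(1-11)
  obtain x y where x: "x \<in> S" "Cod K x = Dom K a" "y \<in> Arr K" "Dom K y = Dom K x" "Cod K y = Dom K b"
    "a \<cdot> x = b \<cdot> y" by (rule refine[of s b a]) (use a b in auto)
  have "s \<cdot> (a \<cdot> x) = s' \<cdot> (a' \<cdot> x)" "s \<cdot> (b \<cdot> y) = s' \<cdot> (b' \<cdot> y)"
    by (rule Cmp_reassoc[OF a(12)] Cmp_reassoc[OF b(12)]; use ab x(1-5) in simp)+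
  then have "s' \<cdot> (a' \<cdot> x) = s' \<cdot> (b' \<cdot> y)" by (simp only: x(6))
  then obtain w where w: "w \<in> S" "Cod K w = Dom K x" "(a' \<cdot> x) \<cdot> w = (b' \<cdot> y) \<cdot> w"
    using cancel[of s' "a' \<cdot> x" "b' \<cdot> y"] ab x(1-5) by auto
  note all = ab x(1-5) w(1,2)
  have e: "a \<cdot> (x \<cdot> w) = b \<cdot> (y \<cdot> w)" by (rule Cmp_reassoc[OF x(6)]) (use all in simp_all)
  have e': "a' \<cdot> (x \<cdot> w) = b' \<cdot> (y \<cdot> w)" using w(3) all by simp
  have S: "s \<cdot> (a \<cdot> (x \<cdot> w)) = s' \<cdot> (a' \<cdot> (x \<cdot> w))" and F: "f \<cdot> (a \<cdot> (x \<cdot> w)) = f' \<cdot> (a' \<cdot> (x \<cdot> w))"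
    by (rule Cmp_reassoc[OF a(12)] Cmp_reassoc[OF a(13)]; use all in simp)+
  have G: "g \<cdot> (a \<cdot> (x \<cdot> w)) = g' \<cdot> (a' \<cdot> (x \<cdot> w))"
    unfolding e e' by (rule Cmp_reassoc[OF b(13)]) (use all in simp_all)
  have inS: "s \<cdot> (a \<cdot> (x \<cdot> w)) \<in> S"
    using S_Cmp[OF S_Cmp[OF w(1) x(1)] a(14)] all by simp
  have "((s, Add K f g), (s', Add K f' g')) \<in> roof_rel K J"
    by (rule roof_relI[where a = "a \<cdot> (x \<cdot> w)" and a' = "a' \<cdot> (x \<cdot> w)"])
      (use all fg' assms(3) S F G inS in \<open>simp_all add: roofs_iff\<close>)
  then show ?case using roof_eq_iff roof_rel_roofs y by metis
qed

lemma common_denominator: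
  assumes "c \<in> Hom V X Y" "d \<in> Hom V X Y"
  obtains s f g where "(s, f) \<in> roofs K J" "(s, g) \<in> roofs K J" "c = roof K J s f" "d = roof K J s g"
    "Cod K s = X" "Cod K f = Y" "Cod K g = Y"
proof -
  obtain s f r g where c: "c = roof K J s f" "(s, f) \<in> roofs K J" "Cod K s = X" "Cod K f = Y"
    and d: "d = roof K J r g" "(r, g) \<in> roofs K J" "Cod K r = X" "Cod K g = Y"
    using assms by (clarsimp elim!: V_ArrE)
  note cd = c(2)[unfolded roofs_iff] d(2)[unfolded roofs_iff] c(3,4) d(3,4)
  obtain x y where x: "x \<in> S" "y \<in> Arr K" "Cod K x = Dom K s" "Dom K y = Dom K x"
    "Cod K y = Dom K r" "s \<cdot> x = r \<cdot> y" using Ore[of s r] cd by auto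
  have sx: "s \<cdot> x \<in> S" using cd x by (intro S_Cmp) auto
  have "roof K J (s \<cdot> x) (f \<cdot> x) = c" unfolding c(1) using c(2) x sx cd by (intro roof_refine) auto
  moreover have "roof K J (r \<cdot> y) (g \<cdot> y) = d" unfolding d(1) using d(2) x(1-5) sx cd
    by (intro roof_refine) (auto simp flip: x(6))
  ultimately show ?thesis
    using sx cd x by (intro that[of "s \<cdot> x" "f \<cdot> x" "g \<cdot> y"]) (simp_all add: roofs_iff)
qed

lemma SusA_roof:
  assumes "(s, f) \<in> roofs K J"
  shows "SusA V (roof K J s f) = roof K J (SusA K s) (SusA K f)"
  unfolding verdier_simps(10)
proof (rule the_elem_eqI, goal_cases)
  case 1
  then show ?case using assms roof_self by fastforce
next
  case (2 y)
  then obtain s' f' where y: "y = roof K J (SusA K s') (SusA K f')" and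
    rel: "((s, f), (s', f')) \<in> roof_rel K J" by (auto simp: mem_roof_iff)
  obtain a a' where a': "refinement s f s' f' a a'" using rel by (rule roof_relE)
  note a = refinementD[OF a']
  have "SusA K (s \<cdot> a) = SusA K (s' \<cdot> a')" "SusA K (f \<cdot> a) = SusA K (f' \<cdot> a')" "SusA K (s \<cdot> a) \<in> S"
    by (simp_all only: a(12,13) SusA_S[OF a(15)])
  then have e: "SusA K s \<cdot> SusA K a = SusA K s' \<cdot> SusA K a'" "SusA K f \<cdot> SusA K a = SusA K f' \<cdot> SusA K a'"
    "SusA K s \<cdot> SusA K a \<in> S" using a(1-11) by simp_all
  have "((SusA K s, SusA K f), (SusA K s', SusA K f')) \<in> roof_rel K J"
    by (rule roof_relI[where a = "SusA K a" and a' = "SusA K a'"])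
      (use a(1-11) e in \<open>simp_all add: roofs_iff\<close>)
  then show ?case using roof_eq_iff roof_rel_roofs y by metis
qed

lemma SusA_V_simps [simp]:
  assumes "c \<in> Arr V"
  shows "SusA V c \<in> Arr V" "Dom V (SusA V c) = Sus K (Dom V c)" "Cod V (SusA V c) = Sus K (Cod V c)"
  using assms by (auto elim!: V_ArrE simp: SusA_roof roofs_iff)

lemma SusA_Q: "f \<in> Arr K \<Longrightarrow> SusA V (Q f) = Q (SusA K f)"
  by (simp add: Q_roof SusA_roof)

lemma SusA_V_Ide: "X \<in> Obj K \<Longrightarrow> SusA V (Ide V X) = Ide V (Sus K X)"
  using SusA_Q[of "Ide K X"] by simp

lemma SusA_V_Cmp:
  assumes "c \<in> Arr V" "d \<in> Arr V" "Cod V c = Dom V d"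
  shows "SusA V (d \<odot> c) = SusA V d \<odot> SusA V c"
proof -
  obtain s f r g where c: "c = roof K J s f" "(s, f) \<in> roofs K J"
    and d: "d = roof K J r g" "(r, g) \<in> roofs K J" and fr: "Cod K f = Cod K r"
    using assms by (auto elim!: V_ArrE)
  obtain r' f' where sq: "r' \<in> S" "f' \<in> Arr K" "Cod K r' = Dom K f" "Dom K f' = Dom K r'"
    "Cod K f' = Dom K r" "f \<cdot> r' = r \<cdot> f'" using Ore[of f r] c d fr by (auto simp: roofs_iff)
  note cd = c(2)[unfolded roofs_iff] d(2)[unfolded roofs_iff] fr sq(1-5)
  have "SusA K (f \<cdot> r') = SusA K (r \<cdot> f')" by (simp only: sq)
  then have sq': "SusA K f \<cdot> SusA K r' = SusA K r \<cdot> SusA K f'" using cd by simp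
  have dc: "d \<odot> c = roof K J (s \<cdot> r') (g \<cdot> f')"
    unfolding c(1) d(1) by (rule Cmp_roof[OF c(2) d(2) sq(1,2,4,3,5,6)])
  have "SusA V d \<odot> SusA V c = roof K J (SusA K s \<cdot> SusA K r') (SusA K g \<cdot> SusA K f')"
    unfolding c(1) d(1) SusA_roof[OF c(2)] SusA_roof[OF d(2)]
    by (rule Cmp_roof) (use cd sq' in \<open>simp_all add: roofs_iff\<close>)
  moreover have "SusA V (d \<odot> c) = roof K J (SusA K (s \<cdot> r')) (SusA K (g \<cdot> f'))"
    unfolding dc using cd by (intro SusA_roof) (simp add: roofs_iff S_Cmp)
  ultimately show ?thesis using cd by simp
qed

lemma SusA_V_iso:
  assumes "is_iso V c"
  shows "is_iso V (SusA V c)"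
proof -
  obtain d where d: "c \<in> Arr V" "d \<in> Arr V" "Dom V d = Cod V c" "Cod V d = Dom V c"
    "d \<odot> c = Ide V (Dom V c)" "c \<odot> d = Ide V (Cod V c)" using assms by (rule V.is_isoE)
  have O: "Dom V c \<in> Obj K" "Cod V c \<in> Obj K" using V.Dom_Obj[OF d(1)] V.Cod_Obj[OF d(1)] by auto
  have "SusA V (d \<odot> c) = Ide V (Sus K (Dom V c))" "SusA V (c \<odot> d) = Ide V (Sus K (Cod V c))"
    using d(5,6) SusA_V_Ide O by simp_all
  then show ?thesis using d(1-4) by (intro V.is_isoI[where g = "SusA V d"]) (simp_all add: SusA_V_Cmp)
qed

section \<open>Objects and arrows that become trivial\<close>

lemma Q_null:
  assumes "f \<in> Arr K" "Dom K f \<in> J \<or> Cod K f \<in> J"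
  shows "Q f = Q (Zer K (Dom K f) (Cod K f))"
  using assms(2)
proof
  assume "Cod K f \<in> J"
  with kill[OF assms(1)] obtain w where "w \<in> S" "Cod K w = Dom K f" "f \<cdot> w = Zer K (Dom K w) (Cod K f)" .
  then show ?thesis using assms(1) by (intro Q_eqI[of _ _ w]) auto
next
  assume "Dom K f \<in> J"
  with kill[of "Ide K (Dom K f)"] assms(1) obtain w where
    "w \<in> S" "Cod K w = Dom K f" "w = Zer K (Dom K w) (Dom K f)" by auto
  then show ?thesis using assms(1) by (intro Q_eqI[of _ _ w]) (simp, simp, simp, simp, simp, metis Cmp_Zer Dom_Obj S_Arr Zer_Cmp Cod_Obj)
qed

text \<open>If \<open>w \<in> S\<close> kills the identity of \<open>X\<close>, then this identity factors through the cone of \<open>w\<close>, so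
  that \<open>X\<close> is a direct summand of an object of \<open>J\<close>.\<close>

lemma null_object_in_J:
  assumes X: "X \<in> Obj K" and eq: "Q (Ide K X) = Q (Zer K X X)"
  shows "X \<in> J"
proof -
  obtain w where w: "w \<in> S" "Cod K w = X" "Ide K X \<cdot> w = Zer K X X \<cdot> w"
    using eq Q_eq_iff[of "Ide K X" "Zer K X X"] X by auto
  obtain k h where T: "(w, k, h) \<in> Tri K" "Cod K k \<in> J" using S_E[OF w(1)] .
  note t = TriD[OF T(1)]
  obtain b where b: "b \<in> Arr K" "Dom K b = Cod K k" "Cod K b = X" "b \<cdot> k = Ide K X"
    using weak_cokernel[OF T(1), of "Ide K X"] t w X by auto
  obtain C \<sigma> l where "is_biproduct K X C (Cod K k) k \<sigma> b l"
    using split_mono_biproduct[of k b] b t(2,4) w(2) by metis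
  then show ?thesis using J_biproduct T(2) by blast
qed

lemma retract_in_J:
  assumes "s \<in> Arr K" "r \<in> Arr K" "Cod K s = Dom K r" "Cod K r = Dom K s" "Dom K r \<in> J"
    and eq: "Q (r \<cdot> s) = Q (Ide K (Dom K s))"
  shows "Dom K s \<in> J"
proof (rule null_object_in_J)
  have "Q (Ide K (Dom K s)) = Q r \<odot> Q s" using Q_Cmp assms by metis
  also have "\<dots> = Q r \<odot> Q (Zer K (Dom K s) (Cod K s))" using Q_null[of s] assms by simp
  also have "\<dots> = Q (Zer K (Dom K s) (Dom K s))"
    using assms(1-5) by (subst Q_Cmp[symmetric]) auto
  finally show "Q (Ide K (Dom K s)) = Q (Zer K (Dom K s) (Dom K s))" .
qed (use assms in auto)

text \<open>Once \<open>s\<close> is invertible, both other maps \<open>k\<close> and \<open>h\<close> of a triangle on \<open>s\<close> vanish in the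
  quotient. The identity of the cone then vanishes too: after precomposition with some \<open>c \<in> S\<close>
  killed by \<open>h\<close> it factors through \<open>k\<close>.\<close>

lemma saturated:
  assumes s: "s \<in> Arr K" and iso: "is_iso V (Q s)"
  shows "s \<in> S"
proof -
  obtain k h where T: "(s, k, h) \<in> Tri K" using cone_ex[OF s] by blast
  note t = TriD[OF T]
  have C: "Cod K k \<in> Obj K" using t by simp
  have "Q k \<odot> Q s = Q (Zer K (Cod K s) (Cod K k)) \<odot> Q s"
    using t Tri_comp[OF T] by (simp flip: Q_Cmp)
  from V.iso_cancel_right[OF iso _ _ _ _ this]
  have k: "Q k = Q (Zer K (Cod K s) (Cod K k))" using t by simp
  have iso': "is_iso V (Q (SusA K s))" using SusA_V_iso[OF iso] s by (simp add: SusA_Q)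
  have "Q (SusA K s) \<odot> Q h = Q (SusA K s) \<odot> Q (Zer K (Cod K k) (Sus K (Dom K s)))"
    using t Tri_comp3[OF T] by (simp flip: Q_Cmp)
  from V.iso_cancel_left[OF iso' _ _ _ _ this]
  have "Q h = Q (Zer K (Cod K k) (Sus K (Dom K s)))" using t by simp
  then obtain c where c: "c \<in> S" "Cod K c = Cod K k" "h \<cdot> c = Zer K (Dom K c) (Sus K (Dom K s))"
    using Q_eq_iff[of h "Zer K (Cod K k) (Sus K (Dom K s))"] t by auto
  obtain d where d: "d \<in> Arr K" "Dom K d = Dom K c" "Cod K d = Cod K s" "k \<cdot> d = c"
    using weak_kernel2[OF T, of c] c t by auto
  have "Ide V (Cod K k) \<odot> Q c = Q k \<odot> Q d"
    using c d t Q_Cmp[of d k] by simp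
  also have "\<dots> = Q (Zer K (Dom K c) (Cod K k))"
    unfolding k using d t by (subst Q_Cmp[symmetric]) auto
  also have "\<dots> = Q (Zer K (Cod K k) (Cod K k)) \<odot> Q c"
    using c t by (subst Q_Cmp[symmetric]) auto
  finally have eq: "Ide V (Cod K k) \<odot> Q c = Q (Zer K (Cod K k) (Cod K k)) \<odot> Q c" .
  have "Ide V (Cod K k) = Q (Zer K (Cod K k) (Cod K k))"
    by (rule V.iso_cancel_right[OF Q_iso[OF c(1)] _ _ _ _ eq]) (use C c in auto)
  then have "Cod K k \<in> J" using C by (intro null_object_in_J) auto
  then show ?thesis by (rule S_I[OF T])
qed

end

section \<open>Thick subcategories generated by a set of objects\<close>

lemma thickD:
  assumes "thick K T"
  shows "is_iso K f \<Longrightarrow> Dom K f \<in> T \<Longrightarrow> Cod K f \<in> T"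
    "is_biproduct K X Y B i j p q \<Longrightarrow> B \<in> T \<Longrightarrow> X \<in> T"
    "is_biproduct K X Y B i j p q \<Longrightarrow> B \<in> T \<Longrightarrow> Y \<in> T"
  using assms unfolding thick_def by blast+

lemma (in triangulated_category) zero_in_thick:
  assumes "thick K T" "is_zero K Z"
  shows "Z \<in> T"
proof -
  obtain Z' where Z': "Z' \<in> T" "is_zero K Z'" using assms(1) unfolding thick_def by blast
  have "is_iso K (Zer K Z' Z)" by (rule zero_iso[OF Z'(2) assms(2)])
  moreover have "Dom K (Zer K Z' Z) = Z'" "Cod K (Zer K Z' Z) = Z" using Z' assms(2) by auto
  ultimately show ?thesis using assms(1) Z'(1) unfolding thick_def by metis
qed

lemma (in triangulated_category) thick_thick_closure: "thick K (thick_closure K A)"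
proof -
  let ?F = "{T. thick K T \<and> A \<subseteq> T}"
  have mem: "X \<in> thick_closure K A \<longleftrightarrow> X \<in> Obj K \<and> (\<forall>T \<in> ?F. X \<in> T)" for X
    unfolding thick_closure_def by auto
  obtain Z where Z: "is_zero K Z" using zero_ex by blast
  show ?thesis
    unfolding thick_def
  proof (intro conjI allI impI ballI)
    show "thick_closure K A \<subseteq> Obj K" unfolding thick_closure_def by auto
    show "\<exists>Z\<in>thick_closure K A. is_zero K Z"
      using Z zero_in_thick by (intro bexI[of _ Z]) (auto simp: mem)
  next
    fix f assume f: "is_iso K f" "Dom K f \<in> thick_closure K A"
    then have "Cod K f \<in> Obj K" unfolding is_iso_def by simp
    moreover have "Cod K f \<in> T" if "T \<in> ?F" for T
    proof (rule thickD(1)[OF _ f(1)])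
      show "thick K T" "Dom K f \<in> T" using that f(2) unfolding mem by blast+
    qed
    ultimately show "Cod K f \<in> thick_closure K A" unfolding mem by blast
  next
    fix X assume "X \<in> Obj K"
    moreover have "Sus K X \<in> T \<longleftrightarrow> X \<in> T" if "T \<in> ?F" for T
      using that \<open>X \<in> Obj K\<close> unfolding thick_def by blast
    ultimately show "Sus K X \<in> thick_closure K A \<longleftrightarrow> X \<in> thick_closure K A" unfolding mem by auto
  next
    fix f g h assume T: "(f, g, h) \<in> Tri K"
    have O: "Dom K f \<in> Obj K" "Dom K g \<in> Obj K" "Dom K h \<in> Obj K" using TriD[OF T] by auto
    have *: "(Dom K f \<in> T \<and> Dom K g \<in> T \<longrightarrow> Dom K h \<in> T) \<and> (Dom K g \<in> T \<and> Dom K h \<in> T \<longrightarrow> Dom K f \<in> T)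
      \<and> (Dom K f \<in> T \<and> Dom K h \<in> T \<longrightarrow> Dom K g \<in> T)" if "T \<in> ?F" for T
      using that T unfolding thick_def by blast
    show "Dom K h \<in> thick_closure K A" if "Dom K f \<in> thick_closure K A \<and> Dom K g \<in> thick_closure K A"
      using that * O unfolding mem by blast
    show "Dom K f \<in> thick_closure K A" if "Dom K g \<in> thick_closure K A \<and> Dom K h \<in> thick_closure K A"
      using that * O unfolding mem by blast
    show "Dom K g \<in> thick_closure K A" if "Dom K f \<in> thick_closure K A \<and> Dom K h \<in> thick_closure K A"
      using that * O unfolding mem by blast
  next
    fix X Y B i j p q assume B: "is_biproduct K X Y B i j p q" "B \<in> thick_closure K A"
    have *: "X \<in> T \<and> Y \<in> T" if "T \<in> ?F" for T
    proof -
      have "thick K T" "B \<in> T" using that B(2) unfolding mem by blast+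
      then show ?thesis using thickD(2,3)[OF _ B(1)] by blast
    qed
    show "X \<in> thick_closure K A" "Y \<in> thick_closure K A"
      using * is_biproductD(1,2)[OF B(1)] unfolding mem by blast+
  qed
qed

lemma thick_closure_superset: "A \<subseteq> Obj K \<Longrightarrow> A \<subseteq> thick_closure K A"
  unfolding thick_closure_def by auto

section \<open>The ideal of arrows through projective objects\<close>

locale frobenius_stable = triangulated_category K + frobenius_class K E
  for K :: "('o, 'm, 'z) tricat_scheme" (structure) and E :: "'m triangle set" +
  fixes R :: "'o \<Rightarrow> 'm triangle"
  assumes R: "injective_choice K E R"
begin

abbreviation P :: "'o set" where "P \<equiv> E_proj K E"
abbreviation M :: "'o set" where "M \<equiv> thick_closure K P"

lemma P_Obj [simp]: "A \<in> P \<Longrightarrow> A \<in> Obj K"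
  unfolding E_proj_def by auto

sublocale thick_subcategory K M
  by unfold_locales (rule thick_thick_closure)

lemma P_M: "A \<in> P \<Longrightarrow> A \<in> M"
  using thick_closure_superset[of P K] P_Obj by blast

text \<open>Exactness in the middle holds for every triangle, so that only the two ends matter.\<close>

lemma P_iff:
  "A \<in> P \<longleftrightarrow> A \<in> Obj K \<and> (\<forall>f g h. (f, g, h) \<in> E \<longrightarrow>
     inj_on (\<lambda>a. f \<cdot> a) (Hom K A (Dom K f)) \<and>
     (\<forall>c \<in> Hom K A (Dom K h). \<exists>b \<in> Hom K A (Dom K g). g \<cdot> b = c))"
proof -
  have mid: "(\<lambda>a. f \<cdot> a) ` Hom K A (Dom K f) = {b \<in> Hom K A (Dom K g). g \<cdot> b = Zer K A (Dom K h)}"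
    if "(f, g, h) \<in> E" and A: "A \<in> Obj K" for f g h
  proof (rule equalityI; rule subsetI)
    have T: "(f, g, h) \<in> Tri K" using that E_Tri by auto
    note t = TriD[OF T]
    {
      fix b assume "b \<in> (\<lambda>a. f \<cdot> a) ` Hom K A (Dom K f)"
      then obtain a where a: "a \<in> Arr K" "Dom K a = A" "Cod K a = Dom K f" "b = f \<cdot> a" by auto
      have "g \<cdot> (f \<cdot> a) = Zer K (Dom K f) (Cod K g) \<cdot> a"
        by (rule Cmp_reassoc1[OF Tri_comp[OF T]]) (use a t in simp_all)
      then show "b \<in> {b \<in> Hom K A (Dom K g). g \<cdot> b = Zer K A (Dom K h)}"
        using a t by simp
    next
      fix b assume "b \<in> {b \<in> Hom K A (Dom K g). g \<cdot> b = Zer K A (Dom K h)}"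
      then have "b \<in> Arr K" "Cod K b = Cod K f" "g \<cdot> b = Zer K (Dom K b) (Cod K g)" "Dom K b = A"
        using t by auto
      from weak_kernel[OF T this(1-3)] this(4)
      show "b \<in> (\<lambda>a. f \<cdot> a) ` Hom K A (Dom K f)" by (metis Hom_iff image_eqI)
    }
  qed
  have epi: "(\<lambda>b. g \<cdot> b) ` Hom K A (Dom K g) = Hom K A (Dom K h) \<longleftrightarrow>
     (\<forall>c \<in> Hom K A (Dom K h). \<exists>b \<in> Hom K A (Dom K g). g \<cdot> b = c)"
    if "(f, g, h) \<in> E" for f g h
  proof -
    have "(f, g, h) \<in> Tri K" using that E_Tri by auto
    note t = TriD[OF this]
    have "(\<lambda>b. g \<cdot> b) ` Hom K A (Dom K g) \<subseteq> Hom K A (Dom K h)" using t by auto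
    show ?thesis
    proof
      assume eq: "(\<lambda>b. g \<cdot> b) ` Hom K A (Dom K g) = Hom K A (Dom K h)"
      show "\<forall>c \<in> Hom K A (Dom K h). \<exists>b \<in> Hom K A (Dom K g). g \<cdot> b = c"
        unfolding eq[symmetric] by auto
    next
      assume r: "\<forall>c \<in> Hom K A (Dom K h). \<exists>b \<in> Hom K A (Dom K g). g \<cdot> b = c"
      show "(\<lambda>b. g \<cdot> b) ` Hom K A (Dom K g) = Hom K A (Dom K h)"
      proof (rule equalityI[OF \<open>_ \<subseteq> _\<close>], rule subsetI)
        fix c assume "c \<in> Hom K A (Dom K h)"
        with r obtain b where "b \<in> Hom K A (Dom K g)" "g \<cdot> b = c" by (elim ballE bexE) auto
        then show "c \<in> (\<lambda>b. g \<cdot> b) ` Hom K A (Dom K g)" by (intro image_eqI[of c _ b]) simp_all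
      qed
    qed
  qed
  show ?thesis
    unfolding E_proj_def mem_Collect_eq
    by (intro conj_cong all_cong1 imp_cong refl) (simp_all add: mid epi)
qed

lemma P_zero:
  assumes "is_zero K Z"
  shows "Z \<in> P"
proof -
  have *: "a = Zer K Z (Cod K a)" if "a \<in> Arr K" "Dom K a = Z" for a
    using eq_Zer_if_Ide_Zer(1) assms that unfolding is_zero_iff by blast
  show ?thesis
    unfolding P_iff
  proof (intro conjI allI impI ballI)
    fix f g h assume "(f, g, h) \<in> E"
    then have T: "(f, g, h) \<in> Tri K" using E_Tri by auto
    note t = TriD[OF T]
    show "inj_on (\<lambda>a. f \<cdot> a) (Hom K Z (Dom K f))"
      by (rule inj_onI) (metis * Hom_iff)
    fix c assume "c \<in> Hom K Z (Dom K h)"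
    then have "c = Zer K Z (Cod K g)" using *[of c] t by simp
    then show "\<exists>b \<in> Hom K Z (Dom K g). g \<cdot> b = c"
      using t assms by (intro bexI[of _ "Zer K Z (Dom K g)"]) simp_all
  qed (use assms in simp)
qed

lemma P_biproduct:
  assumes B: "is_biproduct K X Y B i j p q" and X: "X \<in> P" and Y: "Y \<in> P"
  shows "B \<in> P"
proof -
  note b = is_biproductD[OF B]
  have decomp: "a = Add K ((a \<cdot> i) \<cdot> p) ((a \<cdot> j) \<cdot> q)" if "a \<in> Arr K" "Dom K a = B" for a
  proof -
    have "a = a \<cdot> Add K (i \<cdot> p) (j \<cdot> q)" using that b(20) by simp
    also have "\<dots> = Add K (a \<cdot> (i \<cdot> p)) (a \<cdot> (j \<cdot> q))"
      using that b(1-15) by (intro Cmp_Add') simp_all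
    finally show ?thesis using that b(1-15) by simp
  qed
  show ?thesis
    unfolding P_iff
  proof (intro conjI allI impI ballI)
    fix f g h assume E: "(f, g, h) \<in> E"
    then have T: "(f, g, h) \<in> Tri K" using E_Tri by auto
    note t = TriD[OF T]
    show "inj_on (\<lambda>a. f \<cdot> a) (Hom K B (Dom K f))"
    proof (rule inj_onI)
      fix a a' assume a: "a \<in> Hom K B (Dom K f)" "a' \<in> Hom K B (Dom K f)" "f \<cdot> a = f \<cdot> a'"
      have iX: "inj_on (\<lambda>a. f \<cdot> a) (Hom K X (Dom K f))" and iY: "inj_on (\<lambda>a. f \<cdot> a) (Hom K Y (Dom K f))"
        using X Y E unfolding P_iff by blast+
      have eq: "f \<cdot> (a \<cdot> i) = f \<cdot> (a' \<cdot> i)" "f \<cdot> (a \<cdot> j) = f \<cdot> (a' \<cdot> j)"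
        by (rule Cmp_reassoc[OF a(3)]; use a(1,2) b(1-15) t in simp)+
      have "a \<cdot> i = a' \<cdot> i" "a \<cdot> j = a' \<cdot> j"
        by (rule inj_onD[OF iX eq(1)] inj_onD[OF iY eq(2)]; use a(1,2) b(1-15) in simp)+
      then show "a = a'" using decomp[of a] decomp[of a'] a(1,2) by simp
    qed
    fix c assume c: "c \<in> Hom K B (Dom K h)"
    have "c \<cdot> i \<in> Hom K X (Dom K h)" "c \<cdot> j \<in> Hom K Y (Dom K h)" using c b(1-15) by auto
    then obtain u v where u: "u \<in> Hom K X (Dom K g)" "g \<cdot> u = c \<cdot> i"
      and v: "v \<in> Hom K Y (Dom K g)" "g \<cdot> v = c \<cdot> j" using X Y E unfolding P_iff by meson
    have 1: "g \<cdot> Add K (u \<cdot> p) (v \<cdot> q) = Add K (g \<cdot> (u \<cdot> p)) (g \<cdot> (v \<cdot> q))"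
      using u(1) v(1) b(1-15) t by (intro Cmp_Add') auto
    have 2: "g \<cdot> (u \<cdot> p) = (c \<cdot> i) \<cdot> p" "g \<cdot> (v \<cdot> q) = (c \<cdot> j) \<cdot> q"
      by (rule Cmp_reassoc1[OF u(2)] Cmp_reassoc1[OF v(2)]; use u(1) v(1) b(1-15) t in simp)+
    have "g \<cdot> Add K (u \<cdot> p) (v \<cdot> q) = c"
      unfolding 1 2 using decomp[of c] c by simp
    then show "\<exists>b \<in> Hom K B (Dom K g). g \<cdot> b = c"
      using u(1) v(1) b(1-15) by (intro bexI[of _ "Add K (u \<cdot> p) (v \<cdot> q)"]) auto
  qed (use b in simp)
qed

abbreviation I :: "'o \<Rightarrow> 'o \<Rightarrow> 'm set" where "I \<equiv> factor_through K P"
abbreviation cl :: "'m \<Rightarrow> 'm set" where "cl \<equiv> stab_class K P"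

lemma I_I: "a \<in> Arr K \<Longrightarrow> b \<in> Arr K \<Longrightarrow> Cod K a = Dom K b \<Longrightarrow> Dom K b \<in> P \<Longrightarrow>
   Dom K a = X \<Longrightarrow> Cod K b = Y \<Longrightarrow> b \<cdot> a \<in> I X Y"
  unfolding factor_through_def
  by (rule CollectI, rule exI[of _ a], rule exI[of _ b], rule exI[of _ "Dom K b"]) simp

lemma I_E:
  assumes "u \<in> I X Y"
  obtains a b where "a \<in> Arr K" "b \<in> Arr K" "Dom K b = Cod K a" "Cod K a \<in> P"
   "Dom K a = X" "Cod K b = Y" "u = b \<cdot> a"
  using assms unfolding factor_through_def by auto

lemma I_simps: "u \<in> I X Y \<Longrightarrow> u \<in> Arr K \<and> Dom K u = X \<and> Cod K u = Y"
  by (elim I_E) auto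

lemma I_Zer: "X \<in> Obj K \<Longrightarrow> Y \<in> Obj K \<Longrightarrow> Zer K X Y \<in> I X Y"
proof -
  assume XY: "X \<in> Obj K" "Y \<in> Obj K"
  obtain Z where Z: "is_zero K Z" using zero_ex by blast
  have "Zer K Z Y \<cdot> Zer K X Z \<in> I X Y" using XY Z P_zero by (intro I_I) auto
  then show ?thesis using XY Z by simp
qed

lemma I_Neg: "u \<in> I X Y \<Longrightarrow> Neg K u \<in> I X Y"
proof (elim I_E)
  fix a b assume "a \<in> Arr K" "b \<in> Arr K" "Dom K b = Cod K a" "Cod K a \<in> P"
   "Dom K a = X" "Cod K b = Y" "u = b \<cdot> a"
  then show ?thesis using I_I[of a "Neg K b" X Y] by simp
qed

lemma I_Cmp_left: "u \<in> I X Y \<Longrightarrow> f \<in> Arr K \<Longrightarrow> Dom K f = Y \<Longrightarrow> Z = Cod K f \<Longrightarrow> f \<cdot> u \<in> I X Z"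
proof (elim I_E)
  fix a b assume "f \<in> Arr K" "Dom K f = Y" "Z = Cod K f" "a \<in> Arr K" "b \<in> Arr K" "Dom K b = Cod K a" "Cod K a \<in> P"
   "Dom K a = X" "Cod K b = Y" "u = b \<cdot> a"
  then show ?thesis using I_I[of a "f \<cdot> b" X Z] by simp
qed

lemma I_Cmp_right: "u \<in> I X Y \<Longrightarrow> f \<in> Arr K \<Longrightarrow> Cod K f = X \<Longrightarrow> W = Dom K f \<Longrightarrow> u \<cdot> f \<in> I W Y"
proof (elim I_E)
  fix a b assume "f \<in> Arr K" "Cod K f = X" "W = Dom K f" "a \<in> Arr K" "b \<in> Arr K" "Dom K b = Cod K a" "Cod K a \<in> P"
   "Dom K a = X" "Cod K b = Y" "u = b \<cdot> a"
  then show ?thesis using I_I[of "a \<cdot> f" b W Y] by simp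
qed

text \<open>The sum of two arrows through \<open>A\<close> and \<open>A'\<close> is an arrow through \<open>A \<oplus> A'\<close>.\<close>

lemma I_Add:
  assumes "u \<in> I X Y" "v \<in> I X Y"
  shows "Add K u v \<in> I X Y"
proof -
  obtain a b where a: "a \<in> Arr K" "b \<in> Arr K" "Dom K b = Cod K a" "Cod K a \<in> P"
   "Dom K a = X" "Cod K b = Y" "u = b \<cdot> a" using assms(1) by (rule I_E)
  obtain a' b' where a': "a' \<in> Arr K" "b' \<in> Arr K" "Dom K b' = Cod K a'" "Cod K a' \<in> P"
   "Dom K a' = X" "Cod K b' = Y" "v = b' \<cdot> a'" using assms(2) by (rule I_E)
  obtain B i j p q where B: "is_biproduct K (Cod K a) (Cod K a') B i j p q"
    using biproduct_ex[of "Cod K a" "Cod K a'"] a a' by auto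
  note b = is_biproductD[OF B]
  have BP: "B \<in> P" by (rule P_biproduct[OF B a(4) a'(4)])
  have X: "X \<in> Obj K" using a(1,5) by auto
  note all = a(1-6) a'(1-6) b(1-15) X
  have 1: "p \<cdot> (i \<cdot> a) = Ide K (Cod K a) \<cdot> a" "p \<cdot> (j \<cdot> a') = Zer K (Cod K a') (Cod K a) \<cdot> a'"
    "q \<cdot> (i \<cdot> a) = Zer K (Cod K a) (Cod K a') \<cdot> a" "q \<cdot> (j \<cdot> a') = Ide K (Cod K a') \<cdot> a'"
    by (rule Cmp_reassoc1[OF b(16)] Cmp_reassoc1[OF b(17)] Cmp_reassoc1[OF b(18)] Cmp_reassoc1[OF b(19)];
        use all in simp)+
  have "Add K (b \<cdot> p) (b' \<cdot> q) \<cdot> Add K (i \<cdot> a) (j \<cdot> a') = Add K u v"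
    using all 1 by (simp add: a(7) a'(7))
  moreover have "Add K (b \<cdot> p) (b' \<cdot> q) \<cdot> Add K (i \<cdot> a) (j \<cdot> a') \<in> I X Y"
    using all BP by (intro I_I) auto
  ultimately show ?thesis by simp
qed

lemma mem_cl: "g \<in> cl f \<longleftrightarrow> (\<exists>u \<in> I (Dom K f) (Cod K f). g = Add K f u)"
  unfolding stab_class_def by auto

lemma cl_simps:
  assumes "g \<in> cl f" "f \<in> Arr K"
  shows "g \<in> Arr K" "Dom K g = Dom K f" "Cod K g = Cod K f"
  using assms unfolding mem_cl by (auto dest!: I_simps)

lemma cl_self: "f \<in> Arr K \<Longrightarrow> f \<in> cl f"
  unfolding mem_cl by (rule bexI[of _ "Zer K (Dom K f) (Cod K f)"]) (auto intro: I_Zer)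

lemma cl_sym:
  assumes "g \<in> cl f" "f \<in> Arr K"
  shows "f \<in> cl g"
proof -
  obtain u where u: "u \<in> I (Dom K f) (Cod K f)" "g = Add K f u" using assms(1) unfolding mem_cl by blast
  have "f = Add K g (Neg K u)" using I_simps[OF u(1)] assms(2) by (simp add: u(2) Add_assoc)
  moreover have "Neg K u \<in> I (Dom K g) (Cod K g)"
    using I_Neg[OF u(1)] cl_simps[OF assms] by simp
  ultimately show ?thesis unfolding mem_cl by blast
qed

lemma cl_trans:
  assumes "g \<in> cl f" "h \<in> cl g" "f \<in> Arr K"
  shows "h \<in> cl f"
proof -
  obtain u where u: "u \<in> I (Dom K f) (Cod K f)" "g = Add K f u" using assms(1) unfolding mem_cl by blast
  obtain v where v: "v \<in> I (Dom K f) (Cod K f)" "h = Add K g v"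
    using assms(2) cl_simps[OF assms(1,3)] unfolding mem_cl by auto
  have "h = Add K f (Add K u v)" using I_simps[OF u(1)] I_simps[OF v(1)] assms(3) by (simp add: u(2) v(2) Add_assoc)
  then show ?thesis using I_Add[OF u(1) v(1)] unfolding mem_cl by blast
qed

lemma cl_eq: "g \<in> cl f \<Longrightarrow> f \<in> Arr K \<Longrightarrow> cl g = cl f"
  using cl_trans cl_sym cl_simps(1) by blast

lemma cl_eq_iff: "f \<in> Arr K \<Longrightarrow> g \<in> Arr K \<Longrightarrow> cl f = cl g \<longleftrightarrow> g \<in> cl f"
  using cl_eq cl_self by blast

lemma cl_eqD:
  assumes "cl f = cl g" "f \<in> Arr K" "g \<in> Arr K"
  shows "Dom K f = Dom K g" "Cod K f = Cod K g" "g \<in> cl f"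
  using assms cl_eq_iff[of f g] cl_simps[of g f] by auto

lemma cl_Cmp:
  assumes "f' \<in> cl f" "g' \<in> cl g" "f \<in> Arr K" "g \<in> Arr K" "Cod K f = Dom K g"
  shows "g' \<cdot> f' \<in> cl (g \<cdot> f)"
proof -
  obtain u where u: "u \<in> I (Dom K f) (Cod K f)" "f' = Add K f u" using assms(1) unfolding mem_cl by blast
  obtain v where v: "v \<in> I (Dom K g) (Cod K g)" "g' = Add K g v" using assms(2) unfolding mem_cl by blast
  note us = I_simps[OF u(1)] I_simps[OF v(1)] assms(3-5)
  have "g' \<cdot> f' = Add K (g \<cdot> f) (Add K (v \<cdot> f) (Add K (g \<cdot> u) (v \<cdot> u)))"
    using us by (simp add: u(2) v(2) Add_assoc)
  moreover have "Add K (v \<cdot> f) (Add K (g \<cdot> u) (v \<cdot> u)) \<in> I (Dom K f) (Cod K g)"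
    using us u(1) v(1) by (intro I_Add I_Cmp_right[OF v(1)] I_Cmp_left[OF u(1)]) auto
  ultimately show ?thesis using us unfolding mem_cl by auto
qed

lemma cl_Add:
  assumes "f' \<in> cl f" "g' \<in> cl g" "f \<in> Arr K" "g \<in> Arr K" "Dom K f = Dom K g" "Cod K f = Cod K g"
  shows "Add K f' g' \<in> cl (Add K f g)"
proof -
  obtain u where u: "u \<in> I (Dom K f) (Cod K f)" "f' = Add K f u" using assms(1) unfolding mem_cl by blast
  obtain v where v: "v \<in> I (Dom K g) (Cod K g)" "g' = Add K g v" using assms(2) unfolding mem_cl by blast
  note us = I_simps[OF u(1)] I_simps[OF v(1)] assms(3-6)
  have "Add K f' g' = Add K (Add K f g) (Add K u v)"
    using us by (simp add: u(2) v(2) Add_ac)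
  moreover have "Add K u v \<in> I (Dom K f) (Cod K f)" using u(1) v(1) assms(5,6) by (intro I_Add) auto
  ultimately show ?thesis using us unfolding mem_cl by auto
qed

text \<open>The difference of stably equal arrows is \<open>b a\<close> with \<open>a\<close> ending in a projective, and the fibre of
  \<open>a\<close> lies in \<open>S\<close>. This is what carries every stable identity over to \<open>K // M\<close>.\<close>

lemma cl_agree:
  assumes "cl f = cl g" "f \<in> Arr K" "g \<in> Arr K"
  obtains w where "w \<in> S" "Cod K w = Dom K f" "f \<cdot> w = g \<cdot> w"
proof -
  obtain u where u: "u \<in> I (Dom K f) (Cod K f)" "g = Add K f u"
    using cl_eqD(3)[OF assms] unfolding mem_cl by blast
  obtain a b where a: "a \<in> Arr K" "b \<in> Arr K" "Dom K b = Cod K a" "Cod K a \<in> P"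
   "Dom K a = Dom K f" "Cod K b = Cod K f" "u = b \<cdot> a" using u(1) by (rule I_E)
  obtain w where w: "w \<in> S" "Cod K w = Dom K a" "a \<cdot> w = Zer K (Dom K w) (Cod K a)"
    using kill[of a] a P_M by blast
  have "g \<cdot> w = Add K (f \<cdot> w) (b \<cdot> (a \<cdot> w))" using a(1-6) w(1,2) assms(2) by (simp add: u(2) a(7))
  also have "\<dots> = f \<cdot> w" unfolding w(3) using a(1-6) w(1,2) assms(2) by simp
  finally show ?thesis using w a by (intro that[of w]) auto
qed

lemma cl_eq_Q:
  assumes "cl f = cl g" "f \<in> Arr K" "g \<in> Arr K"
  shows "Q f = Q g"
proof -
  obtain w where "w \<in> S" "Cod K w = Dom K f" "f \<cdot> w = g \<cdot> w" using cl_agree[OF assms] .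
  then show ?thesis using cl_eqD(1)[OF assms] assms(2,3) by (intro Q_eqI[of f g w]) auto
qed

section \<open>The chosen triangles\<close>

definition iR :: "'o \<Rightarrow> 'm" where "iR X = fst (R X)"
definition pR :: "'o \<Rightarrow> 'm" where "pR X = fst (snd (R X))"
definition qR :: "'o \<Rightarrow> 'm" where "qR X = snd (snd (R X))"

lemma R_eq: "R X = (iR X, pR X, qR X)"
  by (simp add: iR_def pR_def qR_def)

lemma
  assumes "X \<in> Obj K"
  shows R_Tri: "(iR X, pR X, qR X) \<in> Tri K"
    and R_mono: "E_mono E (iR X)"
    and R_Dom [simp]: "Dom K (iR X) = X"
    and R_P: "Cod K (iR X) \<in> P"
proof -
  have "R X \<in> Tri K \<and> (case R X of (i, p, q) \<Rightarrow> E_mono E i \<and> Dom K i = X \<and> Cod K i \<in> E_inj K E)"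
    using R assms unfolding injective_choice_def by (rule bspec)
  then have "(iR X, pR X, qR X) \<in> Tri K \<and> E_mono E (iR X) \<and> Dom K (iR X) = X \<and> Cod K (iR X) \<in> E_inj K E"
    by (simp only: R_eq[of X] prod.case)
  then show "(iR X, pR X, qR X) \<in> Tri K" "E_mono E (iR X)" "Dom K (iR X) = X" "Cod K (iR X) \<in> P"
    using proj_eq_inj by blast+
qed

lemma R_simps [simp]:
  assumes "X \<in> Obj K"
  shows "iR X \<in> Arr K" "pR X \<in> Arr K" "qR X \<in> Arr K" "Dom K (pR X) = Cod K (iR X)"
    "Dom K (qR X) = Cod K (pR X)" "Cod K (qR X) = Sus K X"
  using TriD[OF R_Tri[OF assms]] assms by auto

text \<open>As \<open>i\<^sub>X\<close> is an \<open>\<E>\<close>-monomorphism, arrows into injectives extend along it.\<close>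

lemma R_extend:
  assumes "X \<in> Obj K" "a \<in> Arr K" "Dom K a = X" "Cod K a \<in> P"
  obtains a' where "a' \<in> Arr K" "Dom K a' = Cod K (iR X)" "Cod K a' = Cod K a" "a' \<cdot> iR X = a"
proof -
  obtain g h where E: "(iR X, g, h) \<in> E" using R_mono[OF assms(1)] unfolding E_mono_def by blast
  have t: "Dom K g = Cod K (iR X)" using E E_Tri TriD(4) by blast
  have "Cod K a \<in> E_inj K E" using assms(4) proj_eq_inj by simp
  then have "(\<lambda>b. b \<cdot> iR X) ` Hom K (Dom K g) (Cod K a) = Hom K (Dom K (iR X)) (Cod K a)"
    using E unfolding E_inj_def by blast
  moreover have "a \<in> Hom K (Dom K (iR X)) (Cod K a)" using assms by simp
  ultimately obtain b where "b \<in> Hom K (Dom K g) (Cod K a)" "b \<cdot> iR X = a" by (metis imageE)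
  then show ?thesis using t by (intro that[of b]) auto
qed

text \<open>The sign is the one that comes out of the octahedral axiom when standard triangles are compared
  with triangles of \<open>K\<close>; with it no further signs occur.\<close>

definition nq :: "'o \<Rightarrow> 'm" where "nq X = Neg K (qR X)"

lemma nq_simps [simp]:
  assumes "X \<in> Obj K"
  shows "nq X \<in> Arr K" "Dom K (nq X) = Cod K (pR X)" "Cod K (nq X) = Sus K X"
  using assms by (auto simp: nq_def)

lemma nq_S [simp]:
  assumes "X \<in> Obj K"
  shows "nq X \<in> S"
proof -
  have "qR X \<in> S"
    by (rule S_I[OF Tri_rotate[OF Tri_rotate[OF R_Tri[OF assms]]]]) (use assms R_P P_M in simp)
  then show ?thesis unfolding nq_def by (rule Neg_S)
qed

lemma M_Cod_pR: "X \<in> Obj K \<Longrightarrow> Cod K (pR X) \<in> M \<longleftrightarrow> X \<in> M"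
  using J_Tri(1,2)[OF R_Tri, of X] R_P[of X] P_M by auto

text \<open>The third component \<open>f'\<close> of a morphism \<open>(f, e, f')\<close> between the chosen triangles represents the
  stable suspension of \<open>f\<close>.\<close>

lemma lift_ex:
  assumes "f \<in> Arr K"
  obtains e f' where "tri_mor K (R (Dom K f)) (R (Cod K f)) (f, e, f')"
proof -
  have O: "Dom K f \<in> Obj K" "Cod K f \<in> Obj K" using assms by auto
  obtain e where e: "e \<in> Arr K" "Dom K e = Cod K (iR (Dom K f))" "Cod K e = Cod K (iR (Cod K f) \<cdot> f)"
    "e \<cdot> iR (Dom K f) = iR (Cod K f) \<cdot> f"
    using R_extend[of "Dom K f" "iR (Cod K f) \<cdot> f"] O assms R_P by auto
  from fill_in[OF R_Tri[OF O(1)] R_Tri[OF O(2)], of f e] obtain c where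
    "tri_mor K (iR (Dom K f), pR (Dom K f), qR (Dom K f)) (iR (Cod K f), pR (Cod K f), qR (Cod K f)) (f, e, c)"
    using e O assms by auto
  then show ?thesis by (intro that) (simp only: R_eq)
qed

lemma lift_simps:
  assumes "tri_mor K (R (Dom K f)) (R (Cod K f)) (f, e, f')" "f \<in> Arr K"
  shows "f' \<in> Arr K" "Dom K f' = Cod K (pR (Dom K f))" "Cod K f' = Cod K (pR (Cod K f))"
    "nq (Cod K f) \<cdot> f' = SusA K f \<cdot> nq (Dom K f)"
  using assms by (auto simp: R_eq nq_def)

text \<open>If \<open>g - f\<close> factors through a projective, then \<open>q\<^sub>Y (g' - f') = \<Sigma>(g - f) q\<^sub>X\<close> vanishes, so that
  \<open>g' - f'\<close> factors through \<open>p\<^sub>Y\<close> and hence through the injective \<open>Y\<^sub>\<E>\<close>.\<close>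

lemma lift_unique:
  assumes f: "tri_mor K (R (Dom K f)) (R (Cod K f)) (f, e, f')" "f \<in> Arr K"
    and g: "tri_mor K (R (Dom K g)) (R (Cod K g)) (g, e', g')" "g \<in> cl f"
  shows "cl g' = cl f'"
proof -
  have gA: "g \<in> Arr K" "Dom K g = Dom K f" "Cod K g = Cod K f" using cl_simps g(2) f(2) by auto
  define X where "X = Dom K f"
  define Y where "Y = Cod K f"
  have O: "X \<in> Obj K" "Y \<in> Obj K" using f(2) by (auto simp: X_def Y_def)
  note lf = lift_simps(1-3)[OF f, folded X_def Y_def] note lg = lift_simps(1-3)[OF g(1) gA(1), unfolded gA(2,3), folded X_def Y_def]
  have qf: "qR Y \<cdot> f' = SusA K f \<cdot> qR X" using f by (simp add: R_eq X_def Y_def)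
  have qg: "qR Y \<cdot> g' = SusA K g \<cdot> qR X" using g(1) by (simp add: R_eq X_def Y_def gA)
  obtain u where u: "u \<in> I X Y" "g = Add K f u" using g(2) unfolding mem_cl X_def Y_def by blast
  obtain a b where a: "a \<in> Arr K" "b \<in> Arr K" "Dom K b = Cod K a" "Cod K a \<in> P"
   "Dom K a = X" "Cod K b = Y" "u = b \<cdot> a" using u(1) by (rule I_E)
  obtain a' where a': "a' \<in> Arr K" "Dom K a' = Cod K (iR X)" "Cod K a' = Cod K a" "a' \<cdot> iR X = a"
    using R_extend[OF O(1), of a] a by auto
  \<comment> \<open>\<open>\<Sigma>u\<close> factors through \<open>\<Sigma>i\<^sub>X\<close>, and \<open>\<Sigma>i\<^sub>X q\<^sub>X = 0\<close>.\<close>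
  have "SusA K a \<cdot> qR X = (SusA K a' \<cdot> SusA K (iR X)) \<cdot> qR X"
    using a' O by (metis SusA_Cmp R_simps(1))
  also have "\<dots> = SusA K a' \<cdot> (SusA K (iR X) \<cdot> qR X)" using a'(1-3) O by simp
  also have "\<dots> = Zer K (Cod K (pR X)) (Sus K (Cod K a))"
    unfolding Tri_comp3[OF R_Tri[OF O(1)]] using a' O by simp
  finally have 0: "SusA K a \<cdot> qR X = Zer K (Cod K (pR X)) (Sus K (Cod K a))" .
  have fA: "f \<in> Arr K" "Dom K f = X" "Cod K f = Y" using f(2) by (auto simp: X_def Y_def)
  have "qR Y \<cdot> Sub K g' f' = Sub K (qR Y \<cdot> g') (qR Y \<cdot> f')"
    using lf lg O by (intro Cmp_Sub) auto
  also have "\<dots> = Sub K (SusA K g) (SusA K f) \<cdot> qR X"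
    unfolding qf qg using O fA gA by (intro Sub_Cmp[symmetric]) auto
  also have "Sub K (SusA K g) (SusA K f) = SusA K u"
    using fA I_simps[OF u(1)] by (simp add: u(2) Sub_def Add_commute[of "SusA K f"] Add_assoc)
  also have "SusA K u \<cdot> qR X = SusA K b \<cdot> (SusA K a \<cdot> qR X)" using a(1-6) O by (simp add: a(7))
  also have "\<dots> = Zer K (Cod K (pR X)) (Sus K Y)" unfolding 0 using a(1-6) O by simp
  finally have "qR Y \<cdot> Sub K g' f' = Zer K (Cod K (pR X)) (Sus K Y)" .
  then obtain d where d: "d \<in> Arr K" "Dom K d = Cod K (pR X)" "Cod K d = Cod K (iR Y)" "pR Y \<cdot> d = Sub K g' f'"
    using weak_kernel2[OF R_Tri[OF O(2)], of "Sub K g' f'"] lf lg O by auto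
  have "Sub K g' f' \<in> I (Dom K f') (Cod K f')"
    unfolding d(4)[symmetric] using d(1-3) O R_P lf by (intro I_I) auto
  moreover have "g' = Add K f' (Sub K g' f')"
    using lf lg by (simp add: Sub_def Add_left_commute[of f'])
  ultimately have "g' \<in> cl f'" unfolding mem_cl by blast
  then show ?thesis using cl_eq lf by blast
qed

end

section \<open>Added triangles and transported category laws\<close>

lemma with_triangles_fields:
  "Obj (with_triangles K A) = Obj K" "Arr (with_triangles K A) = Arr K" "Dom (with_triangles K A) = Dom K"
  "Cod (with_triangles K A) = Cod K" "Ide (with_triangles K A) = Ide K" "Cmp (with_triangles K A) = Cmp K"
  "Add (with_triangles K A) = Add K" "Zer (with_triangles K A) = Zer K" "Sus (with_triangles K A) = Sus K"
  "SusA (with_triangles K A) = SusA K"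
  unfolding with_triangles_def suscat.extend_def tricat.fields_def by simp_all

lemma Tri_with_triangles:
  "T \<in> Tri (with_triangles K A) \<longleftrightarrow> is_triangle (with_triangles K A) T \<and>
     (\<exists>T0 \<in> A. tri_isomorphic (with_triangles K A) T0 T)"
proof -
  have 1: "is_triangle (with_triangles K A) T \<longleftrightarrow> is_triangle K T" for T
    by (cases T) (simp add: with_triangles_fields)
  have iso: "is_iso (with_triangles K A) f \<longleftrightarrow> is_iso K f" for f
    unfolding is_iso_def Hom_def with_triangles_fields by simp
  have mor: "tri_mor (with_triangles K A) T T' (a, b, c) \<longleftrightarrow> tri_mor K T T' (a, b, c)" for T T' a b c
    by (cases T; cases T') (simp add: Hom_def with_triangles_fields)
  have 2: "tri_isomorphic (with_triangles K A) T T' \<longleftrightarrow> tri_isomorphic K T T'" for T T'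
    unfolding tri_isomorphic_def iso mor by simp
  show ?thesis unfolding 1 2
    by (simp add: with_triangles_def suscat.extend_def tricat.fields_def)
qed

text \<open>The category laws of the target are part of the conclusion: for the Verdier quotient of the
  relative stable category they are obtained from those of \<open>K // M\<close>.\<close>

lemma equivalence_transport:
  assumes C: "category C" and Obj: "Obj D = Obj C" and Arr: "Arr D = F ` Arr C"
    and inj: "inj_on F (Arr C)"
    and ends: "\<And>c. c \<in> Arr C \<Longrightarrow> Dom D (F c) = Dom C c" "\<And>c. c \<in> Arr C \<Longrightarrow> Cod D (F c) = Cod C c"
    and Ide: "\<And>X. X \<in> Obj C \<Longrightarrow> Ide D X = F (Ide C X)"
    and Cmp: "\<And>c d. c \<in> Arr C \<Longrightarrow> d \<in> Arr C \<Longrightarrow> Cod C c = Dom C d \<Longrightarrow>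
      F d \<cdot>\<^bsub>D\<^esub> F c = F (d \<cdot>\<^bsub>C\<^esub> c)"
  shows "category D" "is_equivalence C D \<lparr>FO = id, FA = F\<rparr>"
proof -
  interpret C: category C by fact
  have HomE: "\<exists>c. c \<in> Arr C \<and> Dom C c = X \<and> Cod C c = Y \<and> f = F c" if "f \<in> Hom D X Y" for f X Y
    using that ends unfolding Hom_def Arr by auto
  show D: "category D"
  proof
    fix f g h W X Y Z assume "f \<in> Hom D W X" "g \<in> Hom D X Y" "h \<in> Hom D Y Z"
    then show "(h \<cdot>\<^bsub>D\<^esub> g) \<cdot>\<^bsub>D\<^esub> f = h \<cdot>\<^bsub>D\<^esub> (g \<cdot>\<^bsub>D\<^esub> f)"
      by (auto dest!: HomE simp: Cmp)
  next
    fix f X Y assume f: "f \<in> Hom D X Y"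
    then have "X \<in> Obj C" "Y \<in> Obj C" by (auto dest!: HomE)
    with f show "f \<cdot>\<^bsub>D\<^esub> Ide D X = f" "Ide D Y \<cdot>\<^bsub>D\<^esub> f = f"
      by (auto dest!: HomE simp: Cmp Ide)
  next
    fix f g X Y Z assume "f \<in> Hom D X Y" "g \<in> Hom D Y Z"
    then show "g \<cdot>\<^bsub>D\<^esub> f \<in> Hom D X Z"
      by (auto dest!: HomE simp: Cmp) (auto simp: Hom_def Arr ends)
  next
    fix f assume "f \<in> Arr D"
    then show "Dom D f \<in> Obj D" "Cod D f \<in> Obj D" by (auto simp: Arr Obj ends)
  next
    fix X assume "X \<in> Obj D"
    then show "Ide D X \<in> Hom D X X" by (auto simp: Hom_def Arr Obj Ide ends)
  qed
  interpret D: category D by fact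
  define G where "G = inv_into (Arr C) F"
  have GF: "G (F c) = c" if "c \<in> Arr C" for c using inv_into_f_f[OF inj that] by (simp add: G_def)
  have Ffun: "is_functor C D \<lparr>FO = id, FA = F\<rparr>"
    unfolding is_functor_def using C D by (auto simp: Obj Arr ends Ide Cmp)
  have Gfun: "is_functor D C \<lparr>FO = id, FA = G\<rparr>"
    unfolding is_functor_def using C D by (auto simp: Obj Arr ends Ide Cmp GF)
  have "natural_iso C C (\<lparr>FO = id, FA = G\<rparr> \<circ>\<circ> \<lparr>FO = id, FA = F\<rparr>) id_fctr (Ide C)"
    unfolding natural_iso_def comp_fctr_def id_fctr_def by (auto simp: GF)
  moreover have "natural_iso D D (\<lparr>FO = id, FA = F\<rparr> \<circ>\<circ> \<lparr>FO = id, FA = G\<rparr>) id_fctr (Ide D)"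
    unfolding natural_iso_def comp_fctr_def id_fctr_def
    by (auto simp: GF Arr ends) (auto simp: Obj Ide Cmp ends)
  ultimately show "is_equivalence C D \<lparr>FO = id, FA = F\<rparr>"
    unfolding is_equivalence_def using Ffun Gfun by blast
qed

section \<open>The relative stable category\<close>

context frobenius_stable
begin

abbreviation KE :: "('o, 'm set) tricat" where "KE \<equiv> relative_stable K E R"
abbreviation Cmp_VM (infixr "\<odot>" 75) where "d \<odot> c \<equiv> d \<cdot>\<^bsub>V\<^esub> c"

lemma KE_fields:
  "Obj KE = Obj K" "Arr KE = cl ` Arr K" "Dom KE = (\<lambda>c. the_elem (Dom K ` c))"
  "Cod KE = (\<lambda>c. the_elem (Cod K ` c))" "Ide KE = (\<lambda>X. cl (Ide K X))"
  "Cmp KE = (\<lambda>d c. the_elem {cl (g \<cdot>\<^bsub>K\<^esub> f) | g f. g \<in> d \<and> f \<in> c})"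
  "Add KE = (\<lambda>c d. the_elem {cl (Add K f g) | f g. f \<in> c \<and> g \<in> d})"
  "Zer KE = (\<lambda>X Y. cl (Zer K X Y))" "Sus KE = (\<lambda>X. Cod K (pR X))"
  "SusA KE = (\<lambda>c. the_elem {cl f' | f e f'.
                f \<in> c \<and> tri_mor K (R (Dom K f)) (R (Cod K f)) (f, e, f')})"
  unfolding relative_stable_def with_triangles_fields stable_suscat_def Let_def
  by (simp_all add: R_eq)

lemma KE_cl [simp]:
  assumes "f \<in> Arr K"
  shows "cl f \<in> Arr KE" "Dom KE (cl f) = Dom K f" "Cod KE (cl f) = Cod K f"
proof -
  show "cl f \<in> Arr KE" unfolding KE_fields using assms by (rule imageI)
  have "the_elem (Dom K ` cl f) = Dom K f"
    by (rule the_elem_eqI) (use cl_self[OF assms] cl_simps(2)[OF _ assms] in blast)+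
  then show "Dom KE (cl f) = Dom K f" by (simp only: KE_fields)
  have "the_elem (Cod K ` cl f) = Cod K f"
    by (rule the_elem_eqI) (use cl_self[OF assms] cl_simps(3)[OF _ assms] in blast)+
  then show "Cod KE (cl f) = Cod K f" by (simp only: KE_fields)
qed

lemma KE_Obj [simp]: "Obj KE = Obj K"
  and KE_Ide [simp]: "Ide KE X = cl (Ide K X)"
  and KE_Sus [simp]: "Sus KE X = Cod K (pR X)"
  by (simp_all add: KE_fields)

lemma KE_ArrE:
  assumes "c \<in> Arr KE" obtains f where "f \<in> Arr K" "c = cl f"
  using assms by (auto simp: KE_fields)

lemma KE_HomE:
  assumes "c \<in> Hom KE X Y" obtains f where "f \<in> Arr K" "c = cl f" "Dom K f = X" "Cod K f = Y"
proof -
  have c: "c \<in> Arr KE" "Dom KE c = X" "Cod KE c = Y" using assms unfolding Hom_def by simp_all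
  obtain f where "f \<in> Arr K" "c = cl f" using c(1) by (rule KE_ArrE)
  with c(2,3) show ?thesis by (intro that[of f]) simp_all
qed

lemma Hom_KE: "Hom KE X Y = cl ` Hom K X Y"
  unfolding Hom_def by (auto elim!: KE_ArrE)

lemma KE_Cmp:
  assumes "f \<in> Arr K" "g \<in> Arr K" "Cod K f = Dom K g"
  shows "cl g \<cdot>\<^bsub>KE\<^esub> cl f = cl (g \<cdot> f)"
  unfolding KE_fields
proof (rule the_elem_eqI)
  show "cl (g \<cdot> f) \<in> {cl (ga \<cdot> fa) |ga fa. ga \<in> cl g \<and> fa \<in> cl f}"
    using assms cl_self by blast
next
  fix y assume "y \<in> {cl (ga \<cdot> fa) |ga fa. ga \<in> cl g \<and> fa \<in> cl f}"
  then show "y = cl (g \<cdot> f)" using cl_Cmp assms cl_eq Cmp_simps(1) by blast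
qed

lemma KE_Add:
  assumes "f \<in> Arr K" "g \<in> Arr K" "Dom K f = Dom K g" "Cod K f = Cod K g"
  shows "Add KE (cl f) (cl g) = cl (Add K f g)"
  unfolding KE_fields
proof (rule the_elem_eqI)
  show "cl (Add K f g) \<in> {cl (Add K fa ga) |fa ga. fa \<in> cl f \<and> ga \<in> cl g}"
    using assms cl_self by blast
next
  fix y assume "y \<in> {cl (Add K fa ga) |fa ga. fa \<in> cl f \<and> ga \<in> cl g}"
  then show "y = cl (Add K f g)" using cl_Add assms cl_eq Add_simps(1) by blast
qed

lemma KE_SusA:
  assumes f: "tri_mor K (R (Dom K f)) (R (Cod K f)) (f, e, f')" "f \<in> Arr K"
  shows "SusA KE (cl f) = cl f'"
  unfolding KE_fields
proof (rule the_elem_eqI)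
  show "cl f' \<in> {cl f' |fa e f'. fa \<in> cl f \<and> tri_mor K (R (Dom K fa)) (R (Cod K fa)) (fa, e, f')}"
    using f cl_self by blast
next
  fix y assume "y \<in> {cl f' |fa e f'. fa \<in> cl f \<and> tri_mor K (R (Dom K fa)) (R (Cod K fa)) (fa, e, f')}"
  then show "y = cl f'" using lift_unique[OF f] by blast
qed

lemma KE_isoE:
  assumes "is_iso KE c"
  obtains a b where "c = cl a" "a \<in> Arr K" "b \<in> Arr K" "Dom K b = Cod K a" "Cod K b = Dom K a"
    "cl (b \<cdot> a) = cl (Ide K (Dom K a))" "cl (a \<cdot> b) = cl (Ide K (Cod K a))"
proof -
  obtain d where cd: "c \<in> Arr KE" "d \<in> Hom KE (Cod KE c) (Dom KE c)"
    "d \<cdot>\<^bsub>KE\<^esub> c = Ide KE (Dom KE c)" "c \<cdot>\<^bsub>KE\<^esub> d = Ide KE (Cod KE c)"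
    using assms unfolding is_iso_def by blast
  obtain a where a: "a \<in> Arr K" "c = cl a" using cd(1) by (rule KE_ArrE)
  obtain b where b: "b \<in> Arr K" "d = cl b" using cd(2) unfolding Hom_def by (auto elim: KE_ArrE)
  show ?thesis
    using cd(2-4) a b by (intro that[of a b]) (auto simp: Hom_def KE_Cmp)
qed

lemma KE_iso_Ide: "X \<in> Obj K \<Longrightarrow> is_iso KE (cl (Ide K X))"
  unfolding is_iso_def by (intro conjI bexI[of _ "cl (Ide K X)"]) (simp_all add: Hom_def KE_Cmp)

lemma KE_iso_Q:
  assumes "is_iso KE (cl a)" "a \<in> Arr K"
  shows "is_iso V (Q a)"
proof -
  obtain a' b where b: "cl a = cl a'" "a' \<in> Arr K" "b \<in> Arr K" "Dom K b = Cod K a'" "Cod K b = Dom K a'"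
    "cl (b \<cdot> a') = cl (Ide K (Dom K a'))" "cl (a' \<cdot> b) = cl (Ide K (Cod K a'))"
    using assms(1) by (rule KE_isoE)
  have "Q (b \<cdot> a') = Q (Ide K (Dom K a'))" "Q (a' \<cdot> b) = Q (Ide K (Cod K a'))"
    by (rule cl_eq_Q[OF b(6)] cl_eq_Q[OF b(7)]; use b(2-5) in simp)+
  then have "is_iso V (Q a')" using b(2-5) by (intro V.is_isoI[where g = "Q b"]) (simp_all add: Q_Cmp)
  moreover have "Q a = Q a'" using cl_eq_Q b(1,2) assms(2) by blast
  ultimately show ?thesis by simp
qed

text \<open>Being zero in \<open>K // M\<close> is a property of the stable class of an arrow, so membership in \<open>M\<close>
  is inherited even by stable retracts.\<close>

lemma stable_retract_in_M:
  assumes "cl (r \<cdot> s) = cl (Ide K (Dom K s))" "s \<in> Arr K" "r \<in> Arr K" "Cod K s = Dom K r"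
    "Cod K r = Dom K s" "Dom K r \<in> M"
  shows "Dom K s \<in> M"
  using retract_in_J[of s r] cl_eq_Q[OF assms(1)] assms(2-6) by simp

lemma KE_retract_in_M:
  assumes "c \<in> Hom KE X B" "d \<in> Hom KE B X" "d \<cdot>\<^bsub>KE\<^esub> c = Ide KE X" "B \<in> M"
  shows "X \<in> M"
proof -
  obtain s where s: "s \<in> Arr K" "c = cl s" "Dom K s = X" "Cod K s = B" using assms(1) by (rule KE_HomE)
  obtain r where r: "r \<in> Arr K" "d = cl r" "Dom K r = B" "Cod K r = X" using assms(2) by (rule KE_HomE)
  show ?thesis using stable_retract_in_M[of r s] assms(3,4) s r by (simp add: KE_Cmp)
qed

lemma KE_iso_M:
  assumes "is_iso KE c"
  shows "Dom KE c \<in> M \<longleftrightarrow> Cod KE c \<in> M"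
proof -
  obtain d where d: "d \<in> Hom KE (Cod KE c) (Dom KE c)" "d \<cdot>\<^bsub>KE\<^esub> c = Ide KE (Dom KE c)"
    "c \<cdot>\<^bsub>KE\<^esub> d = Ide KE (Cod KE c)" and c: "c \<in> Hom KE (Dom KE c) (Cod KE c)"
    using assms unfolding is_iso_def Hom_def by blast
  show ?thesis using KE_retract_in_M[OF c d(1,2)] KE_retract_in_M[OF d(1) c d(3)] by blast
qed

lemma standardE:
  assumes "T \<in> standard_triangles K E R"
  obtains f g h z w where "T = (cl f, cl g, cl h)" "f \<in> Arr K" "homotopy_cartesian K (iR (Dom K f)) f z g"
    "(g, h, w) \<in> Tri K" "Cod K h = Cod K (pR (Dom K f))" "Dom K g = Cod K f"
proof -
  obtain f g h z w where 1: "T = (cl f, cl g, cl h)" "f \<in> Arr K" 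
    "homotopy_cartesian K (iR (Dom K f)) f z g" "(g, h, w) \<in> Tri K"
    "tri_mor K (iR (Dom K f), pR (Dom K f), qR (Dom K f)) (g, h, w) (f, z, Ide K (Cod K (pR (Dom K f))))"
    using assms unfolding standard_triangles_def by (auto simp: stable_fctr_def R_eq)
  have "Ide K (Cod K (pR (Dom K f))) \<in> Hom K (Dom K (qR (Dom K f))) (Dom K w)"
    using 1(5) unfolding tri_mor.simps by blast
  then have "Cod K h = Cod K (pR (Dom K f))" using TriD(5)[OF 1(4)] 1(2) by simp
  moreover have "Dom K g = Cod K f" using 1(3) unfolding homotopy_cartesian_def by simp
  ultimately show ?thesis by (rule that[OF 1(1-4)])
qed

lemma Tri_KE_E:
  assumes "(F, G, H) \<in> Tri KE"
  obtains f g h z w a b c where "f \<in> Arr K" "homotopy_cartesian K (iR (Dom K f)) f z g"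
    "(g, h, w) \<in> Tri K" "Cod K h = Cod K (pR (Dom K f))" "Dom K g = Cod K f"
    "is_iso KE a" "is_iso KE b" "is_iso KE c" "tri_mor KE (cl f, cl g, cl h) (F, G, H) (a, b, c)"
    "is_triangle KE (F, G, H)"
proof -
  have t: "is_triangle KE (F, G, H)" and "\<exists>T0\<in>standard_triangles K E R. tri_isomorphic KE T0 (F, G, H)"
    using assms unfolding relative_stable_def Tri_with_triangles by auto
  then obtain T0 a b c where T0: "T0 \<in> standard_triangles K E R" 
    "tri_mor KE T0 (F, G, H) (a, b, c)" "is_iso KE a" "is_iso KE b" "is_iso KE c"
    unfolding tri_isomorphic_def by blast
  obtain f g h z w where 1: "T0 = (cl f, cl g, cl h)" "f \<in> Arr K" "homotopy_cartesian K (iR (Dom K f)) f z g"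
    "(g, h, w) \<in> Tri K" "Cod K h = Cod K (pR (Dom K f))" "Dom K g = Cod K f"
    using T0(1) by (rule standardE)
  show ?thesis by (rule that[OF 1(2-6) T0(3-5) T0(2)[unfolded 1(1)] t])
qed

text \<open>Up to stable isomorphism, the objects of a triangle \<open>X \<rightarrow> Y \<rightarrow> Z \<rightarrow> X'\<close> are those of a triangle
  \<open>Y \<rightarrow> Z \<rightarrow> X' \<rightarrow> \<Sigma>Y\<close> of \<open>K\<close>, where \<open>X'\<close> can be traded for \<open>X\<close> because \<open>X\<^sub>\<E>\<close> lies in \<open>M\<close>. This
  reduces the two-out-of-three property to the one in \<open>K\<close>.\<close>

lemma Tri_KE_objects:
  assumes "(F, G, H) \<in> Tri KE"
  obtains f g h w where "f \<in> Arr K" "(g, h, w) \<in> Tri K" "Dom K g = Cod K f"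
    "Dom KE F \<in> M \<longleftrightarrow> Cod K h \<in> M" "Dom KE G \<in> M \<longleftrightarrow> Dom K g \<in> M" "Dom KE H \<in> M \<longleftrightarrow> Cod K g \<in> M"
proof -
  obtain f g h z w a b c where T: "f \<in> Arr K" "homotopy_cartesian K (iR (Dom K f)) f z g"
    "(g, h, w) \<in> Tri K" "Cod K h = Cod K (pR (Dom K f))" "Dom K g = Cod K f"
    "is_iso KE a" "is_iso KE b" "is_iso KE c" "tri_mor KE (cl f, cl g, cl h) (F, G, H) (a, b, c)"
    using assms by (rule Tri_KE_E)
  note t = TriD[OF T(3)]
  have "Dom K f \<in> M \<longleftrightarrow> Dom KE F \<in> M" "Dom K g \<in> M \<longleftrightarrow> Dom KE G \<in> M" "Cod K g \<in> M \<longleftrightarrow> Dom KE H \<in> M"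
    using KE_iso_M[OF T(6)] KE_iso_M[OF T(7)] KE_iso_M[OF T(8)] T(9) T(1,5) t by (auto simp: Hom_def)
  moreover have "Dom K f \<in> M \<longleftrightarrow> Cod K h \<in> M" using M_Cod_pR[of "Dom K f"] T(1,4) by simp
  ultimately show ?thesis using T by (intro that[of f g h w]) auto
qed

theorem thick_KE_M: "thick KE M"
  unfolding thick_def
proof (intro conjI allI impI ballI)
  show "M \<subseteq> Obj KE" by (auto simp: KE_fields)
  obtain Z where Z: "Z \<in> M" "is_zero K Z" by (rule zero_in_J)
  have "is_zero KE Z"
    unfolding is_zero_def
  proof (intro conjI ballI)
    fix X assume X: "X \<in> Obj KE"
    have image: "\<exists>!y. y \<in> cl ` A" if "\<exists>!x. x \<in> A" for A using that by blast
    show "\<exists>!f. f \<in> Hom KE X Z" "\<exists>!f. f \<in> Hom KE Z X"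
      unfolding Hom_KE using Z(2) X unfolding is_zero_def by (simp_all only: image KE_Obj)
  qed (use Z in simp)
  with Z show "\<exists>Z\<in>M. is_zero KE Z" by blast
next
  fix f assume "is_iso KE f" "Dom KE f \<in> M"
  then show "Cod KE f \<in> M" using KE_iso_M by blast
next
  fix X assume "X \<in> Obj KE"
  then show "Sus KE X \<in> M \<longleftrightarrow> X \<in> M" using M_Cod_pR by simp
next
  fix F G H assume "(F, G, H) \<in> Tri KE"
  then obtain f g h w where T: "f \<in> Arr K" "(g, h, w) \<in> Tri K" "Dom K g = Cod K f"
    and iff: "Dom KE F \<in> M \<longleftrightarrow> Cod K h \<in> M" "Dom KE G \<in> M \<longleftrightarrow> Dom K g \<in> M" "Dom KE H \<in> M \<longleftrightarrow> Cod K g \<in> M"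
    by (rule Tri_KE_objects)
  show "Dom KE H \<in> M" if "Dom KE F \<in> M \<and> Dom KE G \<in> M" using that J_Tri(3)[OF T(2)] iff by blast
  show "Dom KE F \<in> M" if "Dom KE G \<in> M \<and> Dom KE H \<in> M" using that J_Tri(1)[OF T(2)] iff by blast
  show "Dom KE G \<in> M" if "Dom KE F \<in> M \<and> Dom KE H \<in> M" using that J_Tri(2)[OF T(2)] iff by blast
next
  fix X Y B i j p q assume B: "is_biproduct KE X Y B i j p q" "B \<in> M"
  then have ij: "i \<in> Hom KE X B" "p \<in> Hom KE B X" "p \<cdot>\<^bsub>KE\<^esub> i = Ide KE X"
    "j \<in> Hom KE Y B" "q \<in> Hom KE B Y" "q \<cdot>\<^bsub>KE\<^esub> j = Ide KE Y" unfolding is_biproduct_def by blast+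
  show "X \<in> M" by (rule KE_retract_in_M[OF ij(1-3) B(2)])
  show "Y \<in> M" by (rule KE_retract_in_M[OF ij(4-6) B(2)])
qed

text \<open>The homotopy pushout \<open>Z\<close> of \<open>i\<^sub>X\<close> and \<open>f : X \<rightarrow> Y\<close> is the cone of \<open>m = (i\<^sub>X, f) : X \<rightarrow> X\<^sub>\<E> \<oplus> Y\<close>.
  The octahedral axiom for \<open>pr\<^sub>1 m = i\<^sub>X\<close> provides the map \<open>Z \<rightarrow> X'\<close> of the standard triangle, the one
  for \<open>pr\<^sub>2 m = f\<close> compares \<open>Z\<close> with the cone of \<open>f\<close>, up to \<open>\<Sigma>X\<^sub>\<E>\<close>. Using one and the same cone of \<open>m\<close>
  for both makes the two maps compatible; the minus sign in \<open>nq\<close> is the one that then appears.\<close>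

lemma standard_triangle_comparison:
  assumes T: "(f, g, h) \<in> Tri K"
  obtains z g' h' w c where "homotopy_cartesian K (iR (Dom K f)) f z g'" "(g', h', w) \<in> Tri K"
    "tri_mor K (R (Dom K f)) (g', h', w) (f, z, Ide K (Cod K (pR (Dom K f))))"
    "c \<in> S" "Dom K c = Cod K g'" "Cod K c = Cod K g" "c \<cdot> g' = g" "h \<cdot> c = nq (Dom K f) \<cdot> h'"
proof -
  define X where "X = Dom K f"
  define Y where "Y = Cod K f"
  define W where "W = Cod K (iR X)"
  note t = TriD[OF T, folded X_def Y_def]
  have fXY: "Dom K f = X" "Cod K f = Y" by (simp_all add: X_def Y_def)
  have O: "X \<in> Obj K" "Y \<in> Obj K" "W \<in> Obj K" using t by (auto simp: X_def Y_def W_def)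
  note r = R_simps[OF O(1), folded W_def] R_Dom[OF O(1)] W_def[symmetric]
  obtain B k l p q where B: "is_biproduct K W Y B k l p q" using biproduct_ex[OF O(3,2)] by blast
  note b = is_biproductD[OF B]
  define m where "m = Add K (k \<cdot> iR X) (l \<cdot> f)"
  have m: "m \<in> Arr K" "Dom K m = X" "Cod K m = B" using t r b(1-15) fXY by (auto simp: m_def)
  have "p \<cdot> (k \<cdot> iR X) = Ide K W \<cdot> iR X"
    by (rule Cmp_reassoc1[OF b(16)]) (use r b(1-15) in simp_all)
  moreover have "q \<cdot> (l \<cdot> f) = Ide K Y \<cdot> f"
    by (rule Cmp_reassoc1[OF b(17)]) (use t b(1-15) fXY in simp_all)
  moreover have "p \<cdot> (l \<cdot> f) = Zer K Y W \<cdot> f"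
    by (rule Cmp_reassoc1[OF b(18)]) (use t b(1-15) fXY in simp_all)
  moreover have "q \<cdot> (k \<cdot> iR X) = Zer K W Y \<cdot> iR X"
    by (rule Cmp_reassoc1[OF b(19)]) (use r b(1-15) in simp_all)
  ultimately have e: "p \<cdot> (k \<cdot> iR X) = Ide K W \<cdot> iR X" "q \<cdot> (l \<cdot> f) = Ide K Y \<cdot> f"
    "p \<cdot> (l \<cdot> f) = Zer K Y W \<cdot> f" "q \<cdot> (k \<cdot> iR X) = Zer K W Y \<cdot> iR X" by blast+
  have pm: "p \<cdot> m = iR X" and qm: "q \<cdot> m = f"
    using t r b(1-15) fXY O by (simp_all add: m_def e)
  obtain n d where N: "(m, n, d) \<in> Tri K" using cone_ex[OF m(1)] by blast
  define Z where "Z = Cod K n"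
  note tn = TriD[OF N, unfolded m, folded Z_def] Z_def[symmetric]
  \<comment> \<open>The second map of a homotopy cartesian square is \<open>(z, -g')\<close>.\<close>
  define z where "z = n \<cdot> k"
  define g' where "g' = Neg K (n \<cdot> l)"
  have z: "z \<in> Arr K" "Dom K z = W" "Cod K z = Z" and g': "g' \<in> Arr K" "Dom K g' = Y" "Cod K g' = Z"
    using tn b(1-15) by (auto simp: z_def g'_def)
  have "n = n \<cdot> Add K (k \<cdot> p) (l \<cdot> q)" using b(20) tn by simp
  also have "\<dots> = Sub K (z \<cdot> p) (g' \<cdot> q)"
    using tn b(1-15) by (simp add: Sub_def z_def g'_def)
  finally have n: "n = Sub K (z \<cdot> p) (g' \<cdot> q)" .
  have "Add K (z \<cdot> iR X) (Neg K (g' \<cdot> f)) = n \<cdot> m"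
    using tn b(1-15) t r fXY by (simp add: m_def z_def g'_def)
  also have "\<dots> = Zer K X Z" using Tri_comp[OF N] tn m by simp
  finally have "Sub K (z \<cdot> iR X) (g' \<cdot> f) = Zer K X Z" by (simp add: Sub_def)
  then have sq: "z \<cdot> iR X = g' \<cdot> f"
    using Sub_eq_Zer_iff[of "z \<cdot> iR X" "g' \<cdot> f"] z g' t r fXY by simp
  have hc: "homotopy_cartesian K (iR X) f z g'"
    unfolding homotopy_cartesian_def r(8) fXY
  proof (intro conjI exI)
    show "is_biproduct K W Y B k l p q" by (rule B)
    show "(Add K (k \<cdot> iR X) (l \<cdot> f), Sub K (z \<cdot> p) (g' \<cdot> q), d) \<in> Tri K"
      using N unfolding m_def n .
  qed (use z g' t r sq fXY in simp_all)

  have "(p, Zer K W (Sus K Y), Neg K (SusA K l)) \<in> Tri K"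
    by (rule Tri_rotate[OF biproduct_Tri[OF is_biproduct_sym[OF B]]])
  moreover have "(p \<cdot> m, pR X, qR X) \<in> Tri K" unfolding pm by (rule R_Tri[OF O(1)])
  ultimately obtain u v where
    U: "(u, v, SusA K n \<cdot> Neg K (SusA K l)) \<in> Tri K"
    and mor: "tri_mor K (m, n, d) (p \<cdot> m, pR X, qR X) (Ide K (Dom K m), p, u)"
      "tri_mor K (p \<cdot> m, pR X, qR X) (p, Zer K W (Sus K Y), Neg K (SusA K l)) (m, Ide K (Cod K p), v)"
    using octahedral[OF N, of p "Zer K W (Sus K Y)" "Neg K (SusA K l)" "pR X" "qR X"] m b by auto
  have u: "u \<in> Arr K" "Dom K u = Z" "Cod K u = Cod K (pR X)" "u \<cdot> n = pR X \<cdot> p" "qR X \<cdot> u = d"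
  proof -
    have 1: "u \<in> Hom K (Dom K d) (Dom K (qR X))" "u \<cdot> n = pR X \<cdot> p" "SusA K (Ide K (Dom K m)) \<cdot> d = qR X \<cdot> u"
      using mor(1) by (simp_all only: tri_mor.simps)
    show "u \<in> Arr K" "Dom K u = Z" "Cod K u = Cod K (pR X)" using 1(1) tn r by simp_all
    show "u \<cdot> n = pR X \<cdot> p" by (rule 1(2))
    show "qR X \<cdot> u = d" unfolding 1(3)[symmetric] using tn m O by simp
  qed
  have v: "v \<in> Arr K" "Dom K v = Cod K (pR X)" "Cod K v = Sus K Y" "SusA K m \<cdot> qR X = Neg K (SusA K l) \<cdot> v"
  proof -
    have 1: "v \<in> Hom K (Dom K (qR X)) (Dom K (Neg K (SusA K l)))" "SusA K m \<cdot> qR X = Neg K (SusA K l) \<cdot> v"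
      using mor(2) by (simp_all only: tri_mor.simps)
    show "v \<in> Arr K" "Dom K v = Cod K (pR X)" "Cod K v = Sus K Y" using 1(1) r b(1-15) by simp_all
    show "SusA K m \<cdot> qR X = Neg K (SusA K l) \<cdot> v" by (rule 1(2))
  qed
  have uz: "u \<cdot> z = pR X"
  proof -
    have "u \<cdot> (n \<cdot> k) = pR X \<cdot> (p \<cdot> k)" by (rule Cmp_reassoc[OF u(4)]) (use u(1-3) tn r b(1-15) in simp_all)
    then show ?thesis unfolding z_def using b(16) r by simp
  qed
  have Fq: "SusA K f \<cdot> qR X = Neg K v"
  proof -
    have "SusA K q \<cdot> (SusA K m \<cdot> qR X) = SusA K (q \<cdot> m) \<cdot> qR X"
      using m b(1-15) r O by simp
    moreover have "SusA K q \<cdot> (SusA K m \<cdot> qR X) = Neg K (SusA K (q \<cdot> l) \<cdot> v)"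
      unfolding v(4) using v(1-3) b(1-15) by simp
    ultimately show ?thesis unfolding qm b(17) using v(1-3) O by simp
  qed
  have Sg: "SusA K n \<cdot> Neg K (SusA K l) = SusA K g'"
    using tn b(1-15) by (simp add: g'_def)
  \<comment> \<open>The last two maps of \<open>(u, v, \<Sigma>g')\<close> are negated, which turns it into a rotation of \<open>(g', u, -v)\<close>.\<close>
  have U': "(u, Neg K v, Neg K (SusA K g')) \<in> Tri K"
  proof -
    have "(u, Neg K (Ide K (Sus K Y)) \<cdot> v, Neg K (SusA K g')) \<in> Tri K"
      by (rule Tri_change_cone[OF U[unfolded Sg] is_iso_Neg_Ide]) (use v(1-3) u(1-3) g' O in simp_all)
    then show ?thesis using v(1-3) O by simp
  qed
  have G: "(g', u, Neg K v) \<in> Tri K"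
    using U' u(1-3) v(1-3) g' by (subst rotation) auto
  have trm: "tri_mor K (R X) (g', u, Neg K v) (f, z, Ide K (Cod K (pR X)))"
    unfolding R_eq[of X] tri_mor.simps
  proof (intro conjI)
    show "z \<cdot> iR X = g' \<cdot> f" by (rule sq)
    show "Ide K (Cod K (pR X)) \<cdot> pR X = u \<cdot> z" unfolding uz using r by simp
    show "SusA K f \<cdot> qR X = Neg K v \<cdot> Ide K (Cod K (pR X))" unfolding Fq using v(1-3) O by simp
  qed (use z g' t r fXY u(1-3) v(1-3) O in simp_all)

  have QT: "(q, Zer K Y (Sus K W), Neg K (SusA K k)) \<in> Tri K"
    by (rule Tri_rotate[OF biproduct_Tri[OF B]])
  moreover have "(q \<cdot> m, g, h) \<in> Tri K" unfolding qm by (rule T)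
  ultimately obtain c v' where
    C: "(c, v', SusA K n \<cdot> Neg K (SusA K k)) \<in> Tri K"
    and mor': "tri_mor K (m, n, d) (q \<cdot> m, g, h) (Ide K (Dom K m), q, c)"
      "tri_mor K (q \<cdot> m, g, h) (q, Zer K Y (Sus K W), Neg K (SusA K k)) (m, Ide K (Cod K q), v')"
    using octahedral[OF N, of q "Zer K Y (Sus K W)" "Neg K (SusA K k)" g h] m b by auto
  have c: "c \<in> Arr K" "Dom K c = Z" "Cod K c = Cod K g" "c \<cdot> n = g \<cdot> q" "h \<cdot> c = d"
  proof -
    have 1: "c \<in> Hom K (Dom K d) (Dom K h)" "c \<cdot> n = g \<cdot> q" "SusA K (Ide K (Dom K m)) \<cdot> d = h \<cdot> c"
      using mor'(1) by (simp_all only: tri_mor.simps)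
    show "c \<in> Arr K" "Dom K c = Z" "Cod K c = Cod K g" using 1(1) tn t by simp_all
    show "c \<cdot> n = g \<cdot> q" by (rule 1(2))
    show "h \<cdot> c = d" unfolding 1(3)[symmetric] using tn m O by simp
  qed
  have "v' \<in> Hom K (Dom K h) (Dom K (Neg K (SusA K k)))" using mor'(2) by (simp_all only: tri_mor.simps)
  then have "Cod K v' = Sus K W" using b(1-15) by simp
  then have cS: "c \<in> S" using S_I[OF C] R_P[OF O(1)] P_M O r(8) by simp
  have "c \<cdot> (n \<cdot> l) = g \<cdot> (q \<cdot> l)"
    by (rule Cmp_reassoc[OF c(4)]) (use c(1-3) tn t b(1-15) in simp_all)
  then have cl': "c \<cdot> (n \<cdot> l) = g" using b(17) t fXY by simp
  have "Neg K c \<cdot> g' = Neg K (Neg K (c \<cdot> (n \<cdot> l)))"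
    unfolding g'_def using c(1-3) tn b(1-15) by simp
  then have cg: "Neg K c \<cdot> g' = g" unfolding cl' using t by simp
  have "h \<cdot> Neg K c = Neg K (h \<cdot> c)" using c(1-3) t by simp
  also have "\<dots> = nq X \<cdot> u" unfolding c(5) u(5)[symmetric] nq_def using u(1-3) r by simp
  finally have hc': "h \<cdot> Neg K c = nq X \<cdot> u" .
  show ?thesis
    by (rule that[of z g' u "Neg K v" "Neg K c"])
      (use hc G trm cS Neg_S cg hc' c(1-3) g' in \<open>simp_all add: fXY\<close>)
qed

lemma standard_in_Tri_KE:
  assumes "f \<in> Arr K" "homotopy_cartesian K (iR (Dom K f)) f z g" "(g, h, w) \<in> Tri K"
    "tri_mor K (R (Dom K f)) (g, h, w) (f, z, Ide K (Cod K (pR (Dom K f))))"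
  shows "(cl f, cl g, cl h) \<in> Tri KE"
proof -
  note t = TriD[OF assms(3)]
  have g: "Dom K g = Cod K f" using assms(2) unfolding homotopy_cartesian_def by simp
  have h: "Cod K h = Cod K (pR (Dom K f))" using t assms(1,4) by (simp add: R_eq)
  have std: "(cl f, cl g, cl h) \<in> standard_triangles K E R"
  proof -
    have ex: "\<exists>i p q z w. R (Dom K f) = (i, p, q) \<and> homotopy_cartesian K i f z g \<and> (g, h, w) \<in> Tri K \<and>
        tri_mor K (i, p, q) (g, h, w) (f, z, Ide K (Cod K p))"
      using R_eq[of "Dom K f"] assms(2,3) assms(4)[unfolded R_eq[of "Dom K f"]] by blast
    show ?thesis
      unfolding standard_triangles_def stable_fctr_def
      by (rule CollectI, rule exI[of _ f], rule exI[of _ g], rule exI[of _ h], intro conjI)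
        (simp, rule assms(1), rule ex)
  qed
  have tri: "is_triangle KE (cl f, cl g, cl h)" using assms(1) t g h by simp
  have "tri_mor K (R (Dom K f)) (R (Dom K f)) (Ide K (Dom K f), Ide K (Cod K (iR (Dom K f))), Ide K (Cod K (pR (Dom K f))))"
    using assms(1) by (simp add: R_eq)
  then have S: "SusA KE (cl (Ide K (Dom K f))) = cl (Ide K (Cod K (pR (Dom K f))))"
    using assms(1) by (intro KE_SusA) auto
  have "tri_mor KE (cl f, cl g, cl h) (cl f, cl g, cl h) (cl (Ide K (Dom K f)), cl (Ide K (Cod K f)), cl (Ide K (Cod K g)))"
    using assms(1) t g h by (simp add: Hom_def KE_Cmp S)
  moreover have "is_iso KE (cl (Ide K (Dom K f)))" "is_iso KE (cl (Ide K (Cod K f)))" "is_iso KE (cl (Ide K (Cod K g)))"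
    using assms(1) t by (intro KE_iso_Ide; simp)+
  ultimately have "tri_isomorphic KE (cl f, cl g, cl h) (cl f, cl g, cl h)"
    unfolding tri_isomorphic_def by blast
  then show ?thesis
    using std tri unfolding relative_stable_def Tri_with_triangles by blast
qed

text \<open>\<open>f\<close> is the composite of \<open>(i\<^sub>X, f) : X \<rightarrow> X\<^sub>\<E> \<oplus> Y\<close>, whose cone is the pushout, with the projection
  to \<open>Y\<close>, whose fibre is \<open>X\<^sub>\<E>\<close>.\<close>

lemma pushout_cone_in_M:
  assumes f: "f \<in> Arr K" and hc: "homotopy_cartesian K (iR (Dom K f)) f z g" and Z: "Cod K g \<in> M"
  shows "f \<in> S"
proof -
  define i where "i = iR (Dom K f)"
  have i: "i \<in> Arr K" "Dom K i = Dom K f" "Cod K i \<in> M" using f R_P P_M by (auto simp: i_def)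
  obtain B k l p q d where B: "is_biproduct K (Cod K i) (Cod K f) B k l p q"
    and T: "(Add K (k \<cdot> i) (l \<cdot> f), Sub K (z \<cdot> p) (g \<cdot> q), d) \<in> Tri K"
    and zg: "z \<in> Arr K" "g \<in> Arr K" "Dom K z = Cod K i" "Dom K g = Cod K f" "Cod K z = Cod K g"
    using hc unfolding homotopy_cartesian_def i_def by metis
  note b = is_biproductD[OF B]
  have "Add K (k \<cdot> i) (l \<cdot> f) \<in> S" by (rule S_I[OF T]) (use zg b(1-15) Z in simp)
  moreover have "q \<in> S" using S_fibre[OF biproduct_Tri[OF B]] b(5) i(3) by simp
  ultimately have "q \<cdot> Add K (k \<cdot> i) (l \<cdot> f) \<in> S" by (intro S_Cmp) (use b(1-15) f i in auto)
  moreover have "q \<cdot> (l \<cdot> f) = Ide K (Cod K f) \<cdot> f" "q \<cdot> (k \<cdot> i) = Zer K (Cod K i) (Cod K f) \<cdot> i"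
    by (rule Cmp_reassoc1[OF b(17)] Cmp_reassoc1[OF b(19)]; use b(1-15) f i in simp)+
  then have "q \<cdot> Add K (k \<cdot> i) (l \<cdot> f) = f" using b(1-15) f i by simp
  ultimately show ?thesis by simp
qed

text \<open>A stable triangle on \<open>\<pi> s\<close> is only isomorphic to a standard triangle on some \<open>f\<close>, so that \<open>s\<close>
  and \<open>f\<close> are conjugate by stable isomorphisms. These become invertible in \<open>K // M\<close>, and saturation
  passes from \<open>f\<close> to \<open>s\<close>.\<close>

lemma cone_in_KE:
  assumes "s \<in> Arr K"
  shows "cl s \<in> cone_in KE M \<longleftrightarrow> s \<in> S"
proof
  assume s: "s \<in> S"
  obtain g h where T: "(s, g, h) \<in> Tri K" "Cod K g \<in> M" using S_E[OF s] .
  obtain z g' h' w c where st: "homotopy_cartesian K (iR (Dom K s)) s z g'" "(g', h', w) \<in> Tri K"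
    "tri_mor K (R (Dom K s)) (g', h', w) (s, z, Ide K (Cod K (pR (Dom K s))))"
    and c: "c \<in> S" "Dom K c = Cod K g'" "Cod K c = Cod K g" "c \<cdot> g' = g" "h \<cdot> c = nq (Dom K s) \<cdot> h'"
    by (rule standard_triangle_comparison[OF T(1)])
  obtain k l where kl: "(c, k, l) \<in> Tri K" "Cod K k \<in> M" using S_E[OF c(1)] .
  have "Cod K g' \<in> M" using J_Tri(2)[OF kl(1)] kl(2) T(2) c(2,3) by simp
  then have "Cod KE (cl g') \<in> M" using TriD[OF st(2)] by simp
  then show "cl s \<in> cone_in KE M"
    using standard_in_Tri_KE[OF assms st] unfolding cone_in_def by blast
next
  assume "cl s \<in> cone_in KE M"
  then obtain G H where GH: "(cl s, G, H) \<in> Tri KE" "Cod KE G \<in> M" unfolding cone_in_def by blast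
  obtain f g h z w A B C where T: "f \<in> Arr K" "homotopy_cartesian K (iR (Dom K f)) f z g"
    "(g, h, w) \<in> Tri K" "Cod K h = Cod K (pR (Dom K f))" "Dom K g = Cod K f"
    "is_iso KE A" "is_iso KE B" "is_iso KE C" "tri_mor KE (cl f, cl g, cl h) (cl s, G, H) (A, B, C)"
    "is_triangle KE (cl s, G, H)"
    using GH(1) by (rule Tri_KE_E)
  note t = TriD[OF T(3)]
  have "Dom KE C = Cod K g" "Cod KE C = Cod KE G" using T(9,10) t by (auto simp: Hom_def)
  then have "Cod K g \<in> M" using KE_iso_M[OF T(8)] GH(2) by simp
  then have fS: "f \<in> S" by (rule pushout_cone_in_M[OF T(1,2)])
  obtain a where a: "A = cl a" "a \<in> Arr K" using T(6) unfolding is_iso_def by (auto elim: KE_ArrE)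
  obtain b where b: "B = cl b" "b \<in> Arr K" using T(7) unfolding is_iso_def by (auto elim: KE_ArrE)
  have ab: "Dom K a = Dom K f" "Cod K a = Dom K s" "Dom K b = Cod K f" "Cod K b = Cod K s"
    "cl b \<cdot>\<^bsub>KE\<^esub> cl f = cl s \<cdot>\<^bsub>KE\<^esub> cl a"
    using T(9,10) a b assms T(1,5) t by (auto simp: Hom_def)
  then have "cl (b \<cdot> f) = cl (s \<cdot> a)" using a b assms T(1) by (simp add: KE_Cmp)
  then have "Q (b \<cdot> f) = Q (s \<cdot> a)" using a b ab(1-4) assms T(1) by (intro cl_eq_Q) auto
  then have e: "Q s \<odot> Q a = Q b \<odot> Q f" using a b ab(1-4) assms T(1) by (simp add: Q_Cmp)
  have iso: "is_iso V (Q a)" "is_iso V (Q b \<odot> Q f)"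
    using KE_iso_Q T(6,7) a b Q_iso[OF fS] T(1) ab(3) by (auto intro!: V.is_iso_Cmp)
  obtain a' where a': "a' \<in> Arr V" "Dom V a' = Dom K s" "Cod V a' = Dom K a" "Q a \<odot> a' = Ide V (Dom K s)"
    "is_iso V a'"
  proof -
    obtain a' where "a' \<in> Arr V" "Dom V a' = Cod V (Q a)" "Cod V a' = Dom V (Q a)"
      "a' \<odot> Q a = Ide V (Dom V (Q a))" "Q a \<odot> a' = Ide V (Cod V (Q a))"
      using iso(1) by (rule V.is_isoE)
    then show ?thesis using a ab(1,2) by (intro that[of a'] V.is_isoI[where g = "Q a"]) simp_all
  qed
  have "Q s = Q s \<odot> (Q a \<odot> a')" using a' assms by simp
  also have "\<dots> = (Q b \<odot> Q f) \<odot> a'" unfolding e[symmetric] using a'(1-3) a ab(1,2) assms by simp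
  also have "is_iso V \<dots>" by (rule V.is_iso_Cmp[OF a'(5) iso(2)]) (use a'(3) ab b T(1) in simp)
  finally have "is_iso V (Q s)" .
  then show "s \<in> S" by (rule saturated[OF assms])
qed

end

section \<open>The isomorphism of Verdier quotients\<close>

context frobenius_stable
begin

abbreviation D :: "('o, ('m set \<times> 'm set) set) tricat" where "D \<equiv> verdier KE M"

definition roof_map :: "('m \<times> 'm) set \<Rightarrow> ('m set \<times> 'm set) set" where
  "roof_map c = (\<lambda>(s, f). (cl s, cl f)) ` c"

lemma roofs_KE_iff:
  "(C, F) \<in> roofs KE M \<longleftrightarrow> (\<exists>s f. (s, f) \<in> roofs K M \<and> C = cl s \<and> F = cl f)"
proof
  assume "(C, F) \<in> roofs KE M"
  then have C: "C \<in> cone_in KE M" "C \<in> Arr KE" "F \<in> Arr KE" "Dom KE C = Dom KE F"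
    unfolding roofs_def by auto
  obtain s where s: "s \<in> Arr K" "C = cl s" using C(2) by (rule KE_ArrE)
  obtain f where f: "f \<in> Arr K" "F = cl f" using C(3) by (rule KE_ArrE)
  show "\<exists>s f. (s, f) \<in> roofs K M \<and> C = cl s \<and> F = cl f"
    using C(1,4) s f by (intro exI[of _ s] exI[of _ f]) (simp add: roofs_iff cone_in_KE)
next
  assume "\<exists>s f. (s, f) \<in> roofs K M \<and> C = cl s \<and> F = cl f"
  then obtain s f where "(s, f) \<in> roofs K M" "C = cl s" "F = cl f" by blast
  then show "(C, F) \<in> roofs KE M" by (simp add: roofs_iff roofs_def cone_in_KE)
qed

text \<open>A refinement of stable roofs makes two pairs of arrows stably equal; precomposing with one arrow
  of \<open>S\<close> for each pair makes them equal.\<close>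

lemma roof_rel_KE_iff:
  assumes sf: "(s, f) \<in> roofs K M" and sf': "(s', f') \<in> roofs K M"
  shows "((cl s, cl f), (cl s', cl f')) \<in> roof_rel KE M \<longleftrightarrow> ((s, f), (s', f')) \<in> roof_rel K M"
proof
  assume "((s, f), (s', f')) \<in> roof_rel K M"
  then obtain a a' where a': "refinement s f s' f' a a'" by (rule roof_relE)
  note a = refinementD[OF a']
  have 1: "cl s \<cdot>\<^bsub>KE\<^esub> cl a = cl s' \<cdot>\<^bsub>KE\<^esub> cl a'" "cl f \<cdot>\<^bsub>KE\<^esub> cl a = cl f' \<cdot>\<^bsub>KE\<^esub> cl a'"
    "cl s \<cdot>\<^bsub>KE\<^esub> cl a \<in> cone_in KE M"
    using a(1-11) by (simp_all add: KE_Cmp a(12,13) cone_in_KE a(15))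
  have 2: "cl a \<in> Arr KE" "cl a' \<in> Arr KE" "Dom KE (cl a) = Dom KE (cl a')"
    "Cod KE (cl a) = Dom KE (cl s)" "Cod KE (cl a') = Dom KE (cl s')" using a(1-11) by simp_all
  have 3: "(cl s, cl f) \<in> roofs KE M" "(cl s', cl f') \<in> roofs KE M"
    unfolding roofs_KE_iff using sf sf' by blast+
  show "((cl s, cl f), (cl s', cl f')) \<in> roof_rel KE M"
    unfolding roof_rel_def using 1 2 3 by blast
next
  assume "((cl s, cl f), (cl s', cl f')) \<in> roof_rel KE M"
  then obtain A A' where A: "A \<in> Arr KE" "A' \<in> Arr KE" "Dom KE A = Dom KE A'" "Cod KE A = Dom KE (cl s)"
    "Cod KE A' = Dom KE (cl s')" "cl s \<cdot>\<^bsub>KE\<^esub> A = cl s' \<cdot>\<^bsub>KE\<^esub> A'" "cl f \<cdot>\<^bsub>KE\<^esub> A = cl f' \<cdot>\<^bsub>KE\<^esub> A'"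
    "cl s \<cdot>\<^bsub>KE\<^esub> A \<in> cone_in KE M" unfolding roof_rel_def by blast
  obtain a where a: "a \<in> Arr K" "A = cl a" using A(1) by (rule KE_ArrE)
  obtain a' where a': "a' \<in> Arr K" "A' = cl a'" using A(2) by (rule KE_ArrE)
  have sf1: "s \<in> S" "f \<in> Arr K" "Dom K f = Dom K s" "s' \<in> S" "f' \<in> Arr K" "Dom K f' = Dom K s'"
    using sf sf' by (auto simp: roofs_iff)
  have d: "Dom K a = Dom K a'" "Cod K a = Dom K s" "Cod K a' = Dom K s'"
    using A(3-5) a a' sf1 by simp_all
  note all = sf1 a(1) a'(1) d
  have e: "cl (s \<cdot> a) = cl (s' \<cdot> a')" "cl (f \<cdot> a) = cl (f' \<cdot> a')"
    using A(6,7) all by (simp_all add: a(2) a'(2) KE_Cmp)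
  have sa: "s \<cdot> a \<in> S" using A(8) all cone_in_KE[of "s \<cdot> a"] by (simp add: a(2) KE_Cmp)
  obtain w where w: "w \<in> S" "Cod K w = Dom K (s \<cdot> a)" "(s \<cdot> a) \<cdot> w = (s' \<cdot> a') \<cdot> w"
    by (rule cl_agree[OF e(1)]) (use all in simp_all)
  have "cl ((f \<cdot> a) \<cdot> w) = cl (f \<cdot> a) \<cdot>\<^bsub>KE\<^esub> cl w" using all w(1,2) by (simp add: KE_Cmp)
  also have "\<dots> = cl ((f' \<cdot> a') \<cdot> w)" unfolding e(2) using all w(1,2) by (simp add: KE_Cmp)
  finally have e': "cl ((f \<cdot> a) \<cdot> w) = cl ((f' \<cdot> a') \<cdot> w)" .
  obtain v where v: "v \<in> S" "Cod K v = Dom K ((f \<cdot> a) \<cdot> w)" "((f \<cdot> a) \<cdot> w) \<cdot> v = ((f' \<cdot> a') \<cdot> w) \<cdot> v"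
    by (rule cl_agree[OF e']) (use all w(1,2) in simp_all)
  have v2: "Cod K v = Dom K w" using v(2) all w(1,2) by simp
  have "((s \<cdot> a) \<cdot> w) \<cdot> v = ((s' \<cdot> a') \<cdot> w) \<cdot> v" by (simp only: w(3))
  then have 1: "s \<cdot> (a \<cdot> (w \<cdot> v)) = s' \<cdot> (a' \<cdot> (w \<cdot> v))" using all w(1,2) v(1) v2 by simp
  have 2: "f \<cdot> (a \<cdot> (w \<cdot> v)) = f' \<cdot> (a' \<cdot> (w \<cdot> v))" using v(3) all w(1,2) v(1) v2 by simp
  have "(s \<cdot> a) \<cdot> (w \<cdot> v) \<in> S"
    by (rule S_Cmp[OF S_Cmp[OF v(1) w(1) v2] sa]) (use all w(1,2) v(1) v2 in simp)
  then have 3: "s \<cdot> (a \<cdot> (w \<cdot> v)) \<in> S" using all w(1,2) v(1) v2 by simp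
  show "((s, f), (s', f')) \<in> roof_rel K M"
    by (rule roof_relI[OF sf sf', of "a \<cdot> (w \<cdot> v)" "a' \<cdot> (w \<cdot> v)"])
      (use all w(1,2) v(1) v2 1 2 3 in simp_all)
qed

lemma roof_map_roof:
  assumes "(s, f) \<in> roofs K M"
  shows "roof_map (roof K M s f) = roof KE M (cl s) (cl f)"
proof (rule equalityI; rule subsetI)
  fix x assume "x \<in> roof_map (roof K M s f)"
  then obtain z where z: "x = (case z of (s, f) \<Rightarrow> (cl s, cl f))" "z \<in> roof K M s f"
    unfolding roof_map_def by (rule imageE)
  obtain s' f' where "z = (s', f')" by (rule prod.exhaust)
  with z have x: "x = (cl s', cl f')" "(s', f') \<in> roof K M s f" by simp_all
  then have rel: "((s, f), (s', f')) \<in> roof_rel K M" by (simp add: mem_roof_iff)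
  then have "((cl s, cl f), (cl s', cl f')) \<in> roof_rel KE M"
    using roof_rel_KE_iff roof_rel_roofs by blast
  then show "x \<in> roof KE M (cl s) (cl f)" unfolding roof_def x(1) by blast
next
  fix x assume "x \<in> roof KE M (cl s) (cl f)"
  then have rel: "((cl s, cl f), x) \<in> roof_rel KE M" unfolding roof_def by blast
  then have "x \<in> roofs KE M" unfolding roof_rel_def by auto
  then obtain s' f' where x: "(s', f') \<in> roofs K M" "x = (cl s', cl f')"
    using roofs_KE_iff by (metis surj_pair)
  then have "(s', f') \<in> roof K M s f" using rel roof_rel_KE_iff assms mem_roof_iff by blast
  then show "x \<in> roof_map (roof K M s f)" unfolding roof_map_def x(2) by force
qed

lemma roof_map_memI: "(s, f) \<in> roofs K M \<Longrightarrow> (cl s, cl f) \<in> roof_map (roof K M s f)"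
  unfolding roof_map_def using roof_self by force

lemma roof_map_memE:
  assumes "(C, F) \<in> roof_map c" "c \<in> Arr V"
  obtains s f where "(s, f) \<in> roofs K M" "c = roof K M s f" "C = cl s" "F = cl f"
proof -
  obtain s0 f0 where c: "(s0, f0) \<in> roofs K M" "c = roof K M s0 f0" using assms(2) by (rule V_ArrE)
  obtain z where z: "z \<in> c" "(C, F) = (case z of (s, f) \<Rightarrow> (cl s, cl f))"
    using assms(1) unfolding roof_map_def by (rule imageE)
  obtain s f where sf: "z = (s, f)" by (rule prod.exhaust)
  have mem: "(s, f) \<in> roof K M s0 f0" using z(1) unfolding sf c(2) .
  show ?thesis
  proof (rule that)
    show "(s, f) \<in> roofs K M" using mem mem_roof_iff roof_rel_roofs by blast
    show "c = roof K M s f" unfolding c(2) by (rule mem_roof_eq[OF mem, symmetric])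
  qed (use z(2) sf in simp_all)
qed

lemma roof_map_inj: "inj_on roof_map (Arr V)"
proof (rule inj_onI)
  fix c d assume "c \<in> Arr V" "d \<in> Arr V" and eq: "roof_map c = roof_map d"
  then obtain s f r g where c: "(s, f) \<in> roofs K M" "c = roof K M s f"
    and d: "(r, g) \<in> roofs K M" "d = roof K M r g" by (metis V_ArrE)
  have "(cl r, cl g) \<in> roof_map d" unfolding d(2) by (rule roof_map_memI[OF d(1)])
  then have "(cl r, cl g) \<in> roof KE M (cl s) (cl f)" using eq c roof_map_roof by simp
  then have "((s, f), (r, g)) \<in> roof_rel K M"
    unfolding roof_def using roof_rel_KE_iff[OF c(1) d(1)] by blast
  then show "c = d" using roof_eq_iff c d by blast
qed

lemma D_Arr: "Arr D = roof_map ` Arr V"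
proof (rule equalityI; rule subsetI)
  fix x assume "x \<in> Arr D"
  then obtain C F where CF: "(C, F) \<in> roofs KE M" "x = roof KE M C F"
    unfolding verdier_simps(2) roof_def by (auto elim!: quotientE)
  then obtain s f where "(s, f) \<in> roofs K M" "C = cl s" "F = cl f" unfolding roofs_KE_iff by blast
  then have "x = roof_map (roof K M s f)" "roof K M s f \<in> Arr V" using CF roof_map_roof by auto
  then show "x \<in> roof_map ` Arr V" by blast
next
  fix x assume "x \<in> roof_map ` Arr V"
  then obtain s f where "(s, f) \<in> roofs K M" "x = roof_map (roof K M s f)" by (auto elim!: V_ArrE)
  then have "x = roof KE M (cl s) (cl f)" "(cl s, cl f) \<in> roofs KE M"
    using roof_map_roof roofs_KE_iff by auto
  then show "x \<in> Arr D" unfolding verdier_simps(2) roof_def by (simp add: quotientI)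
qed

lemma D_ends [simp]:
  assumes "c \<in> Arr V"
  shows "roof_map c \<in> Arr D" "Dom D (roof_map c) = Dom V c" "Cod D (roof_map c) = Cod V c"
proof -
  show "roof_map c \<in> Arr D" using assms D_Arr by blast
  obtain s f where c: "(s, f) \<in> roofs K M" "c = roof K M s f" using assms by (rule V_ArrE)
  have self: "(cl s, cl f) \<in> roof_map c" unfolding c(2) by (rule roof_map_memI[OF c(1)])
  have *: "\<exists>s' f'. C = cl s' \<and> F = cl f' \<and> s' \<in> Arr K \<and> f' \<in> Arr K \<and> Cod K s' = Cod K s \<and> Cod K f' = Cod K f"
    if mem: "(C, F) \<in> roof_map c" for C F
  proof -
    obtain s' f' where sf: "(s', f') \<in> roofs K M" "c = roof K M s' f'" "C = cl s'" "F = cl f'"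
      using mem assms by (rule roof_map_memE)
    have "Cod K s' = Cod K s" "Cod K f' = Cod K f"
      using roof_Arr(2,3)[OF sf(1)] roof_Arr(2,3)[OF c(1)] sf(2) c(2) by simp_all
    moreover have "s' \<in> Arr K" "f' \<in> Arr K" using sf(1) by (auto simp: roofs_iff)
    ultimately show ?thesis using sf(3,4) by blast
  qed
  have sA: "s \<in> Arr K" "f \<in> Arr K" using c(1) by (auto simp: roofs_iff)
  have "the_elem {Cod KE s' |s' f'. (s', f') \<in> roof_map c} = Cod K s"
  proof (rule the_elem_eqI)
    show "Cod K s \<in> {Cod KE s' |s' f'. (s', f') \<in> roof_map c}" using self KE_cl(3)[OF sA(1)] by (metis (mono_tags, lifting) mem_Collect_eq)
    fix y assume "y \<in> {Cod KE s' |s' f'. (s', f') \<in> roof_map c}"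
    then show "y = Cod K s" using * by fastforce
  qed
  then show "Dom D (roof_map c) = Dom V c" using c by (simp add: verdier_simps(6)[of KE])
  have "the_elem {Cod KE f' |s' f'. (s', f') \<in> roof_map c} = Cod K f"
  proof (rule the_elem_eqI)
    show "Cod K f \<in> {Cod KE f' |s' f'. (s', f') \<in> roof_map c}" using self KE_cl(3)[OF sA(2)] by (metis (mono_tags, lifting) mem_Collect_eq)
    fix y assume "y \<in> {Cod KE f' |s' f'. (s', f') \<in> roof_map c}"
    then show "y = Cod K f" using * by fastforce
  qed
  then show "Cod D (roof_map c) = Cod V c" using c by (simp add: verdier_simps(7)[of KE])
qed

lemma D_Ide: "X \<in> Obj K \<Longrightarrow> Ide D X = roof_map (Ide V X)"
  by (simp add: verdier_simps(3) roof_map_roof)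

lemma D_Obj [simp]: "Obj D = Obj K" and D_Sus [simp]: "Sus D X = Cod K (pR X)"
  by (simp_all add: verdier_simps(1,5)[of KE])

text \<open>A square that commutes stably commutes after precomposition with an arrow of \<open>S\<close>, and then
  computes the composite in \<open>V\<close>.\<close>

lemma D_Cmp:
  assumes "c \<in> Arr V" "d \<in> Arr V" "Cod V c = Dom V d"
  shows "roof_map d \<cdot>\<^bsub>D\<^esub> roof_map c = roof_map (d \<odot> c)"
proof -
  obtain s f where c: "(s, f) \<in> roofs K M" "c = roof K M s f" using assms(1) by (rule V_ArrE)
  obtain r g where d: "(r, g) \<in> roofs K M" "d = roof K M r g" using assms(2) by (rule V_ArrE)
  have fr: "Cod K f = Cod K r" using assms(3) c d by simp
  show ?thesis
    unfolding verdier_simps(8)[of KE]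
  proof (rule the_elem_eqI, goal_cases)
    case 1
    note sf = c(1)[unfolded roofs_iff] d(1)[unfolded roofs_iff]
    obtain r' f' where sq: "r' \<in> S" "f' \<in> Arr K" "Cod K r' = Dom K f" "Dom K f' = Dom K r'"
      "Cod K f' = Dom K r" "f \<cdot> r' = r \<cdot> f'" using Ore[of f r] sf fr by auto
    have "(s \<cdot> r', g \<cdot> f') \<in> roofs K M" using sf sq(1-5) by (simp add: roofs_iff S_Cmp)
    moreover have "d \<odot> c = roof K M (s \<cdot> r') (g \<cdot> f')"
      unfolding c(2) d(2) by (rule Cmp_roof[OF c(1) d(1) sq(1,2,4,3,5,6)])
    ultimately have "roof_map (d \<odot> c) = roof KE M (cl s \<cdot>\<^bsub>KE\<^esub> cl r') (cl g \<cdot>\<^bsub>KE\<^esub> cl f')"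
      using roof_map_roof sf sq(1-5) by (simp add: KE_Cmp)
    moreover have "(cl s, cl f) \<in> roof_map c" "(cl r, cl g) \<in> roof_map d"
      unfolding c(2) d(2) by (rule roof_map_memI[OF c(1)] roof_map_memI[OF d(1)])+
    moreover have "cl r' \<in> cone_in KE M" "cl r' \<in> Arr KE" "cl f' \<in> Arr KE" "Dom KE (cl r') = Dom KE (cl f')"
      "Cod KE (cl r') = Dom KE (cl f)" "Cod KE (cl f') = Dom KE (cl r)"
      using sf sq(1-5) by (simp_all add: cone_in_KE)
    moreover have "cl f \<cdot>\<^bsub>KE\<^esub> cl r' = cl r \<cdot>\<^bsub>KE\<^esub> cl f'"
      using sf sq(1-5) by (simp add: KE_Cmp sq(6))
    ultimately show ?case by blast
  next
    case (2 y)
    then obtain A F B G T T' where y: "y = roof KE M (A \<cdot>\<^bsub>KE\<^esub> T) (G \<cdot>\<^bsub>KE\<^esub> T')"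
      and 2: "(A, F) \<in> roof_map c" "(B, G) \<in> roof_map d" "T \<in> cone_in KE M" "T \<in> Arr KE" "T' \<in> Arr KE"
        "Dom KE T = Dom KE T'" "Cod KE T = Dom KE F" "Cod KE T' = Dom KE B" "F \<cdot>\<^bsub>KE\<^esub> T = B \<cdot>\<^bsub>KE\<^esub> T'"
      by blast
    obtain s f where sf: "(s, f) \<in> roofs K M" "c = roof K M s f" "A = cl s" "F = cl f"
      using 2(1) assms(1) by (rule roof_map_memE)
    obtain r g where rg: "(r, g) \<in> roofs K M" "d = roof K M r g" "B = cl r" "G = cl g"
      using 2(2) assms(2) by (rule roof_map_memE)
    obtain t where t: "t \<in> Arr K" "T = cl t" using 2(4) by (rule KE_ArrE)
    obtain t' where t': "t' \<in> Arr K" "T' = cl t'" using 2(5) by (rule KE_ArrE)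
    note u = sf(1)[unfolded roofs_iff] rg(1)[unfolded roofs_iff]
    have tS: "t \<in> S" using 2(3) t cone_in_KE by simp
    have e: "Dom K t' = Dom K t" "Cod K t = Dom K s" "Cod K t' = Dom K r"
      using 2(6-8) u t t' by (simp_all add: sf(4) rg(3))
    note all = u t(1) t'(1) tS e
    have "cl (f \<cdot> t) = cl (r \<cdot> t')" using 2(9) all by (simp add: sf(4) rg(3) t(2) t'(2) KE_Cmp)
    then obtain w where w: "w \<in> S" "Cod K w = Dom K (f \<cdot> t)" "(f \<cdot> t) \<cdot> w = (r \<cdot> t') \<cdot> w"
      by (rule cl_agree) (use all in simp_all)
    have w2: "Cod K w = Dom K t" using w(2) all by simp
    have sq: "f \<cdot> (t \<cdot> w) = r \<cdot> (t' \<cdot> w)" using w(3) w(1) w2 all by simp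
    have "d \<odot> c = roof K M (s \<cdot> (t \<cdot> w)) (g \<cdot> (t' \<cdot> w))"
      unfolding sf(2) rg(2)
      by (rule Cmp_roof[OF sf(1) rg(1)]) (use all w(1) w2 sq in \<open>simp_all add: S_Cmp\<close>)
    also have "\<dots> = roof K M ((s \<cdot> t) \<cdot> w) ((g \<cdot> t') \<cdot> w)" using all w(1) w2 by simp
    also have "\<dots> = roof K M (s \<cdot> t) (g \<cdot> t')"
      by (rule roof_refine) (use all w(1) w2 S_Cmp[of w "s \<cdot> t"] in \<open>simp_all add: roofs_iff S_Cmp\<close>)
    finally have dc: "d \<odot> c = roof K M (s \<cdot> t) (g \<cdot> t')" .
    have "roof_map (d \<odot> c) = roof KE M (cl (s \<cdot> t)) (cl (g \<cdot> t'))"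
      unfolding dc by (rule roof_map_roof) (use all in \<open>simp add: roofs_iff S_Cmp\<close>)
    then show ?case unfolding y sf(3) rg(4) t(2) t'(2) using all by (simp add: KE_Cmp)
  qed
qed

abbreviation roof_fctr :: "('o, ('m \<times> 'm) set, 'o, ('m set \<times> 'm set) set) fctr" where
  "roof_fctr \<equiv> \<lparr>FO = id, FA = roof_map\<rparr>"

lemma D_category: "category D"
  and roof_map_equivalence: "is_equivalence V D roof_fctr"
proof -
  note * = equivalence_transport[of V D roof_map, OF category_V _ D_Arr roof_map_inj]
  show "category D" by (rule *) (auto simp: D_Ide D_Cmp)
  show "is_equivalence V D roof_fctr" by (rule *) (auto simp: D_Ide D_Cmp)
qed

lemma roof_map_iso:
  assumes "is_iso V c"
  shows "is_iso D (roof_map c)"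
proof -
  obtain d where d: "c \<in> Arr V" "d \<in> Arr V" "Dom V d = Cod V c" "Cod V d = Dom V c"
    "d \<odot> c = Ide V (Dom V c)" "c \<odot> d = Ide V (Cod V c)" using assms by (rule V.is_isoE)
  have O: "Dom V c \<in> Obj K" "Cod V c \<in> Obj K" using V.Dom_Obj[OF d(1)] V.Cod_Obj[OF d(1)] by simp_all
  show ?thesis
    by (rule category.is_isoI[OF D_category, of _ "roof_map d"]) (use d O in \<open>simp_all add: D_Cmp D_Ide\<close>)
qed

text \<open>Two stable fractions with the same denominator lift to fractions whose denominators are stably
  equal, and which therefore acquire a common denominator after refinement.\<close>

lemma D_Add:
  assumes "c \<in> Hom V X Y" "d \<in> Hom V X Y"
  shows "Add D (roof_map c) (roof_map d) = roof_map (Add V c d)"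
proof -
  obtain s f g where sfg: "(s, f) \<in> roofs K M" "(s, g) \<in> roofs K M" "c = roof K M s f" "d = roof K M s g"
    "Cod K s = X" "Cod K f = Y" "Cod K g = Y" using common_denominator[OF assms] .
  note u = sfg(1)[unfolded roofs_iff] sfg(2)[unfolded roofs_iff] sfg(6,7)
  show ?thesis
    unfolding verdier_simps(9)[of KE]
  proof (rule the_elem_eqI, goal_cases)
    case 1
    have "roof_map (Add V c d) = roof KE M (cl s) (Add KE (cl f) (cl g))"
      unfolding sfg(3,4) using u by (simp add: Add_roof[OF sfg(1,2)] roof_map_roof roofs_iff KE_Add)
    moreover have "(cl s, cl f) \<in> roof_map c" "(cl s, cl g) \<in> roof_map d"
      unfolding sfg(3,4) by (rule roof_map_memI[OF sfg(1)] roof_map_memI[OF sfg(2)])+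
    ultimately show ?case by blast
  next
    case (2 y)
    then obtain A F G where y: "y = roof KE M A (Add KE F G)" and 2: "(A, F) \<in> roof_map c" "(A, G) \<in> roof_map d"
      by blast
    have cd: "c \<in> Arr V" "d \<in> Arr V" using assms by (simp_all add: Hom_def)
    obtain s1 f1 where c: "(s1, f1) \<in> roofs K M" "c = roof K M s1 f1" "A = cl s1" "F = cl f1"
      using 2(1) cd(1) by (rule roof_map_memE)
    obtain s2 g1 where d: "(s2, g1) \<in> roofs K M" "d = roof K M s2 g1" "A = cl s2" "G = cl g1"
      using 2(2) cd(2) by (rule roof_map_memE)
    note v = c(1)[unfolded roofs_iff] d(1)[unfolded roofs_iff]
    have ss: "cl s1 = cl s2" using c(3) d(3) by simp
    have s12: "Dom K s2 = Dom K s1" "Cod K s2 = Cod K s1" using cl_eqD(1,2)[OF ss] v by simp_all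
    have fY: "Cod K f1 = Y" "Cod K g1 = Y" using roof_Arr(3)[OF c(1)] roof_Arr(3)[OF d(1)] assms c(2) d(2)
      by (simp_all add: Hom_def)
    obtain w where w: "w \<in> S" "Cod K w = Dom K s1" "s1 \<cdot> w = s2 \<cdot> w" by (rule cl_agree[OF ss]) (use v in simp_all)
    note all = v s12 fY w(1,2)
    have w': "s1 \<cdot> w \<in> S" by (rule S_Cmp) (use all in simp_all)
    have c': "c = roof K M (s1 \<cdot> w) (f1 \<cdot> w)"
      unfolding c(2) by (rule roof_refine[symmetric, OF c(1)]) (use all w' in simp_all)
    have d': "d = roof K M (s1 \<cdot> w) (g1 \<cdot> w)"
      unfolding d(2) w(3) by (rule roof_refine[symmetric, OF d(1)]) (use all w' w(3) in simp_all)
    have rf: "(s1 \<cdot> w, f1 \<cdot> w) \<in> roofs K M" "(s1 \<cdot> w, g1 \<cdot> w) \<in> roofs K M" "(s1, Add K f1 g1) \<in> roofs K M"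
      using all w' by (simp_all add: roofs_iff)
    have "Add V c d = roof K M (s1 \<cdot> w) (Add K (f1 \<cdot> w) (g1 \<cdot> w))"
      unfolding c' d' by (rule Add_roof[OF rf(1,2)]) (use all in simp)
    also have "\<dots> = roof K M (s1 \<cdot> w) (Add K f1 g1 \<cdot> w)" using all by simp
    also have "\<dots> = roof K M s1 (Add K f1 g1)" by (rule roof_refine[OF rf(3)]) (use all w' in simp_all)
    finally have "roof_map (Add V c d) = roof KE M (cl s1) (cl (Add K f1 g1))"
      using roof_map_roof[OF rf(3)] by simp
    then show ?case unfolding y c(3,4) d(4) using all by (simp add: KE_Add)
  qed
qed

section \<open>Exactness\<close>

definition nq_inv :: "'o \<Rightarrow> ('m \<times> 'm) set" where
  "nq_inv X = roof K M (nq X) (Ide K (Cod K (pR X)))"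

lemma nq_inv:
  assumes X: "X \<in> Obj K"
  shows "nq_inv X \<in> Arr V" "Dom V (nq_inv X) = Sus K X" "Cod V (nq_inv X) = Cod K (pR X)"
    "nq_inv X \<odot> Q (nq X) = Ide V (Cod K (pR X))" "Q (nq X) \<odot> nq_inv X = Ide V (Sus K X)"
    "is_iso V (nq_inv X)"
proof -
  have "(nq X, Ide K (Cod K (pR X))) \<in> roofs K M" using X by (simp add: roofs_iff)
  then show 1: "nq_inv X \<in> Arr V" "Dom V (nq_inv X) = Sus K X" "Cod V (nq_inv X) = Cod K (pR X)"
    using X by (simp_all add: nq_inv_def)
  show 2: "nq_inv X \<odot> Q (nq X) = Ide V (Cod K (pR X))" "Q (nq X) \<odot> nq_inv X = Ide V (Sus K X)"
    using roof_Q_inv[OF nq_S[OF X]] X by (simp_all add: nq_inv_def)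
  show "is_iso V (nq_inv X)" by (rule V.is_isoI[of _ "Q (nq X)"]) (use 1 2 X in simp_all)
qed

text \<open>As \<open>q\<close> is natural for morphisms of the chosen triangles, the arrows \<open>-q\<^sub>X\<close> of \<open>S\<close> conjugate the
  stable suspension into the suspension of \<open>K\<close>. In particular \<open>s'\<close> becomes invertible together with
  \<open>\<Sigma>s\<close>, and lies in \<open>S\<close> by saturation.\<close>

lemma lift_roof:
  assumes sf: "(s, f) \<in> roofs K M"
    and s': "tri_mor K (R (Dom K s)) (R (Cod K s)) (s, e, s')"
    and f': "tri_mor K (R (Dom K f)) (R (Cod K f)) (f, e', f')"
  shows "(s', f') \<in> roofs K M"
    "Q (nq (Cod K f)) \<odot> roof K M s' f' = SusA V (roof K M s f) \<odot> Q (nq (Cod K s))"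
proof -
  note u = sf[unfolded roofs_iff]
  define A where "A = Dom K s"
  define X where "X = Cod K s"
  define Y where "Y = Cod K f"
  have a: "Dom K s = A" "Dom K f = A" "Cod K s = X" "Cod K f = Y" "s \<in> Arr K" "f \<in> Arr K"
    using u by (simp_all add: A_def X_def Y_def)
  have O: "A \<in> Obj K" "X \<in> Obj K" "Y \<in> Obj K" using a Dom_Obj Cod_Obj by metis+
  note ls = lift_simps[OF s' a(5), unfolded a] and lf = lift_simps[OF f' a(6), unfolded a]
  have iso: "is_iso V (Q (nq Z))" if "Z \<in> Obj K" for Z using that by (intro Q_iso nq_S)
  have "Q (nq X) \<odot> Q s' = Q (SusA K s \<cdot> nq A)" using ls O by (simp flip: Q_Cmp)
  also have "\<dots> = Q (SusA K s) \<odot> Q (nq A)" by (rule Q_Cmp) (use a O in simp_all)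
  finally have es: "Q (nq X) \<odot> Q s' = Q (SusA K s) \<odot> Q (nq A)" .
  have "Q (nq Y) \<odot> Q f' = Q (SusA K f \<cdot> nq A)" using lf O by (simp flip: Q_Cmp)
  also have "\<dots> = Q (SusA K f) \<odot> Q (nq A)" by (rule Q_Cmp) (use a O in simp_all)
  finally have ef: "Q (nq Y) \<odot> Q f' = Q (SusA K f) \<odot> Q (nq A)" .
  note v = nq_inv[OF O(2)]
  have Siso: "is_iso V (Q (SusA K s))" using u by (intro Q_iso) simp
  have "Q s' = nq_inv X \<odot> (Q (nq X) \<odot> Q s')"
    using V.Cmp_reassoc1[OF v(4), of "Q s'"] v(1-3) ls(1-3) O by simp
  also have "\<dots> = nq_inv X \<odot> (Q (SusA K s) \<odot> Q (nq A))" by (simp only: es)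
  also have "is_iso V \<dots>"
    by (intro V.is_iso_Cmp v(6) Siso iso O) (use a O v(1-3) in simp_all)
  finally have "is_iso V (Q s')" .
  then have s'S: "s' \<in> S" by (rule saturated[OF ls(1)])
  show rf: "(s', f') \<in> roofs K M" using s'S ls lf by (simp add: roofs_iff)
  have c: "roof K M s f \<in> Arr V" "Dom V (roof K M s f) = X" "Cod V (roof K M s f) = Y"
    using sf a by simp_all
  have fr: "roof K M s' f' \<odot> Q s' = Q f'" by (rule roof_fraction[OF rf])
  have Sfr: "SusA V (roof K M s f) \<odot> Q (SusA K s) = Q (SusA K f)"
  proof -
    have "SusA V (roof K M s f) \<odot> SusA V (Q s) = SusA V (roof K M s f \<odot> Q s)"
      by (rule SusA_V_Cmp[symmetric]) (use a c in simp_all)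
    then show ?thesis unfolding roof_fraction[OF sf] using a by (simp add: SusA_Q)
  qed
  have "(Q (nq Y) \<odot> roof K M s' f') \<odot> Q s' = Q (nq Y) \<odot> (roof K M s' f' \<odot> Q s')"
    using rf ls(1-3) lf(1-3) O by simp
  also have "\<dots> = Q (SusA K f) \<odot> Q (nq A)" unfolding fr by (rule ef)
  also have "\<dots> = SusA V (roof K M s f) \<odot> (Q (SusA K s) \<odot> Q (nq A))"
    by (rule V.Cmp_reassoc1[OF Sfr, symmetric]) (use a c O in simp_all)
  also have "\<dots> = SusA V (roof K M s f) \<odot> (Q (nq X) \<odot> Q s')" unfolding es ..
  also have "\<dots> = (SusA V (roof K M s f) \<odot> Q (nq X)) \<odot> Q s'"
    using ls(1-3) O c by simp
  finally have eq: "(Q (nq Y) \<odot> roof K M s' f') \<odot> Q s' =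
    (SusA V (roof K M s f) \<odot> Q (nq X)) \<odot> Q s'" .
  have "Q (nq Y) \<odot> roof K M s' f' = SusA V (roof K M s f) \<odot> Q (nq X)"
    by (rule V.iso_cancel_right[OF Q_iso[OF s'S] _ _ _ _ eq]) (use rf ls(1-3) lf(1-3) O c in simp_all)
  then show "Q (nq (Cod K f)) \<odot> roof K M s' f' = SusA V (roof K M s f) \<odot> Q (nq (Cod K s))"
    unfolding a .
qed

lemma D_SusA:
  assumes "c \<in> Arr V"
  obtains c' where "c' \<in> Arr V" "Dom V c' = Cod K (pR (Dom V c))" "Cod V c' = Cod K (pR (Cod V c))"
    "SusA D (roof_map c) = roof_map c'" "Q (nq (Cod V c)) \<odot> c' = SusA V c \<odot> Q (nq (Dom V c))"
proof -
  obtain s f where c: "(s, f) \<in> roofs K M" "c = roof K M s f" using assms by (rule V_ArrE)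
  note u = c(1)[unfolded roofs_iff]
  obtain e s' where s': "tri_mor K (R (Dom K s)) (R (Cod K s)) (s, e, s')" using lift_ex[of s] u by auto
  obtain e' f' where f': "tri_mor K (R (Dom K f)) (R (Cod K f)) (f, e', f')" using lift_ex[of f] u by auto
  note l = lift_roof[OF c(1) s' f']
  have lc: "Cod K s' = Cod K (pR (Cod K s))" "Cod K f' = Cod K (pR (Cod K f))"
    using lift_simps(3)[OF s'] lift_simps(3)[OF f'] u by auto
  have "SusA D (roof_map c) = roof_map (roof K M s' f')"
    unfolding verdier_simps(10)[of KE]
  proof (rule the_elem_eqI, goal_cases)
    case 1
    have "roof_map (roof K M s' f') = roof KE M (SusA KE (cl s)) (SusA KE (cl f))"
      using roof_map_roof[OF l(1)] KE_SusA[OF s'] KE_SusA[OF f'] u by simp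
    moreover have "(cl s, cl f) \<in> roof_map c" unfolding c(2) by (rule roof_map_memI[OF c(1)])
    ultimately show ?case by blast
  next
    case (2 y)
    then obtain A F where y: "y = roof KE M (SusA KE A) (SusA KE F)" and mem: "(A, F) \<in> roof_map c" by blast
    obtain t g where t: "(t, g) \<in> roofs K M" "c = roof K M t g" "A = cl t" "F = cl g"
      using mem assms by (rule roof_map_memE)
    note v = t(1)[unfolded roofs_iff]
    obtain e1 t' where t': "tri_mor K (R (Dom K t)) (R (Cod K t)) (t, e1, t')" using lift_ex[of t] v by auto
    obtain e2 g' where g': "tri_mor K (R (Dom K g)) (R (Cod K g)) (g, e2, g')" using lift_ex[of g] v by auto
    note k = lift_roof[OF t(1) t' g']
    have kc: "Cod K t' = Cod K (pR (Cod K t))" "Cod K g' = Cod K (pR (Cod K g))"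
      using lift_simps(3)[OF t'] lift_simps(3)[OF g'] v by auto
    have ends: "Cod K t = Cod K s" "Cod K g = Cod K f"
      using roof_Arr(2,3)[OF t(1)] roof_Arr(2,3)[OF c(1)] t(2) c(2) by simp_all
    have eq: "Q (nq (Cod K f)) \<odot> roof K M t' g' = Q (nq (Cod K f)) \<odot> roof K M s' f'"
      using k(2) l(2) t(2) c(2) ends by simp
    have O: "Cod K f \<in> Obj K" using u by simp
    have "roof K M t' g' = roof K M s' f'"
      by (rule V.iso_cancel_left[OF Q_iso[OF nq_S[OF O]] _ _ _ _ eq]) (use k(1) l(1) kc lc ends O in simp_all)
    then have "roof_map (roof K M s' f') = roof KE M (cl t') (cl g')" using roof_map_roof[OF k(1)] by simp
    then show ?case unfolding y t(3,4) using KE_SusA[OF t'] KE_SusA[OF g'] v by simp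
  qed
  then show ?thesis
    using l lc c by (intro that[of "roof K M s' f'"]) simp_all
qed

lemma nq_inv_natural:
  assumes "c \<in> Arr V" "c' \<in> Arr V" "Dom V c' = Cod K (pR (Dom V c))" "Cod V c' = Cod K (pR (Cod V c))"
    "Q (nq (Cod V c)) \<odot> c' = SusA V c \<odot> Q (nq (Dom V c))"
  shows "nq_inv (Cod V c) \<odot> SusA V c = c' \<odot> nq_inv (Dom V c)"
proof -
  define X where "X = Dom V c"
  define Y where "Y = Cod V c"
  have O: "X \<in> Obj K" "Y \<in> Obj K" using V.Dom_Obj[OF assms(1)] V.Cod_Obj[OF assms(1)] by (simp_all add: X_def Y_def)
  have c: "c \<in> Arr V" "Dom V c = X" "Cod V c = Y" "c' \<in> Arr V" "Dom V c' = Cod K (pR X)" "Cod V c' = Cod K (pR Y)"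
    using assms(1-4) by (simp_all add: X_def Y_def)
  have e: "Q (nq Y) \<odot> c' = SusA V c \<odot> Q (nq X)" using assms(5) by (simp add: X_def Y_def)
  note n = nq_inv[OF O(1)] nq_inv[OF O(2)]
  have "c' \<odot> nq_inv X = nq_inv Y \<odot> (Q (nq Y) \<odot> (c' \<odot> nq_inv X))"
    using V.Cmp_reassoc1[OF n(10), of "c' \<odot> nq_inv X"] c n(1-3,7-9) O by simp
  also have "Q (nq Y) \<odot> (c' \<odot> nq_inv X) = SusA V c \<odot> (Q (nq X) \<odot> nq_inv X)"
    by (rule V.Cmp_reassoc[OF e]) (use c n(1-3,7-9) O in simp_all)
  also have "\<dots> = SusA V c" unfolding n(5) using c O by simp
  finally show ?thesis unfolding X_def[symmetric] Y_def[symmetric] by (rule sym)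
qed

lemma roof_map_Q: "f \<in> Arr K \<Longrightarrow> roof_map (Q f) = FA (verdier_fctr KE M) (cl f)"
  by (simp add: verdier_fctr_def roof_map_roof)

lemma roof_map_additive: "is_additive V D roof_fctr"
proof -
  have "roof_map \<in> hom (hom_group V X Y) (hom_group D X Y)" for X Y
    unfolding hom_def hom_group_def using D_Add by (auto simp: Hom_def)
  then show ?thesis
    using roof_map_equivalence unfolding is_additive_def is_equivalence_def by simp
qed

text \<open>The natural isomorphism is the inverse of \<open>-q\<close>. A triangle of \<open>V\<close> is, up to isomorphism, the
  image of a triangle on some \<open>f\<close> in \<open>K\<close>, and the comparison map \<open>c\<close> identifies the image of the
  latter with that of a standard triangle on \<open>f\<close>.\<close>

lemma roof_map_exact: "is_exact V D roof_fctr"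
  unfolding is_exact_def
proof (intro conjI exI[of _ "\<lambda>X. roof_map (nq_inv X)"] allI impI)
  show "is_additive V D roof_fctr" by (rule roof_map_additive)
  show "natural_iso V D (roof_fctr \<circ>\<circ> susp_fctr V) (susp_fctr D \<circ>\<circ> roof_fctr)
      (\<lambda>X. roof_map (nq_inv X))"
    unfolding natural_iso_def
  proof (intro conjI ballI)
    fix X assume "X \<in> Obj V"
    then have X: "X \<in> Obj K" by simp
    note n = nq_inv[OF X]
    show "roof_map (nq_inv X) \<in> Hom D (FO (roof_fctr \<circ>\<circ> susp_fctr V) X)
        (FO (susp_fctr D \<circ>\<circ> roof_fctr) X)"
      using n(1-3) by (simp add: Hom_def comp_fctr_def susp_fctr_def)
    show "is_iso D (roof_map (nq_inv X))" by (rule roof_map_iso[OF n(6)])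
  next
    fix c assume c: "c \<in> Arr V"
    obtain c' where c': "c' \<in> Arr V" "Dom V c' = Cod K (pR (Dom V c))" "Cod V c' = Cod K (pR (Cod V c))"
      "SusA D (roof_map c) = roof_map c'" "Q (nq (Cod V c)) \<odot> c' = SusA V c \<odot> Q (nq (Dom V c))"
      using c by (rule D_SusA)
    have O: "Dom V c \<in> Obj K" "Cod V c \<in> Obj K" using V.Dom_Obj[OF c] V.Cod_Obj[OF c] by simp_all
    note n = nq_inv(1-3)[OF O(1)] nq_inv(1-3)[OF O(2)]
    have "roof_map (nq_inv (Cod V c)) \<cdot>\<^bsub>D\<^esub> roof_map (SusA V c) = roof_map (nq_inv (Cod V c) \<odot> SusA V c)"
      by (rule D_Cmp) (use c n in simp_all)
    also have "\<dots> = roof_map (c' \<odot> nq_inv (Dom V c))" using nq_inv_natural[OF c c'(1-3,5)] by simp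
    also have "\<dots> = roof_map c' \<cdot>\<^bsub>D\<^esub> roof_map (nq_inv (Dom V c))"
      by (rule D_Cmp[symmetric]) (use c'(1-3) n in simp_all)
    finally show "roof_map (nq_inv (Cod V c)) \<cdot>\<^bsub>D\<^esub> FA (roof_fctr \<circ>\<circ> susp_fctr V) c =
        FA (susp_fctr D \<circ>\<circ> roof_fctr) c \<cdot>\<^bsub>D\<^esub> roof_map (nq_inv (Dom V c))"
      by (simp add: comp_fctr_def susp_fctr_def c'(4))
  qed
next
  fix c1 c2 c3 assume "(c1, c2, c3) \<in> Tri V"
  then obtain f g h where tri: "is_triangle V (c1, c2, c3)" and T: "(f, g, h) \<in> Tri K"
    and iso: "tri_isomorphic V (Q f, Q g, Q h) (c1, c2, c3)"
    unfolding verdier_def Tri_with_triangles by blast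
  then obtain a b e where m: "tri_mor V (Q f, Q g, Q h) (c1, c2, c3) (a, b, e)"
    and isos: "is_iso V a" "is_iso V b" "is_iso V e"
    unfolding tri_isomorphic_def by blast
  obtain z g' h' w c where st: "homotopy_cartesian K (iR (Dom K f)) f z g'" "(g', h', w) \<in> Tri K"
    "tri_mor K (R (Dom K f)) (g', h', w) (f, z, Ide K (Cod K (pR (Dom K f))))"
    and c: "c \<in> S" "Dom K c = Cod K g'" "Cod K c = Cod K g" "c \<cdot> g' = g" "h \<cdot> c = nq (Dom K f) \<cdot> h'"
    by (rule standard_triangle_comparison[OF T])
  define X where "X = Dom K f"
  define X1 where "X1 = Dom V c1"
  note t = TriD[OF T] TriD[OF st(2)]
  have fX: "Dom K f = X" by (simp add: X_def)
  have O: "X \<in> Obj K" using t by (simp add: X_def)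
  have g': "Dom K g' = Cod K f" using st(1) unfolding homotopy_cartesian_def by simp
  have "Ide K (Cod K (pR X)) \<in> Hom K (Dom K (qR X)) (Dom K w)"
    using st(3) unfolding fX R_eq[of X] tri_mor.simps by blast
  then have h': "Cod K h' = Cod K (pR X)" using t O by simp
  have cc: "c1 \<in> Arr V" "c2 \<in> Arr V" "c3 \<in> Arr V" "Dom V c2 = Cod V c1" "Dom V c3 = Cod V c2"
    "Cod V c3 = Sus K X1" "Dom V c1 = X1" using tri by (simp_all add: X1_def)
  have O1: "X1 \<in> Obj K" using V.Dom_Obj[OF cc(1)] by (simp add: X1_def)
  have abe: "a \<in> Arr V" "Dom V a = X" "Cod V a = X1" "b \<in> Arr V" "Dom V b = Cod K f" "Cod V b = Cod V c1"
    "e \<in> Arr V" "Dom V e = Cod K g" "Cod V e = Cod V c2"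
    and sq: "b \<odot> Q f = c1 \<odot> a" "e \<odot> Q g = c2 \<odot> b" "SusA V a \<odot> Q h = c3 \<odot> e"
    using m t(1-6) cc by (simp_all add: fX)
  obtain a' where a': "a' \<in> Arr V" "Dom V a' = Cod K (pR X)" "Cod V a' = Cod K (pR X1)"
      "SusA D (roof_map a) = roof_map a'" "Q (nq X1) \<odot> a' = SusA V a \<odot> Q (nq X)"
    using D_SusA[OF abe(1)] abe(2,3) by metis
  note n = nq_inv[OF O1]
  note ty = cc abe a'(1-3) n(1-3) t g' h' c(1-3) O O1 fX
  have eQ: "(e \<odot> Q c) \<odot> Q g' = c2 \<odot> b"
  proof -
    have "(e \<odot> Q c) \<odot> Q g' = e \<odot> (Q c \<odot> Q g')" using ty by simp
    also have "Q c \<odot> Q g' = Q g" unfolding c(4)[symmetric] by (rule Q_Cmp[symmetric]) (use ty in simp_all)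
    finally show ?thesis using sq(2) by simp
  qed
  have third: "a' \<odot> Q h' = (nq_inv X1 \<odot> c3) \<odot> (e \<odot> Q c)"
  proof -
    have hc: "Q (nq X) \<odot> Q h' = Q h \<odot> Q c"
    proof -
      have "Q (nq X) \<odot> Q h' = Q (nq X \<cdot> h')" by (rule Q_Cmp[symmetric]) (use ty in simp_all)
      also have "\<dots> = Q (h \<cdot> c)" using c(5) fX by simp
      also have "\<dots> = Q h \<odot> Q c" by (rule Q_Cmp) (use ty in simp_all)
      finally show ?thesis .
    qed
    have "Q (nq X1) \<odot> (a' \<odot> Q h') = SusA V a \<odot> (Q (nq X) \<odot> Q h')"
      by (rule V.Cmp_reassoc[OF a'(5)]) (use ty in simp_all)
    also have "\<dots> = SusA V a \<odot> (Q h \<odot> Q c)" by (simp only: hc)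
    also have "\<dots> = c3 \<odot> (e \<odot> Q c)" by (rule V.Cmp_reassoc[OF sq(3)]) (use ty in simp_all)
    finally have 1: "Q (nq X1) \<odot> (a' \<odot> Q h') = c3 \<odot> (e \<odot> Q c)" .
    have "a' \<odot> Q h' = Ide V (Cod K (pR X1)) \<odot> (a' \<odot> Q h')" using ty by simp
    also have "\<dots> = nq_inv X1 \<odot> (Q (nq X1) \<odot> (a' \<odot> Q h'))"
      by (rule V.Cmp_reassoc1[OF n(4), symmetric]) (use ty in simp_all)
    also have "\<dots> = (nq_inv X1 \<odot> c3) \<odot> (e \<odot> Q c)" unfolding 1 using ty by simp
    finally show ?thesis .
  qed
  let ?U = "(roof_map (Q f), roof_map (Q g'), roof_map (Q h'))"
  let ?T = "(roof_map c1, roof_map c2, roof_map (nq_inv X1) \<cdot>\<^bsub>D\<^esub> roof_map c3)"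
  have n3: "roof_map (nq_inv X1) \<cdot>\<^bsub>D\<^esub> roof_map c3 = roof_map (nq_inv X1 \<odot> c3)"
    by (rule D_Cmp) (use ty in simp_all)
  have "tri_mor D ?U ?T (roof_map a, roof_map b, roof_map (e \<odot> Q c))"
    unfolding n3 tri_mor.simps
  proof (intro conjI)
    show "roof_map b \<cdot>\<^bsub>D\<^esub> roof_map (Q f) = roof_map c1 \<cdot>\<^bsub>D\<^esub> roof_map a"
      by (subst (1 2) D_Cmp) (use ty sq(1) in simp_all)
    show "roof_map (e \<odot> Q c) \<cdot>\<^bsub>D\<^esub> roof_map (Q g') = roof_map c2 \<cdot>\<^bsub>D\<^esub> roof_map b"
    proof -
      have "roof_map (e \<odot> Q c) \<cdot>\<^bsub>D\<^esub> roof_map (Q g') = roof_map ((e \<odot> Q c) \<odot> Q g')"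
        by (rule D_Cmp) (use ty in simp_all)
      also have "\<dots> = roof_map c2 \<cdot>\<^bsub>D\<^esub> roof_map b" unfolding eQ by (rule D_Cmp[symmetric]) (use ty in simp_all)
      finally show ?thesis .
    qed
    show "SusA D (roof_map a) \<cdot>\<^bsub>D\<^esub> roof_map (Q h') = roof_map (nq_inv X1 \<odot> c3) \<cdot>\<^bsub>D\<^esub> roof_map (e \<odot> Q c)"
    proof -
      have "SusA D (roof_map a) \<cdot>\<^bsub>D\<^esub> roof_map (Q h') = roof_map (a' \<odot> Q h')"
        unfolding a'(4) by (rule D_Cmp) (use ty in simp_all)
      also have "\<dots> = roof_map (nq_inv X1 \<odot> c3) \<cdot>\<^bsub>D\<^esub> roof_map (e \<odot> Q c)"
        unfolding third by (rule D_Cmp[symmetric]) (use ty in simp_all)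
      finally show ?thesis .
    qed
  qed (use ty in \<open>simp_all add: Hom_def\<close>)
  moreover have "is_iso V (e \<odot> Q c)" by (rule V.is_iso_Cmp[OF Q_iso[OF c(1)] isos(3)]) (use ty in simp)
  ultimately have iso: "tri_isomorphic D ?U ?T"
    unfolding tri_isomorphic_def using isos roof_map_iso by blast
  have T0: "?U = (FA (verdier_fctr KE M) (cl f), FA (verdier_fctr KE M) (cl g'), FA (verdier_fctr KE M) (cl h'))"
    using ty by (simp add: roof_map_Q)
  have std: "(cl f, cl g', cl h') \<in> Tri KE" by (rule standard_in_Tri_KE[OF _ st]) (use ty in simp)
  have "is_triangle D ?T" unfolding n3 using ty by simp
  with iso T0 std have "?T \<in> Tri D"
    unfolding verdier_def Tri_with_triangles by blast
  then show "(FA roof_fctr c1, FA roof_fctr c2,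
      roof_map (nq_inv (Dom V c1)) \<cdot>\<^bsub>D\<^esub> FA roof_fctr c3) \<in> Tri D"
    by (simp add: X1_def)
qed

section \<open>The induced functor\<close>

lemma roof_map_extends:
  "fctr_eq K (roof_fctr \<circ>\<circ> verdier_fctr K M) (verdier_fctr KE M \<circ>\<circ> stable_fctr K E)"
  unfolding fctr_eq_def comp_fctr_def
  by (simp add: roof_map_Q) (simp add: verdier_fctr_def stable_fctr_def)

text \<open>Every arrow of \<open>V\<close> is a fraction of arrows in the image of \<open>Q\<close>.\<close>

lemma roof_map_unique:
  assumes G: "is_functor V D G"
    and eq: "fctr_eq K (G \<circ>\<circ> verdier_fctr K M) (verdier_fctr KE M \<circ>\<circ> stable_fctr K E)"
  shows "fctr_eq V G roof_fctr"
proof -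
  have GO: "FO G X = X" if "X \<in> Obj K" for X
    using eq that unfolding fctr_eq_def comp_fctr_def by (simp add: verdier_fctr_def stable_fctr_def)
  have GQ: "FA G (Q f) = roof_map (Q f)" if "f \<in> Arr K" for f
    using eq that unfolding fctr_eq_def comp_fctr_def by (simp add: roof_map_Q stable_fctr_def)
  have GA: "FA G c \<in> Hom D (FO G (Dom V c)) (FO G (Cod V c))" if "c \<in> Arr V" for c
    using G that unfolding is_functor_def by blast
  have GC: "FA G (d \<odot> c) = FA G d \<cdot>\<^bsub>D\<^esub> FA G c" if "c \<in> Arr V" "d \<in> Arr V" "Cod V c = Dom V d" for c d
    using G that unfolding is_functor_def by blast
  have "FA G c = roof_map c" if c: "c \<in> Arr V" for c
  proof -
    obtain s f where sf: "(s, f) \<in> roofs K M" "c = roof K M s f" using c by (rule V_ArrE)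
    note u = sf(1)[unfolded roofs_iff]
    have d: "Dom V c = Cod K s" "Cod V c = Cod K f" using sf by simp_all
    have "FA G c \<cdot>\<^bsub>D\<^esub> roof_map (Q s) = FA G (c \<odot> Q s)"
      using GC[of "Q s" c] GQ[of s] c u d by simp
    also have "\<dots> = FA G (Q f)" unfolding sf(2) roof_fraction[OF sf(1)] ..
    also have "\<dots> = roof_map (c \<odot> Q s)" unfolding sf(2) roof_fraction[OF sf(1)] using GQ u by simp
    also have "\<dots> = roof_map c \<cdot>\<^bsub>D\<^esub> roof_map (Q s)" by (rule D_Cmp[symmetric]) (use c u d in simp_all)
    finally have e: "FA G c \<cdot>\<^bsub>D\<^esub> roof_map (Q s) = roof_map c \<cdot>\<^bsub>D\<^esub> roof_map (Q s)" .
    have "FA G c \<in> Arr D" "Dom D (FA G c) = Cod K s"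
      using GA[OF c] GO[of "Dom V c"] d u by (simp_all add: Hom_def)
    then show ?thesis
      by (intro category.iso_cancel_right[OF D_category roof_map_iso[OF Q_iso] _ _ _ _ e]) (use u c d in simp_all)
  qed
  then show ?thesis unfolding fctr_eq_def using GO by simp
qed

end

theorem corollary5p10:
  fixes K :: "('o, 'm) tricat"
    and E :: "'m triangle set"
    and R :: "'o \<Rightarrow> 'm triangle"
    and M \<pi>M :: "'o set"
    and \<K>E :: "('o, 'm set) tricat"
    and \<pi> :: "('o, 'm, 'o, 'm set) fctr"
  assumes "triangulated_category K"
    and "frobenius_class K E"
    and "injective_choice K E R"
    and "\<K>E = relative_stable K E R"
    and "\<pi> = stable_fctr K E"
    and "M = thick_closure K (E_proj K E)"
    and "\<pi>M = FO \<pi> ` M"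
  shows "thick \<K>E \<pi>M \<and>
         (\<exists>F. is_functor (verdier K M) (verdier \<K>E \<pi>M) F \<and>
             fctr_eq K (F \<circ>\<circ> verdier_fctr K M) (verdier_fctr \<K>E \<pi>M \<circ>\<circ> \<pi>) \<and>
             (\<forall>G. is_functor (verdier K M) (verdier \<K>E \<pi>M) G \<and>
                  fctr_eq K (G \<circ>\<circ> verdier_fctr K M) (verdier_fctr \<K>E \<pi>M \<circ>\<circ> \<pi>) \<longrightarrow>
                  fctr_eq (verdier K M) G F) \<and>
             is_equivalence (verdier K M) (verdier \<K>E \<pi>M) F \<and>
             is_exact (verdier K M) (verdier \<K>E \<pi>M) F)"
proof -
  interpret frobenius_stable K E R
    using assms(1-3) by (intro frobenius_stable.intro frobenius_stable_axioms.intro)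
  have \<pi>M: "\<pi>M = M" using assms(5,7) by (simp add: stable_fctr_def)
  show ?thesis
    unfolding \<pi>M assms(4-6)
    using thick_KE_M roof_map_equivalence roof_map_exact roof_map_extends roof_map_unique
    by (intro conjI exI[of _ "roof_fctr"]) (auto simp: is_equivalence_def)
qed

end
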